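(* Assume that the projection $\pi:\mathfrak R\to\widehat{\mathbb C}$ is such that all its critical points are of the first order (i.e. simple: $\pi$ has local degree $2$ at each of them) and that for each $z\in\widehat{\mathbb C}$ there is at most one critical point of $\pi$ in the set $\pi^{-1}(z)$. Then all the surfaces $\widetilde{\mathfrak R}_{[k]}$, $k=1,\dots,m$, are connected.
   Context: $\mathfrak R$ is a compact connected Riemann surface, $\pi:\mathfrak R\to\widehat{\mathbb C}$ an $(m+1)$-sheeted holomorphic branched covering of the Riemann sphere, $m\ge1$, and $\Sigma$ the set of critical values of $\pi$. The surface $\widetilde{\mathfrak R}_{[k]}$. Regard $\pi^{-1}(\cdot)$ as an $(m+1)$-valued global analytic function on $\widehat{\mathbb C}\setminus\Sigma$. Let $\widetilde{\mathfrak R}'_{[k]}$ be the set of pairs $(z,\{w_1^z,\dots,w_k^z\})$, where $z\in\widehat{\mathbb C}\setminus\Sigma$ and $\{w^z_1,\dots,w^z_k\}$ is an unordered collection of $k$ distinct germs of this function at $z$, with the Riemann surface structure given by analytic continuation of germs; it is a $\binom{m+1}{k}$-sheeted (possibly disconnected) unbranched covering of $\widehat{\mathbb C}\setminus\Sigma$. $\widetilde{\mathfrak R}_{[k]}$ is its standard compactification, a compact (possibly disconnected) Riemann surface. *)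

theory Defs
  imports "HOL-Complex_Analysis.Complex_Analysis"
begin

section \<open>Riemann surfaces and holomorphic maps\<close>

record 'a surface =
  surf_top :: "'a topology"
  surf_charts :: "('a set \<times> ('a \<Rightarrow> complex)) set"

definition riemann_surface :: "'a surface \<Rightarrow> bool" where
  "riemann_surface S \<longleftrightarrow>
     Hausdorff_space (surf_top S) \<and>
     (\<Union>(U, \<phi>)\<in>surf_charts S. U) = topspace (surf_top S) \<and>
     (\<forall>(U, \<phi>)\<in>surf_charts S.
        openin (surf_top S) U \<and> open (\<phi> ` U) \<and>
        homeomorphic_map (subtopology (surf_top S) U) (top_of_set (\<phi> ` U)) \<phi>) \<and>
     (\<forall>(U, \<phi>)\<in>surf_charts S. \<forall>(V, \<psi>)\<in>surf_charts S.
        (\<psi> \<circ> inv_into U \<phi>) holomorphic_on \<phi> ` (U \<inter> V))"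

definition riemann_sphere :: "complex option surface" where
  "riemann_sphere =
     \<lparr>surf_top = Alexandroff_compactification euclidean,
      surf_charts = {(range Some, the),
                     (- {Some 0}, \<lambda>z. case z of None \<Rightarrow> 0 | Some w \<Rightarrow> inverse w)}\<rparr>"

definition holomorphic_map_on :: "'a surface \<Rightarrow> 'b surface \<Rightarrow> 'a set \<Rightarrow> ('a \<Rightarrow> 'b) \<Rightarrow> bool" where
  "holomorphic_map_on S T D f \<longleftrightarrow>
     openin (surf_top S) D \<and>
     continuous_map (subtopology (surf_top S) D) (surf_top T) f \<and>
     (\<forall>(U, \<phi>)\<in>surf_charts S. \<forall>(V, \<psi>)\<in>surf_charts T.
        (\<psi> \<circ> f \<circ> inv_into U \<phi>) holomorphic_on \<phi> ` (U \<inter> D \<inter> f -` V))"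

text \<open>The order of vanishing of \<open>f - f(p)\<close> at \<open>p\<close> in local coordinates; for holomorphic \<open>f\<close>,
  not constant near \<open>p\<close>, it does not depend on the charts.\<close>

definition local_degree :: "'a surface \<Rightarrow> 'b surface \<Rightarrow> ('a \<Rightarrow> 'b) \<Rightarrow> 'a \<Rightarrow> nat" where
  "local_degree S T f p =
     (THE n. \<forall>(U, \<phi>)\<in>surf_charts S. \<forall>(V, \<psi>)\<in>surf_charts T. p \<in> U \<and> f p \<in> V \<longrightarrow>
        zorder (\<lambda>\<zeta>. \<psi> (f (inv_into U \<phi> \<zeta>)) - \<psi> (f p)) (\<phi> p) = int n)"

definition critical_points :: "'a surface \<Rightarrow> 'b surface \<Rightarrow> ('a \<Rightarrow> 'b) \<Rightarrow> 'a set" where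
  "critical_points S T f = {p \<in> topspace (surf_top S). 2 \<le> local_degree S T f p}"

definition critical_values :: "'a surface \<Rightarrow> 'b surface \<Rightarrow> ('a \<Rightarrow> 'b) \<Rightarrow> 'b set" where
  "critical_values S T f = f ` critical_points S T f"

definition regular_values :: "'a surface \<Rightarrow> 'b surface \<Rightarrow> ('a \<Rightarrow> 'b) \<Rightarrow> 'b set" where
  "regular_values S T f = topspace (surf_top T) - critical_values S T f"

definition fibre :: "'a surface \<Rightarrow> ('a \<Rightarrow> 'b) \<Rightarrow> 'b \<Rightarrow> 'a set" where
  "fibre S f z = {p \<in> topspace (surf_top S). f p = z}"

text \<open>Finiteness of the fibres also expresses that the map is not constant on any component.\<close>

definition branched_covering :: "'a surface \<Rightarrow> 'b surface \<Rightarrow> ('a \<Rightarrow> 'b) \<Rightarrow> nat \<Rightarrow> bool" where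
  "branched_covering S T f n \<longleftrightarrow>
     holomorphic_map_on S T (topspace (surf_top S)) f \<and>
     proper_map (surf_top S) (surf_top T) f \<and>
     (\<forall>z\<in>topspace (surf_top T).
        finite (fibre S f z) \<and> (\<Sum>p\<in>fibre S f z. local_degree S T f p) = n)"


section \<open>The unbranched covering by unordered tuples of germs of the inverse\<close>

definition germ :: "'b surface \<Rightarrow> 'b \<Rightarrow> ('b \<Rightarrow> 'a) \<Rightarrow> ('b \<Rightarrow> 'a) set" where
  "germ T z s = {t. \<exists>U. openin (surf_top T) U \<and> z \<in> U \<and> (\<forall>x\<in>U. t x = s x)}"

text \<open>The holomorphic branches on \<open>U\<close> of the multivalued inverse of \<open>f\<close>.\<close>

definition inverse_branches ::
  "'a surface \<Rightarrow> 'b surface \<Rightarrow> ('a \<Rightarrow> 'b) \<Rightarrow> 'b set \<Rightarrow> ('b \<Rightarrow> 'a) set" where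
  "inverse_branches S T f U = {s. holomorphic_map_on T S U s \<and> (\<forall>x\<in>U. f (s x) = x)}"

definition inverse_germs ::
  "'a surface \<Rightarrow> 'b surface \<Rightarrow> ('a \<Rightarrow> 'b) \<Rightarrow> 'b \<Rightarrow> ('b \<Rightarrow> 'a) set set" where
  "inverse_germs S T f z =
     {germ T z s | U s. z \<in> U \<and> s \<in> inverse_branches S T f U}"

type_synonym ('a, 'b) germ_tuple = "'b \<times> ('b \<Rightarrow> 'a) set set"

definition germ_tuples ::
  "'a surface \<Rightarrow> 'b surface \<Rightarrow> ('a \<Rightarrow> 'b) \<Rightarrow> nat \<Rightarrow> ('a, 'b) germ_tuple set" where
  "germ_tuples S T f k =
     {(z, W). z \<in> regular_values S T f \<and>
              W \<subseteq> inverse_germs S T f z \<and> finite W \<and> card W = k}"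

text \<open>\<open>F\<close> is a set of \<open>k\<close> branches on \<open>U\<close> whose germs are pairwise distinct at every point of
  \<open>U\<close>; continuing them over \<open>U\<close> sweeps out the sheet \<open>germ_sheet T U F\<close>.\<close>

definition branch_tuple ::
  "'a surface \<Rightarrow> 'b surface \<Rightarrow> ('a \<Rightarrow> 'b) \<Rightarrow> nat \<Rightarrow> 'b set \<Rightarrow> ('b \<Rightarrow> 'a) set \<Rightarrow> bool" where
  "branch_tuple S T f k U F \<longleftrightarrow>
     openin (surf_top T) U \<and> U \<subseteq> regular_values S T f \<and>
     F \<subseteq> inverse_branches S T f U \<and> finite F \<and> card F = k \<and>
     (\<forall>x\<in>U. inj_on (germ T x) F)"

definition germ_sheet :: "'b surface \<Rightarrow> 'b set \<Rightarrow> ('b \<Rightarrow> 'a) set \<Rightarrow> ('a, 'b) germ_tuple set" where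
  "germ_sheet T U F = (\<lambda>x. (x, germ T x ` F)) ` U"

definition germ_surface ::
  "'a surface \<Rightarrow> 'b surface \<Rightarrow> ('a \<Rightarrow> 'b) \<Rightarrow> nat \<Rightarrow> ('a, 'b) germ_tuple surface" where
  "germ_surface S T f k =
     \<lparr>surf_top = subtopology
        (topology_generated_by {germ_sheet T U F | U F. branch_tuple S T f k U F})
        (germ_tuples S T f k),
      surf_charts = {(germ_sheet T U F, \<phi> \<circ> fst) | U F V \<phi>.
        branch_tuple S T f k U F \<and> (V, \<phi>) \<in> surf_charts T \<and> U \<subseteq> V}\<rparr>"


section \<open>The standard compactification\<close>

text \<open>Let \<open>p\<close> map \<open>Y\<close> to \<open>T\<close> minus a finite set \<open>B\<close> as a finite unbranched covering.  The
  punctures of \<open>Y\<close> over \<open>b \<in> B\<close> are its ends over \<open>b\<close>: coherent choices, for all open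
  neighbourhoods \<open>V\<close> of \<open>b\<close>, of a component of the part of \<open>Y\<close> over \<open>V - B\<close>.  When \<open>V\<close> is a
  small disc, these components are the punctured discs that have to be filled in.\<close>

definition components_over ::
  "'y surface \<Rightarrow> ('y \<Rightarrow> 'b) \<Rightarrow> 'b set \<Rightarrow> 'b set \<Rightarrow> 'y set set" where
  "components_over Y p B V =
     connected_components_of
       (subtopology (surf_top Y) {y \<in> topspace (surf_top Y). p y \<in> V - B})"

definition ends_over ::
  "'y surface \<Rightarrow> 'b surface \<Rightarrow> ('y \<Rightarrow> 'b) \<Rightarrow> 'b set \<Rightarrow> 'b \<Rightarrow> ('b set \<Rightarrow> 'y set) set" where
  "ends_over Y T p B b =
     {e \<in> (\<Pi>\<^sub>E V\<in>{V. openin (surf_top T) V \<and> b \<in> V}. components_over Y p B V).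
        \<forall>V V'. openin (surf_top T) V \<and> openin (surf_top T) V' \<and> b \<in> V \<and> V \<subseteq> V' \<longrightarrow>
          e V \<subseteq> e V'}"

type_synonym ('y, 'b) filled = "'y + 'b \<times> ('b set \<Rightarrow> 'y set)"

definition filled_topology ::
  "'y surface \<Rightarrow> 'b surface \<Rightarrow> ('y \<Rightarrow> 'b) \<Rightarrow> 'b set \<Rightarrow> ('y, 'b) filled topology" where
  "filled_topology Y T p B =
     topology_generated_by
       ({Inl ` U | U. openin (surf_top Y) U} \<union>
        {Inl ` C \<union> {Inr (b, e) | e. e \<in> ends_over Y T p B b \<and> e V = C} | C b V.
           b \<in> B \<and> openin (surf_top T) V \<and> b \<in> V \<and> C \<in> components_over Y p B V})"

text \<open>The charts are all local homeomorphisms to the plane that are holomorphic off the added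
  points; this is the maximal atlas of the unique complex structure extending that of \<open>Y\<close>.\<close>

definition fill_punctures ::
  "'y surface \<Rightarrow> 'b surface \<Rightarrow> ('y \<Rightarrow> 'b) \<Rightarrow> 'b set \<Rightarrow> ('y, 'b) filled surface" where
  "fill_punctures Y T p B =
     \<lparr>surf_top = filled_topology Y T p B,
      surf_charts = {(N, \<psi>).
        openin (filled_topology Y T p B) N \<and> open (\<psi> ` N) \<and>
        homeomorphic_map (subtopology (filled_topology Y T p B) N) (top_of_set (\<psi> ` N)) \<psi> \<and>
        (\<forall>(U, \<phi>)\<in>surf_charts Y.
           (\<psi> \<circ> Inl \<circ> inv_into U \<phi>) holomorphic_on \<phi> ` (U \<inter> Inl -` N))}\<rparr>"

definition tuple_surface ::
  "'a surface \<Rightarrow> 'b surface \<Rightarrow> ('a \<Rightarrow> 'b) \<Rightarrow> nat \<Rightarrow> (('a, 'b) germ_tuple, 'b) filled surface" where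
  "tuple_surface S T f k =
     fill_punctures (germ_surface S T f k) T fst (critical_values S T f)"

end

theory Submission
  imports Defs
begin

text \<open>Let \<open>F\<^sub>x\<close> be the fibre of \<open>\<pi>\<close> over a regular value \<open>x\<close>; the unbranched surface consists of
  the pairs \<open>(x, A)\<close> with \<open>A \<subseteq> F\<^sub>x\<close> of size \<open>k\<close>.  Fix a clopen part of it and call two points
  of \<open>F\<^sub>x\<close> related if exchanging them never moves a tuple in or out of that part.  Since
  transpositions satisfy \<open>(a d) = (a b) (b d) (a b)\<close>, this is an equivalence relation, and it is
  locally constant in \<open>x\<close>.  Near a simple critical value the two points of the fibre that come
  together are related, so the classes form an unbranched covering of the whole sphere.  The sphere
  being simply connected, this covering splits into sheets, and as the surface is connected
  there is only one: all points of a fibre are related.  Transpositions act transitively on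
  \<open>k\<close>-subsets, so the clopen part is a union of full fibres and hence trivial.  Finally the
  unbranched surface is dense in its compactification.\<close>

section \<open>Charts and local orders\<close>

text \<open>Classically, the monodromy group is transitive and generated by transpositions, so it is
  the full symmetric group and acts transitively on \<open>k\<close>-subsets. Here no path is lifted
  and no group is formed: once a clopen part is fixed, each appeal to monodromy becomes the
  statement that some Boolean function is locally constant on a connected set. The price is a
  relation that depends on the clopen part. The obstacle is that this relation carries no
  information over critical values, across which the covering by classes must nevertheless extend.
  Hence triviality over an open set \<open>A\<close> only concerns the points above
  \<open>A \<inter> reg\<close>, while \<open>A\<close> itself may contain critical values.
  Extension across a critical value is then the local claim that some full neighbourhood of it is
  trivial, and gluing needs overlaps that stay connected after finitely many points are deleted. The
  quotient by the relation is never built; its sections are represented by their saturated preimages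
  in the surface. The two hypotheses on critical points serve the local claim: they make exactly two
  points of a nearby fibre cluster at the critical point.\<close>

lemma chart_props:
  assumes "riemann_surface S" "(U, \<phi>) \<in> surf_charts S"
  shows "openin (surf_top S) U" "open (\<phi> ` U)" "inj_on \<phi> U" "U \<subseteq> topspace (surf_top S)"
    and "continuous_map (subtopology (surf_top S) U) (top_of_set (\<phi> ` U)) \<phi>"
    and "open_map (subtopology (surf_top S) U) (top_of_set (\<phi> ` U)) \<phi>"
proof -
  have h: "homeomorphic_map (subtopology (surf_top S) U) (top_of_set (\<phi> ` U)) \<phi>"
    and o: "openin (surf_top S) U" and o': "open (\<phi> ` U)"
    using assms unfolding riemann_surface_def by blast+
  show "openin (surf_top S) U" "open (\<phi> ` U)" by fact+
  show sub: "U \<subseteq> topspace (surf_top S)" using o by (rule openin_subset)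
  show "inj_on \<phi> U"
    using homeomorphic_imp_injective_map[OF h] sub by (simp add: inf.absorb2)
  show "continuous_map (subtopology (surf_top S) U) (top_of_set (\<phi> ` U)) \<phi>"
    using h by (rule homeomorphic_imp_continuous_map)
  show "open_map (subtopology (surf_top S) U) (top_of_set (\<phi> ` U)) \<phi>"
    using h by (rule homeomorphic_imp_open_map)
qed

lemma chart_open_image:
  assumes "riemann_surface S" "(U, \<phi>) \<in> surf_charts S" "openin (surf_top S) W" "W \<subseteq> U"
  shows "open (\<phi> ` W)"
proof -
  note c = chart_props[OF assms(1,2)]
  have "openin (subtopology (surf_top S) U) W"
    using assms c by (simp add: openin_open_subtopology)
  then have "openin (top_of_set (\<phi> ` U)) (\<phi> ` W)"
    using c(6) by (simp add: open_map_def)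
  then show ?thesis using c(2) openin_open_eq by blast
qed

lemma chart_open_vimage:
  assumes "riemann_surface S" "(U, \<phi>) \<in> surf_charts S" "open W"
  shows "openin (surf_top S) {p \<in> U. \<phi> p \<in> W}"
proof -
  note c = chart_props[OF assms(1,2)]
  have "openin (top_of_set (\<phi> ` U)) (\<phi> ` U \<inter> W)" using assms(3) by (simp add: openin_open_Int)
  then have "openin (subtopology (surf_top S) U)
      {p \<in> topspace (subtopology (surf_top S) U). \<phi> p \<in> \<phi> ` U \<inter> W}"
    using c(5) openin_continuous_map_preimage by blast
  moreover have "{p \<in> topspace (subtopology (surf_top S) U). \<phi> p \<in> \<phi> ` U \<inter> W} = {p \<in> U. \<phi> p \<in> W}"
    using c(4) by auto
  ultimately show ?thesis using c(1) by (simp add: openin_open_subtopology)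
qed

lemma chart_inv_continuous:
  assumes "riemann_surface S" "(U, \<phi>) \<in> surf_charts S"
  shows "continuous_map (top_of_set (\<phi> ` U)) (surf_top S) (inv_into U \<phi>)"
  unfolding continuous_map_alt
proof (intro conjI allI impI)
  note c = chart_props[OF assms]
  fix W assume W: "openin (surf_top S) W"
  have "inv_into U \<phi> -` W \<inter> topspace (top_of_set (\<phi> ` U)) = \<phi> ` (U \<inter> W)"
    using c(3) by (auto simp: inv_into_f_f)
  moreover have "open (\<phi> ` (U \<inter> W))" using chart_open_image[OF assms, of "U \<inter> W"] W c by auto
  ultimately show "openin (top_of_set (\<phi> ` U)) (inv_into U \<phi> -` W \<inter> topspace (top_of_set (\<phi> ` U)))"
    by (metis (no_types, lifting) Int_lower1 image_mono open_openin openin_subset openin_subtopology_Int2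
      open_subset topspace_euclidean_subtopology inf.absorb_iff2 openin_open_Int)
next
  show "inv_into U \<phi> \<in> topspace (top_of_set (\<phi> ` U)) \<rightarrow> topspace (surf_top S)"
    using chart_props(3,4)[OF assms] by auto
qed

lemma chart_at:
  assumes "riemann_surface S" "p \<in> topspace (surf_top S)"
  obtains U \<phi> where "(U, \<phi>) \<in> surf_charts S" "p \<in> U"
  using assms unfolding riemann_surface_def by blast

lemma transition_holomorphic:
  assumes "riemann_surface S" "(U, \<phi>) \<in> surf_charts S" "(V, \<psi>) \<in> surf_charts S"
  shows "(\<lambda>z. \<psi> (inv_into U \<phi> z)) holomorphic_on \<phi> ` (U \<inter> V)"
  using assms unfolding riemann_surface_def o_def by blast

text \<open>Pull back a round disc about \<open>\<phi> p\<close>: a planar disc stays connected when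
  its centre is removed. This is the local fact behind all later deletions of points, and near a
  critical point the punctured disc replaces the path that exchanges two sheets.\<close>

lemma punctured_disc_neighbourhood:
  assumes "riemann_surface S" "openin (surf_top S) W" "p \<in> W"
  obtains N where "openin (surf_top S) N" "p \<in> N" "N \<subseteq> W" "connectedin (surf_top S) N"
    "connectedin (surf_top S) (N - {p})" "N - {p} \<noteq> {}"
proof -
  have "p \<in> topspace (surf_top S)" using assms openin_subset by blast
  then obtain U \<phi> where U: "(U, \<phi>) \<in> surf_charts S" "p \<in> U" using chart_at assms(1) by metis
  note c = chart_props[OF assms(1) U(1)]
  have "open (\<phi> ` (U \<inter> W))" using chart_open_image[OF assms(1) U(1), of "U \<inter> W"] assms c by auto
  then obtain r where r: "r > 0" "ball (\<phi> p) r \<subseteq> \<phi> ` (U \<inter> W)"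
    using U assms(3) openE by (metis IntI imageI)
  define N where "N = inv_into U \<phi> ` ball (\<phi> p) r"
  have sub: "ball (\<phi> p) r \<subseteq> \<phi> ` U" using r by auto
  have N: "N = {q \<in> U. \<phi> q \<in> ball (\<phi> p) r}"
  proof (intro equalityI subsetI)
    fix q assume "q \<in> N"
    then show "q \<in> {q \<in> U. \<phi> q \<in> ball (\<phi> p) r}"
      using sub unfolding N_def by (auto simp: f_inv_into_f inv_into_into subset_iff)
  next
    fix q assume "q \<in> {q \<in> U. \<phi> q \<in> ball (\<phi> p) r}"
    then have "q = inv_into U \<phi> (\<phi> q)" "\<phi> q \<in> ball (\<phi> p) r" using c(3) by auto
    then show "q \<in> N" unfolding N_def by (rule image_eqI)
  qed
  have ip: "inv_into U \<phi> (\<phi> p) = p" using U c(3) by simp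
  have inj: "inj_on (inv_into U \<phi>) (ball (\<phi> p) r)" using sub by (meson inj_on_inv_into)
  have Np: "N - {p} = inv_into U \<phi> ` (ball (\<phi> p) r - {\<phi> p})"
    unfolding N_def using inj ip r by (subst inj_on_image_set_diff[OF inj]) auto
  have con: "connectedin (surf_top S) (inv_into U \<phi> ` K)" if "connected K" "K \<subseteq> \<phi> ` U" for K
    using connectedin_continuous_map_image[OF chart_inv_continuous[OF assms(1) U(1)]] that
    by (simp add: connectedin_subtopology)
  show thesis
  proof
    show "openin (surf_top S) N" unfolding N by (rule chart_open_vimage[OF assms(1) U(1)]) simp
    show "p \<in> N" using N U r by simp
    show "N \<subseteq> W" using r c(3) unfolding N by (auto simp: inj_on_def dest!: subsetD)
    show "connectedin (surf_top S) N" unfolding N_def by (intro con sub) simp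
    show "connectedin (surf_top S) (N - {p})" unfolding Np
      by (intro con connected_punctured_ball) (use sub in auto)
    have "\<phi> p + of_real (r/2) \<in> ball (\<phi> p) r - {\<phi> p}" using r by (simp add: dist_norm)
    then show "N - {p} \<noteq> {}" unfolding Np by blast
  qed
qed

text \<open>The local order of a function, in the shape that is preserved by coordinate changes.\<close>

definition has_order :: "(complex \<Rightarrow> complex) \<Rightarrow> complex \<Rightarrow> nat \<Rightarrow> bool" where
  "has_order h z n \<longleftrightarrow> (\<exists>r>0. \<exists>g. g holomorphic_on ball z r \<and> g z \<noteq> 0 \<and>
      (\<forall>w\<in>ball z r. h w = h z + g w * (w - z) ^ n))"

section \<open>Calculus of local orders\<close>

lemma has_order_zorder:
  assumes "has_order h z n" shows "zorder (\<lambda>w. h w - h z) z = int n"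
proof -
  obtain r g where *: "r > 0" "g holomorphic_on ball z r" "g z \<noteq> 0"
      "\<forall>w\<in>ball z r. h w = h z + g w * (w - z) ^ n"
    using assms unfolding has_order_def by blast
  have 4: "h w - h z = g w * (w - z) ^ n" if "w \<in> ball z r" for w
    using *(4) that by (metis add_diff_cancel_left')
  show ?thesis
    by (rule zorder_eqI[of "ball z r" _ g]) (use *(1-3) 4 in \<open>auto \<close>)
qed

lemma has_order_cong:
  assumes "has_order h z n" "open W" "z \<in> W" "\<And>w. w \<in> W \<Longrightarrow> h w = h' w"
  shows "has_order h' z n"
proof -
  obtain r g where *: "r > 0" "g holomorphic_on ball z r" "g z \<noteq> 0"
      "\<forall>w\<in>ball z r. h w = h z + g w * (w - z) ^ n"
    using assms(1) unfolding has_order_def by blast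
  obtain e where e: "e > 0" "ball z e \<subseteq> W" using assms openE by blast
  have "g holomorphic_on ball z (min r e)" by (rule holomorphic_on_subset[OF *(2)]) auto
  moreover have "h' w = h' z + g w * (w - z) ^ n" if "w \<in> ball z (min r e)" for w
  proof -
    have "w \<in> ball z r" "w \<in> W" using that e by auto
    then have eq: "h w = h z + g w * (w - z) ^ n" "h' w = h w" "h' z = h z"
      using *(4) assms(3) assms(4)[symmetric] by blast+
    show ?thesis unfolding eq(2,3) by (rule eq(1))
  qed
  ultimately show ?thesis unfolding has_order_def using *(1,3) e(1)
    by (intro exI[of _ "min r e"] exI[of _ g] conjI ballI) (simp, assumption+)
qed

lemma has_order_holomorphic:
  assumes "has_order h z n" shows "h analytic_on {z}"
proof -
  obtain r g where *: "r > 0" "g holomorphic_on ball z r"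
      "\<And>w. w \<in> ball z r \<Longrightarrow> h w = h z + g w * (w - z) ^ n"
    using assms(1) unfolding has_order_def by blast
  have "(\<lambda>w. h z + g w * (w - z) ^ n) holomorphic_on ball z r"
    using *(2) by (intro holomorphic_intros)
  then have "h holomorphic_on ball z r" by (rule holomorphic_transform) (rule *(3)[symmetric])
  then show ?thesis unfolding analytic_at using *(1) by (intro exI[of _ "ball z r"]) auto
qed

text \<open>\<open>\<theta>\<close> and \<open>u\<close> stand for coordinate changes in source and
  target. Inserting their factorisations into that of \<open>h\<close> multiplies the unit factors,
  and only \<open>h\<close> contributes to the exponent.\<close>

lemma has_order_compose:
  assumes "has_order h (\<theta> z) n" "has_order \<theta> z 1" "has_order u (h (\<theta> z)) 1"
  shows "has_order (\<lambda>w. u (h (\<theta> w))) z n"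
proof -
  obtain r1 e where 1: "r1 > 0" "e holomorphic_on ball z r1" "e z \<noteq> 0"
      "\<And>w. w\<in>ball z r1 \<Longrightarrow> \<theta> w = \<theta> z + e w * (w - z)"
    using assms(2) unfolding has_order_def power_one_right by blast
  obtain r2 g where 2: "r2 > 0" "g holomorphic_on ball (\<theta> z) r2" "g (\<theta> z) \<noteq> 0"
      "\<And>w. w\<in>ball (\<theta> z) r2 \<Longrightarrow> h w = h (\<theta> z) + g w * (w - \<theta> z) ^ n"
    using assms(1) unfolding has_order_def by blast
  obtain r3 c where 3: "r3 > 0" "c holomorphic_on ball (h (\<theta> z)) r3" "c (h (\<theta> z)) \<noteq> 0"
      "\<And>w. w\<in>ball (h (\<theta> z)) r3 \<Longrightarrow> u w = u (h (\<theta> z)) + c w * (w - h (\<theta> z))"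
    using assms(3) unfolding has_order_def power_one_right by blast
  \<comment> \<open>The unit factor of the composite: the factor of \<open>u\<close>, that of
    \<open>h\<close>, and the \<open>n\<close>-th power of that of \<open>\<theta>\<close>. All
    three are nonzero at the centre.\<close>
  define G where "G w = c (h (\<theta> w)) * g (\<theta> w) * e w ^ n" for w
  have "g analytic_on {\<theta> z}" "c analytic_on {h (\<theta> z)}" "e analytic_on {z}"
    unfolding analytic_at using 1(1,2) 2(1,2) 3(1,2) centre_in_ball open_ball by blast+
  moreover have "\<theta> analytic_on {z}" "h analytic_on {\<theta> z}"
    using assms[THEN has_order_holomorphic] by auto
  ultimately have ht: "(h \<circ> \<theta>) analytic_on {z}" "(g \<circ> \<theta>) analytic_on {z}" "\<theta> analytic_on {z}" "e analytic_on {z}"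
    by (auto intro!: analytic_on_compose)
  then have "(c \<circ> (h \<circ> \<theta>)) analytic_on {z}"
    using \<open>c analytic_on _\<close> by (auto intro!: analytic_on_compose[of "h \<circ> \<theta>"])
  then have "(\<lambda>w. (c \<circ> (h \<circ> \<theta>)) w * (g \<circ> \<theta>) w * e w ^ n) analytic_on {z}"
    using ht by (intro analytic_intros)
  then have "G analytic_on {z}" by (simp add: G_def[abs_def] o_def)
  then obtain A where A: "open A" "z \<in> A" "G holomorphic_on A" by (auto simp: analytic_at)
  have "isCont \<theta> z" "isCont (h \<circ> \<theta>) z" using ht by (auto intro: analytic_at_imp_isCont)
  then have t: "(\<theta> \<longlongrightarrow> \<theta> z) (nhds z)" "((h \<circ> \<theta>) \<longlongrightarrow> (h \<circ> \<theta>) z) (nhds z)"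
    unfolding isCont_def tendsto_at_iff_tendsto_nhds .
  have "eventually (\<lambda>w. \<theta> w \<in> ball (\<theta> z) r2) (nhds z)"
    using topological_tendstoD[OF t(1) open_ball] 2(1) by simp
  moreover have "eventually (\<lambda>w. (h \<circ> \<theta>) w \<in> ball ((h \<circ> \<theta>) z) r3) (nhds z)"
    using topological_tendstoD[OF t(2) open_ball] 3(1) by simp
  moreover have "eventually (\<lambda>w. w \<in> A) (nhds z)" "eventually (\<lambda>w. w \<in> ball z r1) (nhds z)"
    by (rule eventually_nhds_in_open; use A 1(1) in simp)+
  ultimately have "eventually (\<lambda>w. \<theta> w \<in> ball (\<theta> z) r2 \<and> h (\<theta> w) \<in> ball (h (\<theta> z)) r3 \<and> w \<in> A \<and> w \<in> ball z r1) (nhds z)"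
    unfolding o_def by eventually_elim simp
  then obtain r where r: "r > 0" "\<And>w. w \<in> ball z r \<Longrightarrow> \<theta> w \<in> ball (\<theta> z) r2"
      "\<And>w. w \<in> ball z r \<Longrightarrow> h (\<theta> w) \<in> ball (h (\<theta> z)) r3" "ball z r \<subseteq> A" "ball z r \<subseteq> ball z r1"
    unfolding eventually_nhds_metric by (metis dist_commute mem_ball subsetI)
  show ?thesis unfolding has_order_def
  proof (intro exI[of _ r] exI[of _ G] conjI ballI)
    show "G holomorphic_on ball z r" using A r holomorphic_on_subset by blast
    show "G z \<noteq> 0" using 1(3) 2(3) 3(3) by (simp add: G_def)
    fix w assume w: "w \<in> ball z r"
    have "u (h (\<theta> w)) = u (h (\<theta> z)) + c (h (\<theta> w)) * (h (\<theta> w) - h (\<theta> z))" by (rule 3) (use r w in auto)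
    moreover have "h (\<theta> w) - h (\<theta> z) = g (\<theta> w) * (\<theta> w - \<theta> z) ^ n" using 2(4)[of "\<theta> w"] r w
      by (metis add_diff_cancel_left')
    moreover have "\<theta> w - \<theta> z = e w * (w - z)" using 1(4)[of w] r(5) w
      by (metis add_diff_cancel_left' subsetD)
    ultimately show "u (h (\<theta> w)) = u (h (\<theta> z)) + G w * (w - z) ^ n"
      by (simp add: G_def power_mult_distrib)
  qed (fact r(1))
qed

text \<open>Nonconstancy on every ball prevents \<open>h - h z\<close> from vanishing identically
  near \<open>z\<close>, so its zero at \<open>z\<close> has a finite positive order.\<close>

lemma has_order_exists:
  assumes "h holomorphic_on W" "open W" "z \<in> W" "\<And>r. r > 0 \<Longrightarrow> \<exists>w\<in>ball z r. h w \<noteq> h z"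
  obtains n where "n \<ge> 1" "has_order h z n"
proof -
  obtain e where e: "e > 0" "ball z e \<subseteq> W" using assms openE by blast
  define f where "f = (\<lambda>w. h w - h z)"
  have f: "f holomorphic_on ball z e" unfolding f_def
    using assms(1) e holomorphic_on_subset by (intro holomorphic_intros) auto
  have "\<exists>w\<in>ball z e. f w \<noteq> 0" using assms(4)[OF e(1)] by (auto simp: f_def)
  have "(if f z = 0 then zorder f z > 0 else zorder f z = 0) \<and>
      (\<exists>r>0. cball z r \<subseteq> ball z e \<and> zor_poly f z holomorphic_on cball z r \<and>
        (\<forall>w\<in>cball z r. f w = zor_poly f z w * (w - z) ^ nat (zorder f z) \<and> zor_poly f z w \<noteq> 0))"
    by (rule zorder_exist_zero[OF f _ _ _ \<open>\<exists>w\<in>ball z e. f w \<noteq> 0\<close>]) (use e in auto)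
  moreover have "f z = 0" by (simp add: f_def)
  ultimately obtain r where
    r: "zorder f z > 0" "r > 0" "cball z r \<subseteq> ball z e" "zor_poly f z holomorphic_on cball z r"
       "\<And>w. w \<in> cball z r \<Longrightarrow> f w = zor_poly f z w * (w - z) ^ nat (zorder f z) \<and> zor_poly f z w \<noteq> 0"
    by auto
  show thesis
  proof
    show "nat (zorder f z) \<ge> 1" using r by simp
    have "h w = h z + zor_poly f z w * (w - z) ^ nat (zorder f z)" if "w \<in> ball z r" for w
    proof -
      have "w \<in> cball z r" using that by auto
      from r(5)[OF this] have "h w - h z = zor_poly f z w * (w - z) ^ nat (zorder f z)"
        unfolding f_def by blast
      then show ?thesis by (metis add.commute diff_add_cancel)
    qed
    moreover have "zor_poly f z holomorphic_on ball z r" using r(4) ball_subset_cball by (rule holomorphic_on_subset)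
    moreover have "zor_poly f z z \<noteq> 0" using r(5)[of z] r(2) by auto
    ultimately show "has_order h z (nat (zorder f z))" unfolding has_order_def
      using r(2) by blast
  qed
qed

text \<open>For positive \<open>n\<close> the derivative at \<open>z\<close> reduces to
  \<open>n * 0 ^ (n - 1) * g z\<close>, which survives only through
  \<open>0 ^ 0 = 1\<close>.\<close>

lemma has_order_deriv:
  assumes "has_order h z n" "n \<ge> 1"
  shows "deriv h z \<noteq> 0 \<longleftrightarrow> n = 1"
proof -
  obtain r g where *: "r > 0" "g holomorphic_on ball z r" "g z \<noteq> 0"
      "\<And>w. w\<in>ball z r \<Longrightarrow> h w = h z + g w * (w - z) ^ n"
    using assms(1) unfolding has_order_def by blast
  obtain d where g: "(g has_field_derivative d) (at z)"
    using * by (metis centre_in_ball holomorphic_derivI open_ball)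
  have "((\<lambda>w. h z + g w * (w - z) ^ n) has_field_derivative
      (d * (z - z) ^ n + (of_nat n * (z - z) ^ (n - 1)) * g z)) (at z)"
    by (auto intro!: derivative_eq_intros g)
  then have "(h has_field_derivative (d * (z - z) ^ n + (of_nat n * (z - z) ^ (n - 1)) * g z)) (at z)"
    by (rule has_field_derivative_transform_within_open[where S="ball z r"]) (use *(1) *(4)[symmetric] in auto)
  then have "deriv h z = d * (z - z) ^ n + (of_nat n * (z - z) ^ (n - 1)) * g z"
    by (rule DERIV_imp_deriv)
  then show ?thesis using assms(2) *(3) by (cases n) (auto simp: power_0_left)
qed

text \<open>Used for transition maps: an injective holomorphic function has nonvanishing derivative,
  so a change of charts does not alter orders.\<close>

lemma has_order_injective:
  assumes "h holomorphic_on W" "open W" "z \<in> W" "inj_on h W"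
  shows "has_order h z 1"
proof -
  have "\<exists>w\<in>ball z r. h w \<noteq> h z" if "r > 0" for r
  proof -
    have "open (W \<inter> ball z r)" "z \<in> W \<inter> ball z r" using assms that by auto
    then obtain e where e: "e > 0" "ball z e \<subseteq> W \<inter> ball z r" using openE by blast
    have "z + of_real (e/2) \<in> ball z e" "z + of_real (e/2) \<noteq> z" using e by (auto simp: dist_norm)
    then show ?thesis using e assms(3,4) by (metis IntE inj_onD subset_iff)
  qed
  from has_order_exists[OF assms(1-3) this] obtain n where n: "n \<ge> 1" "has_order h z n" by blast
  have "deriv h z \<noteq> 0" using assms holomorphic_injective_imp_regular by blast
  then show ?thesis using n has_order_deriv by blast
qed

section \<open>Local degrees and local inverses\<close>

locale branched_cover =
  fixes S :: "'a surface" and T :: "'b surface" and f :: "'a \<Rightarrow> 'b" and n :: nat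
  assumes RS: "riemann_surface S" and RT: "riemann_surface T" and cover: "branched_covering S T f n"
begin

abbreviation "X \<equiv> surf_top S"
abbreviation "Y \<equiv> surf_top T"

lemma f_continuous: "continuous_map X Y f"
  using cover unfolding branched_covering_def holomorphic_map_on_def by simp

lemma f_closed: "closed_map X Y f"
  using cover unfolding branched_covering_def proper_map_def by simp

lemma f_in: "p \<in> topspace X \<Longrightarrow> f p \<in> topspace Y"
  using f_continuous by (auto simp: continuous_map_def)

lemma open_vimage: "openin Y V \<Longrightarrow> openin X {p \<in> topspace X. f p \<in> V}"
  using f_continuous openin_continuous_map_preimage by blast

lemma finite_fibre: "finite (fibre S f x)"
proof (cases "x \<in> topspace Y")
  case True then show ?thesis using cover by (auto simp: branched_covering_def)
next
  case False
  then have "fibre S f x = {}" using f_in by (auto simp: fibre_def)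
  then show ?thesis by simp
qed

section \<open>The covering in local coordinates\<close>

lemma rep_domain_open:
  assumes "(U, \<phi>) \<in> surf_charts S" "(V, \<psi>) \<in> surf_charts T"
  shows "open (\<phi> ` {p \<in> U. f p \<in> V})"
proof (rule chart_open_image[OF RS assms(1)])
  have "openin X (U \<inter> {p \<in> topspace X. f p \<in> V})"
    using chart_props(1)[OF RS assms(1)] chart_props(1)[OF RT assms(2)] open_vimage by blast
  moreover have "U \<inter> {p \<in> topspace X. f p \<in> V} = {p \<in> U. f p \<in> V}"
    using chart_props(4)[OF RS assms(1)] by auto
  ultimately show "openin X {p \<in> U. f p \<in> V}" by simp
qed auto

lemma rep_holomorphic:
  assumes "(U, \<phi>) \<in> surf_charts S" "(V, \<psi>) \<in> surf_charts T"
  shows "(\<lambda>\<zeta>. \<psi> (f (inv_into U \<phi> \<zeta>))) holomorphic_on \<phi> ` {p \<in> U. f p \<in> V}"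
proof -
  have "(\<psi> \<circ> f \<circ> inv_into U \<phi>) holomorphic_on \<phi> ` (U \<inter> topspace X \<inter> f -` V)"
    using cover assms unfolding branched_covering_def holomorphic_map_on_def by blast
  moreover have "U \<inter> topspace X \<inter> f -` V = {p \<in> U. f p \<in> V}"
    using chart_props(4)[OF RS assms(1)] by auto
  ultimately show ?thesis by (simp add: o_def)
qed

text \<open>Constancy on a disc would put infinitely many points into one fibre, and the fibres of a
  branched covering are finite.\<close>

lemma rep_nonconstant:
  assumes c: "(U, \<phi>) \<in> surf_charts S" "(V, \<psi>) \<in> surf_charts T" and p: "p \<in> U" "f p \<in> V" and r: "r > 0"
  shows "\<exists>w\<in>ball (\<phi> p) r. \<psi> (f (inv_into U \<phi> w)) \<noteq> \<psi> (f (inv_into U \<phi> (\<phi> p)))"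
proof (rule ccontr)
  assume "\<not> ?thesis"
  then have eq: "\<psi> (f (inv_into U \<phi> w)) = \<psi> (f p)" if "w \<in> ball (\<phi> p) r" for w
    using that p chart_props(3)[OF RS c(1)] by auto
  have "open (\<phi> ` {p \<in> U. f p \<in> V} \<inter> ball (\<phi> p) r)" using rep_domain_open[OF c] by auto
  moreover have "\<phi> p \<in> \<phi> ` {p \<in> U. f p \<in> V} \<inter> ball (\<phi> p) r" using p r by auto
  ultimately obtain e where e: "e > 0" "ball (\<phi> p) e \<subseteq> \<phi> ` {p \<in> U. f p \<in> V} \<inter> ball (\<phi> p) r"
    using openE by blast
  have "inv_into U \<phi> ` ball (\<phi> p) e \<subseteq> fibre S f (f p)"
  proof
    fix q assume "q \<in> inv_into U \<phi> ` ball (\<phi> p) e"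
    then obtain w where w: "w \<in> ball (\<phi> p) e" "q = inv_into U \<phi> w" by blast
    have "w \<in> \<phi> ` {p \<in> U. f p \<in> V}" using w e by blast
    then have q: "q \<in> U" "f q \<in> V" using w chart_props(3)[OF RS c(1)] by auto
    moreover have "w \<in> ball (\<phi> p) r" using w e by blast
    then have "\<psi> (f q) = \<psi> (f p)" using eq w by simp
    ultimately have "f q = f p" using p chart_props(3)[OF RT c(2)] by (meson inj_onD)
    then show "q \<in> fibre S f (f p)" using q chart_props(4)[OF RS c(1)] by (auto simp: fibre_def)
  qed
  then have "finite (inv_into U \<phi> ` ball (\<phi> p) e)" using finite_fibre finite_subset by blast
  moreover have "ball (\<phi> p) e \<subseteq> \<phi> ` U" using e by blast
  then have "inj_on (inv_into U \<phi>) (ball (\<phi> p) e)" by (rule inj_on_inv_into)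
  ultimately have "finite (ball (\<phi> p) e)" using finite_imageD by blast
  then show False using e(1) by (metis centre_in_ball finite.emptyI finite_imp_not_open open_ball empty_iff)
qed

lemma rep_has_order:
  assumes "(U, \<phi>) \<in> surf_charts S" "(V, \<psi>) \<in> surf_charts T" "p \<in> U" "f p \<in> V"
  obtains k where "k \<ge> 1" "has_order (\<lambda>\<zeta>. \<psi> (f (inv_into U \<phi> \<zeta>))) (\<phi> p) k"
proof (rule has_order_exists[OF rep_holomorphic[OF assms(1,2)] rep_domain_open[OF assms(1,2)], of "\<phi> p"])
  show "\<phi> p \<in> \<phi> ` {p \<in> U. f p \<in> V}" using assms by blast
qed (use rep_nonconstant[OF assms] that in auto)

lemma has_order_chart_change:
  assumes c: "(U, \<phi>) \<in> surf_charts S" "(V, \<psi>) \<in> surf_charts T"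
    and c': "(U', \<phi>') \<in> surf_charts S" "(V', \<psi>') \<in> surf_charts T"
    and p: "p \<in> U" "f p \<in> V" "p \<in> U'" "f p \<in> V'"
    and o: "has_order (\<lambda>\<zeta>. \<psi> (f (inv_into U \<phi> \<zeta>))) (\<phi> p) k"
  shows "has_order (\<lambda>\<zeta>. \<psi>' (f (inv_into U' \<phi>' \<zeta>))) (\<phi>' p) k"
proof -
  have trans: "has_order (\<lambda>z. \<phi>2 (inv_into U1 \<phi>1 z)) (\<phi>1 x) 1"
    if "riemann_surface Q" "(U1, \<phi>1) \<in> surf_charts Q" "(U2, \<phi>2) \<in> surf_charts Q" "x \<in> U1" "x \<in> U2"
    for Q :: "'q surface" and U1 \<phi>1 U2 \<phi>2 x
  proof (rule has_order_injective[OF transition_holomorphic[OF that(1-3)]])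
    note i1 = chart_props(3)[OF that(1,2)] and i2 = chart_props(3)[OF that(1,3)]
    show "open (\<phi>1 ` (U1 \<inter> U2))"
      using that chart_props(1) by (intro chart_open_image[OF that(1,2)]) auto
    show "inj_on (\<lambda>z. \<phi>2 (inv_into U1 \<phi>1 z)) (\<phi>1 ` (U1 \<inter> U2))"
      using i1 i2 by (auto simp: inj_on_def)
  qed (use that in auto)
  let ?t = "\<lambda>z. \<phi> (inv_into U' \<phi>' z)" and ?u = "\<lambda>z. \<psi>' (inv_into V \<psi> z)"
  have ip: "inv_into U' \<phi>' (\<phi>' p) = p" "inv_into U \<phi> (\<phi> p) = p"
    using p chart_props(3)[OF RS c(1)] chart_props(3)[OF RS c'(1)] by auto
  have "has_order (\<lambda>z. ?u (\<psi> (f (inv_into U \<phi> (?t z))))) (\<phi>' p) k"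
  proof (rule has_order_compose[where u = ?u and h = "\<lambda>\<zeta>. \<psi> (f (inv_into U \<phi> \<zeta>))" and \<theta> = ?t])
    show "has_order (\<lambda>\<zeta>. \<psi> (f (inv_into U \<phi> \<zeta>))) (\<phi> (inv_into U' \<phi>' (\<phi>' p))) k" using o ip by simp
    show "has_order ?t (\<phi>' p) 1" by (rule trans[OF RS c'(1) c(1) p(3,1)])
    show "has_order ?u (\<psi> (f (inv_into U \<phi> (\<phi> (inv_into U' \<phi>' (\<phi>' p)))))) 1"
      unfolding ip by (rule trans[OF RT c(2) c'(2) p(2,4)])
  qed
  moreover have "open (\<phi>' ` (U' \<inter> {p \<in> U. f p \<in> V}))"
  proof (rule chart_open_image[OF RS c'(1)])
    have "openin X (U \<inter> U' \<inter> {p \<in> topspace X. f p \<in> V})"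
      using chart_props(1)[OF RS c(1)] chart_props(1)[OF RS c'(1)] chart_props(1)[OF RT c(2)] open_vimage by blast
    moreover have "U \<inter> U' \<inter> {p \<in> topspace X. f p \<in> V} = U' \<inter> {p \<in> U. f p \<in> V}"
      using chart_props(4)[OF RS c(1)] by auto
    ultimately show "openin X (U' \<inter> {p \<in> U. f p \<in> V})" by simp
  qed auto
  ultimately show ?thesis
  proof (rule has_order_cong)
    show "\<phi>' p \<in> \<phi>' ` (U' \<inter> {p \<in> U. f p \<in> V})" using p by auto
    fix w assume "w \<in> \<phi>' ` (U' \<inter> {p \<in> U. f p \<in> V})"
    then show "?u (\<psi> (f (inv_into U \<phi> (?t w)))) = \<psi>' (f (inv_into U' \<phi>' w))"
      using chart_props(3)[OF RS c(1)] chart_props(3)[OF RS c'(1)] chart_props(3)[OF RT c(2)] by auto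
  qed
qed

text \<open>\<open>local_degree\<close> is a definite description ranging over all pairs of charts.
  Chart independence shows that \<open>k\<close> satisfies it, and the given pair alone forces
  uniqueness.\<close>

lemma local_degree_eq:
  assumes c: "(U, \<phi>) \<in> surf_charts S" "(V, \<psi>) \<in> surf_charts T" and p: "p \<in> U" "f p \<in> V"
    and o: "has_order (\<lambda>\<zeta>. \<psi> (f (inv_into U \<phi> \<zeta>))) (\<phi> p) k"
  shows "local_degree S T f p = k"
proof -
  have z: "zorder (\<lambda>\<zeta>. \<psi>' (f (inv_into U' \<phi>' \<zeta>)) - \<psi>' (f p)) (\<phi>' p) = int k"
    if "(U', \<phi>') \<in> surf_charts S" "(V', \<psi>') \<in> surf_charts T" "p \<in> U'" "f p \<in> V'" for U' \<phi>' V' \<psi>'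
    using has_order_zorder[OF has_order_chart_change[OF c that(1,2) p that(3,4) o]]
      chart_props(3)[OF RS that(1)] that(3) by simp
  show ?thesis unfolding local_degree_def
  proof (rule the_equality)
    show "\<forall>(U, \<phi>)\<in>surf_charts S. \<forall>(V, \<psi>)\<in>surf_charts T. p \<in> U \<and> f p \<in> V \<longrightarrow>
        zorder (\<lambda>\<zeta>. \<psi> (f (inv_into U \<phi> \<zeta>)) - \<psi> (f p)) (\<phi> p) = int k"
      using z by blast
    fix j assume "\<forall>(U, \<phi>)\<in>surf_charts S. \<forall>(V, \<psi>)\<in>surf_charts T. p \<in> U \<and> f p \<in> V \<longrightarrow>
        zorder (\<lambda>\<zeta>. \<psi> (f (inv_into U \<phi> \<zeta>)) - \<psi> (f p)) (\<phi> p) = int j"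
    then have "zorder (\<lambda>\<zeta>. \<psi> (f (inv_into U \<phi> \<zeta>)) - \<psi> (f p)) (\<phi> p) = int j" using c p by blast
    then show "j = k" using z[OF c p] by simp
  qed
qed

lemma charts_at:
  assumes "p \<in> topspace X"
  obtains U \<phi> V \<psi> where "(U, \<phi>) \<in> surf_charts S" "(V, \<psi>) \<in> surf_charts T" "p \<in> U" "f p \<in> V"
  using assms chart_at[OF RS] chart_at[OF RT] f_in by metis

lemma local_degree_ge_1: "p \<in> topspace X \<Longrightarrow> local_degree S T f p \<ge> 1"
  by (metis charts_at rep_has_order local_degree_eq)

lemma local_degree_eq_1_iff:
  assumes "(U, \<phi>) \<in> surf_charts S" "(V, \<psi>) \<in> surf_charts T" "p \<in> U" "f p \<in> V"
  shows "local_degree S T f p = 1 \<longleftrightarrow> deriv (\<lambda>\<zeta>. \<psi> (f (inv_into U \<phi> \<zeta>))) (\<phi> p) \<noteq> 0"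
proof -
  obtain k where "k \<ge> 1" "has_order (\<lambda>\<zeta>. \<psi> (f (inv_into U \<phi> \<zeta>))) (\<phi> p) k"
    using rep_has_order assms by blast
  then show ?thesis using has_order_deriv local_degree_eq[OF assms] by blast
qed

lemma noncritical_degree:
  "p \<in> topspace X \<Longrightarrow> p \<notin> critical_points S T f \<Longrightarrow> local_degree S T f p = 1"
  using local_degree_ge_1[of p] by (auto simp: critical_points_def)

text \<open>In a chart the critical points are the zeros of \<open>deriv h\<close>, a holomorphic
  function that is not identically zero because \<open>h\<close> is not constant.\<close>

lemma critical_isolated:
  assumes "p \<in> topspace X"
  obtains N where "openin X N" "p \<in> N" "N \<inter> critical_points S T f \<subseteq> {p}"
proof -
  obtain U \<phi> V \<psi> where c: "(U, \<phi>) \<in> surf_charts S" "(V, \<psi>) \<in> surf_charts T" "p \<in> U" "f p \<in> V"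
    using charts_at assms by blast
  define h where "h = (\<lambda>\<zeta>. \<psi> (f (inv_into U \<phi> \<zeta>)))"
  let ?W = "\<phi> ` {p \<in> U. f p \<in> V}"
  note W = rep_domain_open[OF c(1,2)]
  have "\<phi> p \<in> ?W" using c by auto
  then obtain r where r: "r > 0" "ball (\<phi> p) r \<subseteq> ?W" using W openE by blast
  have h: "h holomorphic_on ball (\<phi> p) r"
    using rep_holomorphic[OF c(1,2)] r holomorphic_on_subset unfolding h_def by blast
  then have dh: "deriv h holomorphic_on ball (\<phi> p) r" by (intro holomorphic_deriv) auto
  have "\<exists>w\<in>ball (\<phi> p) r. deriv h w \<noteq> 0"
  proof (rule ccontr)
    assume "\<not> ?thesis"
    then have "(h has_field_derivative 0) (at w)" if "w \<in> ball (\<phi> p) r" for w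
      using that h by (metis holomorphic_derivI open_ball)
    then obtain k where k: "\<And>w. w \<in> ball (\<phi> p) r \<Longrightarrow> h w = k"
      using DERIV_zero_connected_constant[of "ball (\<phi> p) r" "{}" h]
      by (metis (no_types, lifting) connected_ball open_ball finite.emptyI Diff_empty
        h holomorphic_on_imp_continuous_on)
    have "\<exists>w\<in>ball (\<phi> p) r. h w \<noteq> h (\<phi> p)" unfolding h_def by (rule rep_nonconstant[OF c r(1)])
    then show False using k r(1) by (metis centre_in_ball)
  qed
  then obtain w where w: "w \<in> ball (\<phi> p) r" "deriv h w \<noteq> 0" by blast
  \<comment> \<open>The isolation of zeros applies when the centre is itself a zero; otherwise
    continuity of \<open>deriv h\<close> keeps it away from zero nearby.\<close>
  obtain e where e: "e > 0" "e \<le> r" "\<And>z. z \<in> ball (\<phi> p) e \<Longrightarrow> z \<noteq> \<phi> p \<Longrightarrow> deriv h z \<noteq> 0"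
  proof (cases "deriv h (\<phi> p) = 0")
    case True
    obtain e where e: "e > 0" "ball (\<phi> p) e \<subseteq> ball (\<phi> p) r" "\<And>z. z \<in> ball (\<phi> p) e - {\<phi> p} \<Longrightarrow> deriv h z \<noteq> 0"
      by (rule isolated_zeros[OF dh open_ball connected_ball _ True w]) (use r in auto)
    then show thesis by (intro that[of "min e r"]) (use r in auto)
  next
    case False
    have "isCont (deriv h) (\<phi> p)" using dh r(1)
      by (meson centre_in_ball holomorphic_on_imp_continuous_on continuous_on_eq_continuous_at open_ball)
    from continuous_at_avoid[OF this False] obtain e where
      "e > 0" "\<forall>y. dist (\<phi> p) y < e \<longrightarrow> deriv h y \<noteq> 0" by blast
    then show thesis by (intro that[of "min e r"]) (use r in auto)
  qed
  show thesis
  proof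
    let ?N = "{q \<in> U. \<phi> q \<in> ball (\<phi> p) e}"
    show "openin X ?N" using chart_open_vimage[OF RS c(1)] open_ball by blast
    show "p \<in> ?N" using c e by auto
    show "?N \<inter> critical_points S T f \<subseteq> {p}"
    proof
      fix q assume q: "q \<in> ?N \<inter> critical_points S T f"
      show "q \<in> {p}"
      proof (rule ccontr)
        assume "q \<notin> {p}"
        then have "\<phi> q \<noteq> \<phi> p" using q c chart_props(3)[OF RS c(1)] by (auto dest: inj_onD)
        then have d: "deriv h (\<phi> q) \<noteq> 0" using e(3) q by auto
        have "\<phi> q \<in> ?W" using q e(2) r(2) by (auto simp: subset_iff)
        then have "f q \<in> V" using q chart_props(3)[OF RS c(1)] by (auto dest: inj_onD)
        then have "local_degree S T f q = 1"
          using d local_degree_eq_1_iff[OF c(1,2)] q unfolding h_def by auto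
        then show False using q by (simp add: critical_points_def)
      qed
    qed
  qed
qed

lemma finite_critical_points:
  assumes "compact_space X" shows "finite (critical_points S T f)"
proof -
  have "\<forall>p\<in>topspace X. \<exists>N. openin X N \<and> p \<in> N \<and> N \<inter> critical_points S T f \<subseteq> {p}"
    using critical_isolated by metis
  then obtain N where N: "\<And>p. p \<in> topspace X \<Longrightarrow> openin X (N p) \<and> p \<in> N p \<and> N p \<inter> critical_points S T f \<subseteq> {p}"
    by metis
  have cov: "topspace X \<subseteq> \<Union>(N ` topspace X)" using N by blast
  have "\<exists>F. finite F \<and> F \<subseteq> N ` topspace X \<and> topspace X \<subseteq> \<Union>F"
    using assms[unfolded compact_space_alt, rule_format, of "N ` topspace X"] N cov by blast
  then obtain F where F: "finite F" "F \<subseteq> N ` topspace X" "topspace X \<subseteq> \<Union>F" by blast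
  then obtain P where P: "finite P" "P \<subseteq> topspace X" "F = N ` P" by (meson finite_subset_image)
  have "critical_points S T f \<subseteq> P"
  proof
    fix q assume q: "q \<in> critical_points S T f"
    then have "q \<in> topspace X" by (simp add: critical_points_def)
    then obtain p where p: "p \<in> P" "q \<in> N p" using F(3) P(3) by blast
    then have "q \<in> {p}" using N P(2) q by blast
    then show "q \<in> P" using p by simp
  qed
  then show ?thesis using P(1) finite_subset by blast
qed

text \<open>Degree 1 means a nonvanishing derivative in charts, so \<open>f\<close> is locally
  injective with holomorphic inverse. The image \<open>N\<close> of the branch is recorded as an
  open set because \<open>f\<close> is injective on it, which is what uniqueness of branches rests
  on.\<close>

lemma local_inverse:
  assumes "p \<in> topspace X" "local_degree S T f p = 1"
  obtains N U s where "openin X N" "p \<in> N" "openin Y U" "s \<in> inverse_branches S T f U" "s ` U = N"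
proof -
  obtain U \<phi> V \<psi> where c: "(U, \<phi>) \<in> surf_charts S" "(V, \<psi>) \<in> surf_charts T" "p \<in> U" "f p \<in> V"
    using charts_at assms by blast
  define h where "h = (\<lambda>\<zeta>. \<psi> (f (inv_into U \<phi> \<zeta>)))"
  let ?W = "\<phi> ` {p \<in> U. f p \<in> V}"
  note W = rep_domain_open[OF c(1,2)] and ij = chart_props(3)[OF RS c(1)] chart_props(3)[OF RT c(2)]
  have h: "h holomorphic_on ?W" using rep_holomorphic[OF c(1,2)] unfolding h_def .
  have "\<phi> p \<in> ?W" using c by auto
  moreover have "deriv h (\<phi> p) \<noteq> 0" using local_degree_eq_1_iff[OF c] assms(2) unfolding h_def by simp
  ultimately obtain r where r: "r > 0" "ball (\<phi> p) r \<subseteq> ?W" "inj_on h (ball (\<phi> p) r)"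
    by (rule has_complex_derivative_locally_injective[OF h _ W, of "\<phi> p"])
  define D where "D = ball (\<phi> p) r"
  have hD: "h holomorphic_on D" using h r holomorphic_on_subset unfolding D_def by blast
  have D: "open D" "\<phi> p \<in> D" "D \<subseteq> ?W" "inj_on h D" using r by (auto simp: D_def)
  obtain g where g: "g holomorphic_on h ` D" "\<And>z. z \<in> D \<Longrightarrow> g (h z) = z"
    using holomorphic_has_inverse[OF hD D(1,4)] by metis
  have ohD: "open (h ` D)" using open_mapping_thm3 hD D by blast
  \<comment> \<open>Target chart, then the planar inverse \<open>g\<close> of \<open>h\<close>, then
    the inverse of the source chart. The formula is meaningful on \<open>Q\<close> only.\<close>
  define s where "s x = inv_into U \<phi> (g (\<psi> x))" for x
  define M where "M = {q \<in> U. \<phi> q \<in> D}"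
  define Q where "Q = {x \<in> V. \<psi> x \<in> h ` D}"
  have M: "openin X M" and Q: "openin Y Q" unfolding M_def Q_def
    using chart_open_vimage[OF RS c(1) D(1)] chart_open_vimage[OF RT c(2) ohD] by auto
  have fM: "f q \<in> Q" "s (f q) = q" if "q \<in> M" for q
  proof -
    have q: "q \<in> U" "\<phi> q \<in> D" "inv_into U \<phi> (\<phi> q) = q" using that ij by (auto simp: M_def)
    then have "\<phi> q \<in> ?W" using D by blast
    then have V: "f q \<in> V" using q ij by (auto dest: inj_onD)
    have hq: "\<psi> (f q) = h (\<phi> q)" using q by (simp add: h_def)
    then show "f q \<in> Q" using V q by (auto simp: Q_def)
    show "s (f q) = q" unfolding s_def hq using g(2) q by simp
  qed
  have sQ: "s x \<in> M" "f (s x) = x" if xQ: "x \<in> Q" for x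
  proof -
    obtain \<zeta> where z: "\<zeta> \<in> D" "\<psi> x = h \<zeta>" "x \<in> V" using xQ unfolding Q_def by blast
    then obtain q where q: "q \<in> U" "f q \<in> V" "\<zeta> = \<phi> q" using D by blast
    have sx: "s x = q" unfolding s_def z(2) using g(2) z q ij by simp
    show "s x \<in> M" using sx q z by (simp add: M_def)
    have "\<psi> (f q) = \<psi> x" using z q ij by (simp add: h_def)
    then have "f q = x" using inj_onD[OF ij(2)] q z by blast
    then show "f (s x) = x" using sx by simp
  qed
  have im: "s ` Q = M" using fM sQ by (force simp: image_iff)
  have g': "g z \<in> D" "g z \<in> \<phi> ` U" if "z \<in> h ` D" for z using that g(2) D by auto
  have cont: "continuous_map (subtopology Y Q) X s"
  proof -
    have 1: "continuous_map (subtopology Y Q) (top_of_set (h ` D)) \<psi>"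
    proof -
      have "continuous_map (subtopology Y Q) (top_of_set (\<psi> ` V)) \<psi>"
        using chart_props(5)[OF RT c(2)] by (rule continuous_map_from_subtopology_mono) (auto simp: Q_def)
      then show ?thesis unfolding continuous_map_in_subtopology by (auto simp: Q_def)
    qed
    have 2: "continuous_map (top_of_set (h ` D)) (top_of_set (\<phi> ` U)) g"
      using g(1) g' by (auto simp: holomorphic_on_imp_continuous_on)
    have "continuous_map (subtopology Y Q) X (inv_into U \<phi> \<circ> (g \<circ> \<psi>))"
      by (rule continuous_map_compose[OF continuous_map_compose[OF 1 2] chart_inv_continuous[OF RS c(1)]])
    then show ?thesis by (simp add: o_def s_def[abs_def])
  qed
  have hol: "(\<phi>' \<circ> s \<circ> inv_into V' \<psi>') holomorphic_on \<psi>' ` (V' \<inter> Q \<inter> s -` U')"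
    if c': "(V', \<psi>') \<in> surf_charts T" "(U', \<phi>') \<in> surf_charts S" for V' \<psi>' U' \<phi>'
  proof -
    let ?A = "\<psi>' ` (V' \<inter> Q \<inter> s -` U')"
    note ij' = chart_props(3)[OF RS c'(2)] chart_props(3)[OF RT c'(1)]
    have 1: "(\<lambda>z. \<psi> (inv_into V' \<psi>' z)) holomorphic_on ?A"
      by (rule holomorphic_on_subset[OF transition_holomorphic[OF RT c'(1) c(2)]]) (auto simp: Q_def)
    have "(g \<circ> (\<lambda>z. \<psi> (inv_into V' \<psi>' z))) holomorphic_on ?A"
      by (rule holomorphic_on_compose_gen[OF 1 g(1)]) (use ij' in \<open>auto simp: Q_def\<close>)
    moreover have "(\<lambda>z. \<phi>' (inv_into U \<phi> z)) holomorphic_on \<phi> ` (U \<inter> U')"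
      by (rule transition_holomorphic[OF RS c(1) c'(2)])
    moreover have "(g \<circ> (\<lambda>z. \<psi> (inv_into V' \<psi>' z))) ` ?A \<subseteq> \<phi> ` (U \<inter> U')"
    proof clarsimp
      fix x assume x: "x \<in> V'" "x \<in> Q" "s x \<in> U'"
      have "\<phi> (s x) = g (\<psi> x)" unfolding s_def using g'(2) x by (simp add: Q_def f_inv_into_f)
      moreover have "s x \<in> U" using sQ(1)[OF x(2)] by (simp add: M_def)
      ultimately show "g (\<psi> (inv_into V' \<psi>' (\<psi>' x))) \<in> \<phi> ` (U \<inter> U')" using x ij' by (metis IntI imageI inv_into_f_f)
    qed
    ultimately have "((\<lambda>z. \<phi>' (inv_into U \<phi> z)) \<circ> (g \<circ> (\<lambda>z. \<psi> (inv_into V' \<psi>' z)))) holomorphic_on ?A"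
      by (rule holomorphic_on_compose_gen)
    then show ?thesis by (simp add: o_def s_def)
  qed
  have "s \<in> inverse_branches S T f Q"
    unfolding inverse_branches_def holomorphic_map_on_def using Q cont hol sQ(2) by blast
  moreover have "p \<in> M" using c D by (simp add: M_def)
  ultimately show thesis using that M Q im by blast
qed

end

section \<open>The Riemann sphere\<close>

definition sphere_inverse :: "complex option \<Rightarrow> complex" where
  "sphere_inverse z = (case z of None \<Rightarrow> 0 | Some w \<Rightarrow> inverse w)"

abbreviation "sphere_top \<equiv> Alexandroff_compactification (euclidean :: complex topology)"

text \<open>By Heine-Borel the complement of a neighbourhood of \<open>None\<close> is compact
  exactly when it is closed and bounded, that is, when the neighbourhood contains the outside of
  some disc.\<close>

lemma openin_sphere_iff:
  "openin sphere_top V \<longleftrightarrow> open (Some -` V) \<and> (None \<in> V \<longrightarrow> (\<exists>B. \<forall>w. B < norm w \<longrightarrow> Some w \<in> V))"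
proof
  assume "openin sphere_top V"
  then consider U where "open U" "V = Some ` U"
    | C where "compact C" "V = insert None (Some ` (- C))"
    by (auto simp: openin_Alexandroff_compactification Compl_eq_Diff_UNIV)
  then show "open (Some -` V) \<and> (None \<in> V \<longrightarrow> (\<exists>B. \<forall>w. B < norm w \<longrightarrow> Some w \<in> V))"
  proof cases
    case 1
    then show ?thesis by (auto simp: inj_vimage_image_eq)
  next
    case 2
    have v: "Some -` V = - C" using 2 by auto
    obtain B where "\<And>w. w \<in> C \<Longrightarrow> norm w \<le> B"
      using compact_imp_bounded[OF 2(1)] by (auto simp: bounded_iff)
    then show ?thesis using v compact_imp_closed[OF 2(1)] 2(2) by (metis ComplI image_eqI insertCI linorder_not_le open_Compl)
  qed
next
  assume R: "open (Some -` V) \<and> (None \<in> V \<longrightarrow> (\<exists>B. \<forall>w. B < norm w \<longrightarrow> Some w \<in> V))"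
  show "openin sphere_top V"
  proof (cases "None \<in> V")
    case False
    then have "V = Some ` (Some -` V)" by (auto simp: image_iff) (metis option.exhaust)
    then show ?thesis using R by (metis openin_Alexandroff_compactification_image_Some open_openin)
  next
    case True
    then obtain B where B: "\<And>w. B < norm w \<Longrightarrow> Some w \<in> V" using R by blast
    have "bounded (- (Some -` V))" using B by (intro boundedI[of _ B]) (auto simp: not_less[symmetric])
    then have "compact (- (Some -` V))" using R by (simp add: compact_eq_bounded_closed closed_def)
    moreover have "V = insert None (Some ` (UNIV - - (Some -` V)))"
      using True by (auto simp: image_iff)
    ultimately show ?thesis unfolding openin_Alexandroff_compactification
      by (metis compactin_euclidean_iff compact_imp_closed closed_closedin topspace_euclidean)
  qed
qed

lemma openin_sphere_nonzero: "openin sphere_top (- {Some 0})"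
proof -
  have "Some -` (- {Some 0}) = - {0 :: complex}" by auto
  moreover have "\<forall>w. 0 < norm w \<longrightarrow> Some w \<in> - {Some (0 :: complex)}" by auto
  ultimately show ?thesis unfolding openin_sphere_iff by auto
qed

text \<open>The condition \<open>w \<noteq> 0\<close> guards against the convention
  \<open>inverse 0 = 0\<close>, which would add 0 to the preimage whenever \<open>W\<close> contains
  0.\<close>

lemma open_inverse_vimage: "open (W :: complex set) \<Longrightarrow> open {w. w \<noteq> 0 \<and> inverse w \<in> W}"
proof -
  assume "open W"
  have "continuous_on (- {0 :: complex}) inverse" by (intro continuous_intros) auto
  then have "open (inverse -` W \<inter> - {0})"
    using \<open>open W\<close> continuous_on_open_vimage by blast
  moreover have "inverse -` W \<inter> - {0} = {w. w \<noteq> 0 \<and> inverse w \<in> W}" by auto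
  ultimately show ?thesis by simp
qed

lemma sphere_chart_finite:
  "homeomorphic_map (subtopology sphere_top (range Some)) euclidean the"
proof -
  have "homeomorphic_maps euclidean (subtopology sphere_top (range Some)) Some the"
    unfolding homeomorphic_maps_def
  proof (intro conjI)
    show "continuous_map euclidean (subtopology sphere_top (range Some)) Some"
      by (simp add: continuous_map_in_subtopology continuous_map_Some)
    show "continuous_map (subtopology sphere_top (range Some)) euclidean the"
      unfolding continuous_map_alt
    proof (intro conjI allI impI)
      fix U :: "complex set" assume "openin euclidean U"
      then have "openin sphere_top (Some ` U)" by simp
      moreover have "the -` U \<inter> topspace (subtopology sphere_top (range Some)) = Some ` U \<inter> range Some" by auto
      ultimately show "openin (subtopology sphere_top (range Some)) (the -` U \<inter> topspace (subtopology sphere_top (range Some)))"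
        by (metis openin_subtopology)
    qed auto
  qed auto
  then show ?thesis using homeomorphic_maps_sym homeomorphic_maps_imp_map by blast
qed

lemma sphere_chart_infinite:
  "homeomorphic_map (subtopology sphere_top (- {Some 0})) euclidean sphere_inverse"
proof -
  \<comment> \<open>Since \<open>inverse 0 = 0\<close>, the plain formula would send 0 to
    \<open>Some 0\<close> instead of infinity.\<close>
  define g where "g w = (if w = 0 then None else Some (inverse w))" for w :: complex
  note o = openin_sphere_nonzero
  have "homeomorphic_maps (subtopology sphere_top (- {Some 0})) euclidean sphere_inverse g"
    unfolding homeomorphic_maps_def
  proof (intro conjI)
    show "continuous_map (subtopology sphere_top (- {Some 0})) euclidean sphere_inverse"
      unfolding continuous_map_alt
    proof (intro conjI allI impI)
      fix W :: "complex set" assume "openin euclidean W"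
      then have W: "open W" by simp
      let ?P = "sphere_inverse -` W \<inter> topspace (subtopology sphere_top (- {Some 0}))"
      have P: "?P = {z. z \<noteq> Some 0 \<and> sphere_inverse z \<in> W}" by (auto simp flip: UNIV_option_conv)
      have "Some -` ?P = {w. w \<noteq> 0 \<and> inverse w \<in> W}" unfolding P by (auto simp: sphere_inverse_def)
      then have "open (Some -` ?P)" using open_inverse_vimage W by simp
      moreover have "\<exists>B. \<forall>w. B < norm w \<longrightarrow> Some w \<in> ?P" if "None \<in> ?P"
      proof -
        have "0 \<in> W" using that unfolding P by (simp add: sphere_inverse_def)
        then obtain e where e: "e > 0" "ball 0 e \<subseteq> W" using W openE by blast
        have "Some w \<in> ?P" if "inverse e < norm w" for w
        proof -
          have "norm w > 0" using that e by (smt (verit) positive_imp_inverse_positive)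
          then have "inverse (norm w) < e" using that e
            by (metis inverse_inverse_eq less_imp_inverse_less positive_imp_inverse_positive)
          then have "inverse w \<in> W" using e by (auto simp: norm_inverse subset_iff)
          then show ?thesis unfolding P using \<open>norm w > 0\<close> by (auto simp: sphere_inverse_def)
        qed
        then show ?thesis by blast
      qed
      ultimately have "openin sphere_top ?P" unfolding openin_sphere_iff by blast
      then show "openin (subtopology sphere_top (- {Some 0})) ?P"
        using o by (subst openin_open_subtopology) auto
    qed auto
    show "continuous_map euclidean (subtopology sphere_top (- {Some 0})) g"
      unfolding continuous_map_in_subtopology
    proof
      show "continuous_map euclidean sphere_top g" unfolding continuous_map_alt
      proof (intro conjI allI impI)
        fix V assume V: "openin sphere_top V"
        then have "open (Some -` V)" by (simp add: openin_sphere_iff)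
        then have 1: "open {w. w \<noteq> 0 \<and> Some (inverse w) \<in> V}" using open_inverse_vimage[of "Some -` V"] by simp
        have "open (g -` V)"
        proof (cases "None \<in> V")
          case False
          then have "g -` V = {w. w \<noteq> 0 \<and> Some (inverse w) \<in> V}" by (auto simp: g_def split: if_splits)
          then show ?thesis using 1 by simp
        next
          case True
          then obtain B where B: "\<And>w. B < norm w \<Longrightarrow> Some w \<in> V" using V by (auto simp: openin_sphere_iff)
          \<comment> \<open>The bound \<open>B\<close> may be zero or negative; the maximum with 1
            keeps \<open>e\<close> positive.\<close>
          define e where "e = inverse (max B 1)"
          have e: "e > 0" by (simp add: e_def)
          have "g w \<in> V" if "w \<in> ball 0 e" for w
          proof (cases "w = 0")
            case False
            have "norm w < e" using that by simp
            then have "inverse e < norm (inverse w)" using False e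
              by (simp add: norm_inverse less_imp_inverse_less)
            then have "B < norm (inverse w)" by (simp add: e_def)
            then show ?thesis using B False by (simp add: g_def)
          qed (use True in \<open>simp add: g_def\<close>)
          then have "g -` V = ball 0 e \<union> {w. w \<noteq> 0 \<and> Some (inverse w) \<in> V}"
            using e by (auto simp: g_def split: if_splits)
          then show ?thesis using 1 by (metis open_Un open_ball)
        qed
        then show "openin euclidean (g -` V \<inter> topspace euclidean)" by simp
      qed (auto simp: image_iff g_def)
    qed (auto simp: g_def split: if_splits)
  qed (auto simp: g_def sphere_inverse_def split: option.splits)
  then show ?thesis by (rule homeomorphic_maps_imp_map)
qed

lemma surf_top_sphere: "surf_top riemann_sphere = sphere_top"
  by (simp add: riemann_sphere_def)

lemma surf_charts_sphere: "surf_charts riemann_sphere = {(range Some, the), (- {Some 0}, sphere_inverse)}"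
  by (simp add: riemann_sphere_def sphere_inverse_def[abs_def])

lemma topspace_sphere: "topspace sphere_top = UNIV"
  by (auto simp: UNIV_option_conv)

lemma riemann_surface_sphere: "riemann_surface riemann_sphere"
proof -
  have im: "the ` range Some = (UNIV :: complex set)" "sphere_inverse ` (- {Some 0}) = UNIV"
  proof -
    show "the ` range Some = (UNIV :: complex set)" by force
    have "w \<in> sphere_inverse ` (- {Some 0})" for w
      by (rule image_eqI[of _ _ "if w = 0 then None else Some (inverse w)"]) (auto simp: sphere_inverse_def)
    then show "sphere_inverse ` (- {Some 0}) = UNIV" by blast
  qed
  have inv1: "inv_into (range Some) the w = Some w" for w :: complex
    by (rule inv_into_f_eq) (auto simp: inj_on_def)
  have inv2: "inv_into (- {Some 0}) sphere_inverse w = (if w = 0 then None else Some (inverse w))" for w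
    by (rule inv_into_f_eq) (auto simp: inj_on_def sphere_inverse_def split: option.splits if_splits)
  have o: "openin sphere_top (range Some)" by (simp add: openin_sphere_iff)
  have "Hausdorff_space sphere_top"
    unfolding Hausdorff_space_Alexandroff_compactification
    by (simp add: locally_compact_space_euclidean)
  moreover have h12: "(sphere_inverse \<circ> inv_into (range Some) the) holomorphic_on the ` (range Some \<inter> - {Some 0})"
  proof -
    have "inverse holomorphic_on the ` (range Some \<inter> - {Some (0 :: complex)})"
      by (intro holomorphic_intros) auto
    then show ?thesis by (rule holomorphic_transform) (auto simp: inv1 sphere_inverse_def)
  qed
  moreover have h21: "(the \<circ> inv_into (- {Some 0}) sphere_inverse) holomorphic_on sphere_inverse ` (- {Some 0} \<inter> range Some)"
  proof -
    have "inverse holomorphic_on sphere_inverse ` (- {Some 0} \<inter> range Some)"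
      by (intro holomorphic_intros) (auto simp: sphere_inverse_def)
    then show ?thesis by (rule holomorphic_transform) (auto simp: inv2 sphere_inverse_def)
  qed
  moreover have h11: "(the \<circ> inv_into (range Some) the) holomorphic_on (UNIV :: complex set)"
    by (rule holomorphic_transform[OF holomorphic_on_id]) (auto simp: inv1)
  moreover have h22: "(sphere_inverse \<circ> inv_into (- {Some 0}) sphere_inverse) holomorphic_on UNIV"
    by (rule holomorphic_transform[OF holomorphic_on_id]) (auto simp: inv2 sphere_inverse_def)
  ultimately show ?thesis
    unfolding riemann_surface_def surf_top_sphere surf_charts_sphere
    using o openin_sphere_nonzero sphere_chart_finite sphere_chart_infinite
    by (auto simp: im topspace_sphere)
qed

section \<open>Germs of the inverse and the surface of tuples\<close>

context branched_cover
begin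

section \<open>Holomorphic branches and their germs\<close>

lemma branchD:
  assumes "s \<in> inverse_branches S T f U"
  shows "openin Y U" "\<And>x. x \<in> U \<Longrightarrow> s x \<in> topspace X" "\<And>x. x \<in> U \<Longrightarrow> f (s x) = x"
    and "continuous_map (subtopology Y U) X s"
proof -
  have *: "openin Y U" "continuous_map (subtopology Y U) X s" "\<forall>x\<in>U. f (s x) = x"
    using assms unfolding inverse_branches_def holomorphic_map_on_def by auto
  show "openin Y U" "continuous_map (subtopology Y U) X s" by fact+
  show "f (s x) = x" if "x \<in> U" for x using * that by blast
  show "s x \<in> topspace X" if "x \<in> U" for x
    using * that openin_subset[OF *(1)] by (auto simp: continuous_map_def Pi_iff)
qed

lemma branch_open_vimage:
  assumes "s \<in> inverse_branches S T f U" "openin X N"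
  shows "openin Y {x \<in> U. s x \<in> N}"
proof -
  note b = branchD[OF assms(1)]
  have "openin (subtopology Y U) {x \<in> topspace (subtopology Y U). s x \<in> N}"
    using b(4) assms(2) openin_continuous_map_preimage by blast
  moreover have "{x \<in> topspace (subtopology Y U). s x \<in> N} = {x \<in> U. s x \<in> N}"
    using openin_subset[OF b(1)] by auto
  ultimately show ?thesis using b(1) by (simp add: openin_open_subtopology)
qed

lemma branch_subset:
  assumes "s \<in> inverse_branches S T f U" "openin Y U'" "U' \<subseteq> U"
  shows "s \<in> inverse_branches S T f U'"
proof -
  have *: "continuous_map (subtopology Y U) X s" "\<forall>x\<in>U. f (s x) = x"
    "\<And>V \<psi> W \<phi>. (V, \<psi>) \<in> surf_charts T \<Longrightarrow> (W, \<phi>) \<in> surf_charts S \<Longrightarrow>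
        (\<phi> \<circ> s \<circ> inv_into V \<psi>) holomorphic_on \<psi> ` (V \<inter> U \<inter> s -` W)"
    using assms(1) unfolding inverse_branches_def holomorphic_map_on_def by auto
  have "continuous_map (subtopology Y U') X s"
    using *(1) assms(3) by (rule continuous_map_from_subtopology_mono)
  moreover have "(\<phi> \<circ> s \<circ> inv_into V \<psi>) holomorphic_on \<psi> ` (V \<inter> U' \<inter> s -` W)"
    if "(V, \<psi>) \<in> surf_charts T" "(W, \<phi>) \<in> surf_charts S" for V \<psi> W \<phi>
    by (rule holomorphic_on_subset[OF *(3)[OF that]]) (use assms(3) in auto)
  ultimately show ?thesis using assms *(2)
    unfolding inverse_branches_def holomorphic_map_on_def by blast
qed

abbreviation "reg \<equiv> regular_values S T f"

lemma fibre_iff: "p \<in> fibre S f x \<longleftrightarrow> p \<in> topspace X \<and> f p = x"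
  by (auto simp: fibre_def)

lemma regular_degree: "x \<in> reg \<Longrightarrow> p \<in> fibre S f x \<Longrightarrow> local_degree S T f p = 1"
  using noncritical_degree[of p] by (auto simp: regular_values_def critical_values_def fibre_iff)

lemma reg_topspace: "x \<in> reg \<Longrightarrow> x \<in> topspace Y"
  by (simp add: regular_values_def)

text \<open>Around a point of degree 1 the map \<open>f\<close> is injective on an open set
  \<open>N\<close>, so two sections of \<open>f\<close> agree wherever both take values in
  \<open>N\<close>.\<close>

lemma branch_unique:
  assumes s: "s \<in> inverse_branches S T f U" and t: "t \<in> inverse_branches S T f V"
    and x: "x \<in> U" "x \<in> V" "s x = t x" and d: "local_degree S T f (s x) = 1"
  obtains W where "openin Y W" "x \<in> W" "W \<subseteq> U \<inter> V" "\<forall>y\<in>W. s y = t y"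
proof -
  obtain N U0 s0 where N: "openin X N" "s x \<in> N" "openin Y U0" "s0 \<in> inverse_branches S T f U0" "s0 ` U0 = N"
    using local_inverse branchD(2)[OF s x(1)] d by metis
  have inj: "p = q" if "p \<in> N" "q \<in> N" "f p = f q" for p q
    using that branchD(3)[OF N(4)] N(5) by (metis imageE)
  show thesis
  proof
    show "openin Y ({y \<in> U. s y \<in> N} \<inter> {y \<in> V. t y \<in> N})"
      using branch_open_vimage[OF s N(1)] branch_open_vimage[OF t N(1)] by blast
    show "x \<in> {y \<in> U. s y \<in> N} \<inter> {y \<in> V. t y \<in> N}" using x N(2) by auto
    show "\<forall>y\<in>{y \<in> U. s y \<in> N} \<inter> {y \<in> V. t y \<in> N}. s y = t y"
      using inj branchD(3)[OF s] branchD(3)[OF t] by auto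
  qed auto
qed

lemma germ_eqI:
  assumes "openin Y W" "x \<in> W" "\<And>y. y \<in> W \<Longrightarrow> s y = t y"
  shows "germ T x s = germ T x t"
proof -
  have "germ T x s \<subseteq> germ T x t" if "\<And>y. y \<in> W \<Longrightarrow> s y = t y" for s t
  proof
    fix u assume "u \<in> germ T x s"
    then obtain U where "openin Y U" "x \<in> U" "\<forall>y\<in>U. u y = s y" by (auto simp: germ_def)
    then show "u \<in> germ T x t" unfolding germ_def using assms(1,2) that
      by (auto intro!: exI[of _ "U \<inter> W"])
  qed
  from this[of s t] this[of t s] show ?thesis using assms(3) by auto
qed

lemma germ_eqD:
  assumes "germ T x s = germ T x t" "openin Y U" "x \<in> U"
  obtains W where "openin Y W" "x \<in> W" "\<forall>y\<in>W. s y = t y"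
proof -
  have "s \<in> germ T x s" using assms(2,3) by (auto simp: germ_def)
  then have "s \<in> germ T x t" using assms(1) by simp
  then show thesis using that by (auto simp: germ_def)
qed

lemma germ_eq_iff:
  assumes s: "s \<in> inverse_branches S T f U" and t: "t \<in> inverse_branches S T f V"
    and x: "x \<in> U" "x \<in> V" and d: "local_degree S T f (s x) = 1"
  shows "germ T x s = germ T x t \<longleftrightarrow> s x = t x"
proof
  assume "germ T x s = germ T x t"
  then show "s x = t x" using germ_eqD branchD(1)[OF s] x(1) by metis
next
  assume eq: "s x = t x"
  obtain W where W: "openin Y W" "x \<in> W" "\<forall>y\<in>W. s y = t y"
    using branch_unique[OF s t x eq d] by metis
  show "germ T x s = germ T x t" by (rule germ_eqI[OF W(1,2)]) (use W(3) in blast)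
qed

text \<open>Over a regular value a germ of the inverse is determined by its value, so the points of
  the fibre can stand for the germs. \<open>germ_point\<close> shows that the choice of branch is
  immaterial.\<close>

definition point_germ :: "'a \<Rightarrow> ('b \<Rightarrow> 'a) set" where
  "point_germ p = germ T (f p) (SOME s. \<exists>U. f p \<in> U \<and> s \<in> inverse_branches S T f U \<and> s (f p) = p)"

lemma germ_point:
  assumes "s \<in> inverse_branches S T f U" "x \<in> U" "x \<in> reg"
  shows "germ T x s = point_germ (s x)"
proof -
  let ?P = "\<lambda>t. \<exists>U. f (s x) \<in> U \<and> t \<in> inverse_branches S T f U \<and> t (f (s x)) = s x"
  have fx: "f (s x) = x" using branchD(3) assms by blast
  have "?P (Eps ?P)" by (rule someI[of ?P s]) (use assms fx in auto)
  then obtain V where V: "x \<in> V" "Eps ?P \<in> inverse_branches S T f V" "Eps ?P x = s x"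
    using fx by auto
  have "local_degree S T f (s x) = 1"
    using regular_degree[OF assms(3)] branchD(2)[OF assms(1,2)] fx by (simp add: fibre_iff)
  then have "germ T x s = germ T x (Eps ?P)" using germ_eq_iff[OF assms(1) V(2) assms(2) V(1)] V(3) by simp
  then show ?thesis unfolding point_germ_def fx .
qed

text \<open>On \<open>N\<close> the maps \<open>f\<close> and \<open>s\<close> are mutually inverse,
  so the image of an open \<open>V\<close> is \<open>N\<close> intersected with the preimage of
  \<open>V\<close> under \<open>f\<close>. Openness is stated for all smaller \<open>V\<close> so
  that it survives restricting several branches to a common domain.\<close>

lemma branch_through:
  assumes "p \<in> topspace X" "local_degree S T f p = 1" "openin X M" "p \<in> M"
  obtains s U where "f p \<in> U" "s \<in> inverse_branches S T f U" "s (f p) = p"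
    "\<forall>V. V \<subseteq> U \<longrightarrow> openin Y V \<longrightarrow> openin X (s ` V)" "s ` U \<subseteq> M"
proof -
  obtain N U s where N: "openin X N" "p \<in> N" "openin Y U" "s \<in> inverse_branches S T f U" "s ` U = N"
    using local_inverse assms by metis
  have fN: "f q \<in> U \<and> s (f q) = q" if "q \<in> N" for q
    using that branchD(3)[OF N(4)] N(5) by (metis imageE)
  let ?U = "{x \<in> U. s x \<in> M}"
  have oU: "openin Y ?U" using branch_open_vimage[OF N(4) assms(3)] .
  show thesis
  proof
    show "f p \<in> ?U" "s (f p) = p" using fN N(2) assms(4) by auto
    show "s \<in> inverse_branches S T f ?U" by (rule branch_subset[OF N(4) oU]) auto
    show "s ` ?U \<subseteq> M" by auto
    show "\<forall>V. V \<subseteq> ?U \<longrightarrow> openin Y V \<longrightarrow> openin X (s ` V)"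
    proof (intro allI impI)
      fix V assume V: "V \<subseteq> ?U" "openin Y V"
      have "s ` V = N \<inter> {q \<in> topspace X. f q \<in> V}"
        using V(1) fN N(5) branchD(2,3)[OF N(4)] by (auto 0 4 simp: image_iff subset_iff)
      then show "openin X (s ` V)" using N(1) open_vimage[OF V(2)] by auto
    qed
  qed
qed

text \<open>Degree 1 is demanded only on \<open>P\<close>, not on the whole fibre: over a critical
  value this is applied to the fibre without its critical point. Finiteness of the fibre provides
  the common domain.\<close>

lemma branches_through:
  assumes x: "x \<in> topspace Y" and P: "P \<subseteq> fibre S f x"
    and d: "\<And>p. p \<in> P \<Longrightarrow> local_degree S T f p = 1 \<and> openin X (M p) \<and> p \<in> M p"
    and V: "openin Y V" "x \<in> V"
  obtains \<sigma> U where "openin Y U" "x \<in> U" "U \<subseteq> V"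
    "\<And>p. p \<in> P \<Longrightarrow> \<sigma> p \<in> inverse_branches S T f U \<and> \<sigma> p x = p \<and> openin X (\<sigma> p ` U) \<and> \<sigma> p ` U \<subseteq> M p"
proof -
  have "\<forall>p\<in>P. \<exists>s U. x \<in> U \<and> s \<in> inverse_branches S T f U \<and> s x = p \<and>
     (\<forall>V. V \<subseteq> U \<longrightarrow> openin Y V \<longrightarrow> openin X (s ` V)) \<and> s ` U \<subseteq> M p"
  proof
    fix p assume p: "p \<in> P"
    then have "p \<in> topspace X" "f p = x" using P by (auto simp: fibre_iff)
    then show "\<exists>s U. x \<in> U \<and> s \<in> inverse_branches S T f U \<and> s x = p \<and>
     (\<forall>V. V \<subseteq> U \<longrightarrow> openin Y V \<longrightarrow> openin X (s ` V)) \<and> s ` U \<subseteq> M p"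
      using branch_through[of p "M p"] d[OF p] by (metis (lifting))
  qed
  then obtain \<sigma> U where *: "\<And>p. p \<in> P \<Longrightarrow> x \<in> U p \<and> \<sigma> p \<in> inverse_branches S T f (U p) \<and> \<sigma> p x = p \<and>
     (\<forall>V. V \<subseteq> U p \<longrightarrow> openin Y V \<longrightarrow> openin X (\<sigma> p ` V)) \<and> \<sigma> p ` U p \<subseteq> M p"
    by metis
  have fin: "finite P" using P finite_fibre finite_subset by blast
  let ?U = "(\<Inter>p\<in>P. U p) \<inter> topspace Y \<inter> V"
  have o: "openin Y ?U"
    using openin_INT[OF fin, of Y U] * branchD(1) V(1) by blast
  show thesis
  proof
    show "openin Y ?U" by (rule o)
    show "x \<in> ?U" using * x V by auto
    fix p assume p: "p \<in> P"
    have sub: "?U \<subseteq> U p" using p by auto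
    then show "\<sigma> p \<in> inverse_branches S T f ?U \<and> \<sigma> p x = p \<and> openin X (\<sigma> p ` ?U) \<and> \<sigma> p ` ?U \<subseteq> M p"
      using *[OF p] branch_subset[OF _ o sub] o by blast
  qed auto
qed

text \<open>The tube lemma for a closed map: the complement of \<open>N\<close> has a closed image
  that misses \<open>x\<close>.\<close>

lemma fibre_neighbourhood:
  assumes "x \<in> topspace Y" "openin X N" "fibre S f x \<subseteq> N"
  obtains V where "openin Y V" "x \<in> V" "\<And>p. p \<in> topspace X \<Longrightarrow> f p \<in> V \<Longrightarrow> p \<in> N"
proof
  have "closedin X (topspace X - N)" using assms(2) by blast
  then show "openin Y (topspace Y - f ` (topspace X - N))" using f_closed by (auto simp: closed_map_def)
  show "x \<in> topspace Y - f ` (topspace X - N)" using assms by (auto simp: fibre_def)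
qed auto

lemma card_fibre: "x \<in> reg \<Longrightarrow> card (fibre S f x) = n"
proof -
  assume x: "x \<in> reg"
  then have "(\<Sum>p\<in>fibre S f x. local_degree S T f p) = n"
    using cover reg_topspace by (auto simp: branched_covering_def)
  then show ?thesis using regular_degree[OF x] by simp
qed

lemma separate_points:
  assumes "finite P" "P \<subseteq> topspace X"
  obtains M where "\<And>p. p \<in> P \<Longrightarrow> openin X (M p) \<and> p \<in> M p"
    "\<And>p q. p \<in> P \<Longrightarrow> q \<in> P \<Longrightarrow> p \<noteq> q \<Longrightarrow> M p \<inter> M q = {}"
proof -
  have H: "Hausdorff_space X" using RS by (simp add: riemann_surface_def)
  have "\<forall>p\<in>P. \<forall>q\<in>P. p \<noteq> q \<longrightarrow> (\<exists>A B. openin X A \<and> openin X B \<and> p \<in> A \<and> q \<in> B \<and> A \<inter> B = {})"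
    using H assms(2) unfolding Hausdorff_space_def disjnt_def by blast
  then obtain A B where AB: "\<And>p q. p \<in> P \<Longrightarrow> q \<in> P \<Longrightarrow> p \<noteq> q \<Longrightarrow>
      openin X (A p q) \<and> openin X (B p q) \<and> p \<in> A p q \<and> q \<in> B p q \<and> A p q \<inter> B p q = {}"
    by metis
  \<comment> \<open>The chosen pair of neighbourhoods need not be symmetric in \<open>p\<close> and
    \<open>q\<close>, so both roles are imposed; then \<open>M p\<close> lies in
    \<open>A p q\<close> and \<open>M q\<close> in \<open>B p q\<close>.\<close>
  let ?M = "\<lambda>p. (\<Inter>q\<in>P - {p}. A p q \<inter> B q p) \<inter> topspace X"
  show thesis
  proof
    fix p assume p: "p \<in> P"
    have "openin X (?M p)" by (rule openin_INT) (use assms(1) AB p in auto)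
    moreover have "p \<in> ?M p" using AB p assms(2) by auto
    ultimately show "openin X (?M p) \<and> p \<in> ?M p" by blast
  next
    fix p q assume "p \<in> P" "q \<in> P" "p \<noteq> q"
    then show "?M p \<inter> ?M q = {}" using AB[of p q] by auto
  qed
qed

lemma inj_point_germ: "x \<in> reg \<Longrightarrow> inj_on point_germ (fibre S f x)"
proof (rule inj_onI)
  fix p q assume x: "x \<in> reg" and pq: "p \<in> fibre S f x" "q \<in> fibre S f x" and eq: "point_germ p = point_germ q"
  have ex: "\<exists>s U. x \<in> U \<and> s \<in> inverse_branches S T f U \<and> s x = p" if "p \<in> fibre S f x" for p
  proof -
    have px: "p \<in> topspace X" "f p = x" using that by (auto simp: fibre_iff)
    show ?thesis
      by (rule branch_through[OF px(1) regular_degree[OF x that] openin_topspace px(1)]) (use px in auto)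
  qed
  then obtain s U t V where s: "x \<in> U" "s \<in> inverse_branches S T f U" "s x = p"
      and t: "x \<in> V" "t \<in> inverse_branches S T f V" "t x = q"
    using ex[OF pq(1)] ex[OF pq(2)] by blast
  have "germ T x s = germ T x t" using germ_point[OF s(2,1) x] germ_point[OF t(2,1) x] s t eq by simp
  then show "p = q" using germ_eq_iff[OF s(2) t(2) s(1) t(1)] s t regular_degree[OF x] pq by simp
qed

lemma inverse_germs_eq: "x \<in> reg \<Longrightarrow> inverse_germs S T f x = point_germ ` fibre S f x"
proof (intro equalityI subsetI)
  fix w assume x: "x \<in> reg" and "w \<in> inverse_germs S T f x"
  then obtain U s where "w = germ T x s" "x \<in> U" "s \<in> inverse_branches S T f U" by (auto simp: inverse_germs_def)
  then show "w \<in> point_germ ` fibre S f x" using germ_point x branchD by (auto simp: fibre_iff)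
next
  fix w assume x: "x \<in> reg" and "w \<in> point_germ ` fibre S f x"
  then obtain p where p: "p \<in> fibre S f x" "w = point_germ p" by blast
  have px: "p \<in> topspace X" "f p = x" using p(1) by (auto simp: fibre_iff)
  obtain s U where s: "f p \<in> U" "s \<in> inverse_branches S T f U" "s (f p) = p"
    using branch_through[OF px(1) regular_degree[OF x p(1)] openin_topspace px(1)] by metis
  then have "w = germ T x s" using germ_point[OF s(2,1)] p x by (simp add: fibre_iff)
  then show "w \<in> inverse_germs S T f x" using s p by (auto simp: inverse_germs_def fibre_iff)
qed

text \<open>The preimage of another sheet is the set where two finite families have the same germs.
  It is open because equality of two germs at a point persists nearby, and only finitely many pairs
  are involved.\<close>

lemma sheet_continuous:
  assumes F: "branch_tuple S T f k U F"
  shows "continuous_map (subtopology Y U) (surf_top (germ_surface S T f k)) (\<lambda>x. (x, germ T x ` F))"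
proof -
  have U: "openin Y U" "U \<subseteq> reg" "F \<subseteq> inverse_branches S T f U" "finite F" "card F = k"
     "\<And>x. x \<in> U \<Longrightarrow> inj_on (germ T x) F"
    using F by (auto simp: branch_tuple_def)
  have tU: "topspace (subtopology Y U) = U" using openin_subset[OF U(1)] by auto
  show ?thesis
    unfolding germ_surface_def surface.simps continuous_map_in_subtopology
  proof
    show "(\<lambda>x. (x, germ T x ` F)) \<in> topspace (subtopology Y U) \<rightarrow> germ_tuples S T f k"
    proof
      fix x assume "x \<in> topspace (subtopology Y U)"
      then have x: "x \<in> U" unfolding tU .
      have "germ T x ` F \<subseteq> inverse_germs S T f x" using U(3) x by (auto simp: inverse_germs_def)
      moreover have "card (germ T x ` F) = k" using U(5) card_image[OF U(6)[OF x]] by simp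
      ultimately show "(x, germ T x ` F) \<in> germ_tuples S T f k" using x U by (auto simp: germ_tuples_def)
    qed
    show "continuous_map (subtopology Y U) (topology_generated_by {germ_sheet T U F |U F. branch_tuple S T f k U F})
        (\<lambda>x. (x, germ T x ` F))"
    proof (rule continuous_on_generated_topo)
      show "(\<lambda>x. (x, germ T x ` F)) ` topspace (subtopology Y U) \<subseteq> \<Union> {germ_sheet T U F |U F. branch_tuple S T f k U F}"
        unfolding tU using F by (auto simp: germ_sheet_def)
      fix Z assume "Z \<in> {germ_sheet T U F |U F. branch_tuple S T f k U F}"
      then obtain U' F' where Z: "Z = germ_sheet T U' F'" "branch_tuple S T f k U' F'" by blast
      then have U': "openin Y U'" "F' \<subseteq> inverse_branches S T f U'" "finite F'" by (auto simp: branch_tuple_def)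
      let ?P = "(\<lambda>x. (x, germ T x ` F)) -` Z \<inter> topspace (subtopology Y U)"
      have P: "?P = {x \<in> U \<inter> U'. germ T x ` F = germ T x ` F'}"
        unfolding tU Z(1) germ_sheet_def by auto
      have "\<exists>W. openin Y W \<and> x \<in> W \<and> W \<subseteq> ?P" if "x \<in> ?P" for x
      proof -
        have x: "x \<in> U" "x \<in> U'" "germ T x ` F = germ T x ` F'" using that unfolding P by auto
        have near: "\<exists>W. openin Y W \<and> x \<in> W \<and> (\<forall>y\<in>W. germ T y s = germ T y t)"
          if st: "germ T x s = germ T x t" for s t
        proof -
          obtain W where W: "openin Y W" "x \<in> W" "\<forall>y\<in>W. s y = t y"
            using germ_eqD[OF st U(1) x(1)] by blast
          then show ?thesis using germ_eqI[OF W(1), where s=s and t=t] by blast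
        qed
        \<comment> \<open>Keeping the pairs that agree at \<open>x\<close> is enough: each member of
          either family has a partner in \<open>E\<close>, which yields both inclusions at nearby
          points.\<close>
        define E where "E = {e \<in> F \<times> F'. germ T x (fst e) = germ T x (snd e)}"
        have finE: "finite E" unfolding E_def using U(4) U'(3) by simp
        have "\<forall>e\<in>E. \<exists>W. openin Y W \<and> x \<in> W \<and> (\<forall>y\<in>W. germ T y (fst e) = germ T y (snd e))"
        proof
          fix e assume "e \<in> E"
          then have "germ T x (fst e) = germ T x (snd e)" by (simp add: E_def)
          then show "\<exists>W. openin Y W \<and> x \<in> W \<and> (\<forall>y\<in>W. germ T y (fst e) = germ T y (snd e))" by (rule near)
        qed
        from bchoice[OF this] obtain W where
          W: "\<forall>e\<in>E. openin Y (W e) \<and> x \<in> W e \<and> (\<forall>y\<in>W e. germ T y (fst e) = germ T y (snd e))"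
          by (elim exE)
        let ?W = "((\<Inter>e\<in>E. W e) \<inter> topspace Y) \<inter> (U \<inter> U')"
        have "openin Y ((\<Inter>e\<in>E. W e) \<inter> topspace Y)"
          by (rule openin_INT[OF finE]) (use W in blast)
        then have "openin Y ?W" using U(1) U'(1) by blast
        moreover have "x \<in> ?W" using W x openin_subset[OF U(1)] by blast
        moreover have "?W \<subseteq> ?P"
        proof
          fix y assume y: "y \<in> ?W"
          have g: "germ T y s = germ T y t" if "s \<in> F" "t \<in> F'" "germ T x s = germ T x t" for s t
          proof -
            have "(s, t) \<in> E" using that by (simp add: E_def)
            then have "y \<in> W (s, t)" "\<forall>y\<in>W (s, t). germ T y (fst (s, t)) = germ T y (snd (s, t))"
              using W y by blast+
            then show ?thesis by simp
          qed
          have "germ T y ` F \<subseteq> germ T y ` F'"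
          proof
            fix w assume "w \<in> germ T y ` F"
            then obtain s where s: "s \<in> F" "w = germ T y s" by blast
            then obtain t where "t \<in> F'" "germ T x s = germ T x t" using x(3) by (metis imageE imageI)
            then show "w \<in> germ T y ` F'" using g s by blast
          qed
          moreover have "germ T y ` F' \<subseteq> germ T y ` F"
          proof
            fix w assume "w \<in> germ T y ` F'"
            then obtain t where t: "t \<in> F'" "w = germ T y t" by blast
            then obtain s where "s \<in> F" "germ T x s = germ T x t" using x(3) by (metis imageE imageI)
            then show "w \<in> germ T y ` F" using g t by blast
          qed
          ultimately show "y \<in> ?P" unfolding P using y by auto
        qed
        ultimately show ?thesis by blast
      qed
      then have "openin Y ?P" by (subst openin_subopen) blast
      then show "openin (subtopology Y U) ?P"
        unfolding P using U(1) by (subst openin_open_subtopology) auto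
    qed
  qed
qed

end

section \<open>Finitely many critical values, and tuples as subsets of fibres\<close>

locale compact_cover = branched_cover +
  assumes compact: "compact_space X"
begin

lemma reg_open: "openin Y reg"
proof -
  have "finite (critical_values S T f)"
    unfolding critical_values_def using finite_critical_points[OF compact] by simp
  moreover have "critical_values S T f \<subseteq> topspace Y"
    using f_in by (auto simp: critical_values_def critical_points_def)
  moreover have "Hausdorff_space Y" using RT by (simp add: riemann_surface_def)
  ultimately have "closedin Y (critical_values S T f)"
    by (simp add: closedin_Hausdorff_finite)
  then show ?thesis unfolding regular_values_def by blast
qed

text \<open>Disjoint neighbourhoods \<open>L p\<close> keep the branches apart over all of
  \<open>U\<close>, so their germs stay distinct; the sets \<open>M p\<close> let the caller confine
  each branch further.\<close>

lemma branch_tuple_near: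
  assumes x: "x \<in> reg" and A: "A \<subseteq> fibre S f x" and V: "openin Y V" "x \<in> V"
    and M: "\<And>p. p \<in> A \<Longrightarrow> openin X (M p) \<and> p \<in> M p"
  obtains \<sigma> U where "openin Y U" "x \<in> U" "U \<subseteq> V" "branch_tuple S T f (card A) U (\<sigma> ` A)"
    "inj_on \<sigma> A" "\<And>p. p \<in> A \<Longrightarrow> \<sigma> p \<in> inverse_branches S T f U \<and> \<sigma> p x = p \<and> openin X (\<sigma> p ` U) \<and> \<sigma> p ` U \<subseteq> M p"
proof -
  have fin: "finite A" using A finite_fibre finite_subset by blast
  have "A \<subseteq> topspace X" using A by (auto simp: fibre_iff)
  then obtain L where L: "\<And>p. p \<in> A \<Longrightarrow> openin X (L p) \<and> p \<in> L p"
    "\<And>p q. p \<in> A \<Longrightarrow> q \<in> A \<Longrightarrow> p \<noteq> q \<Longrightarrow> L p \<inter> L q = {}"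
    using separate_points fin by metis
  have d: "local_degree S T f p = 1 \<and> openin X (L p \<inter> M p) \<and> p \<in> L p \<inter> M p" if "p \<in> A" for p
    using that regular_degree[OF x] A L(1) M by blast
  obtain \<sigma> U where s: "openin Y U" "x \<in> U" "U \<subseteq> V \<inter> reg"
    "\<And>p. p \<in> A \<Longrightarrow> \<sigma> p \<in> inverse_branches S T f U \<and> \<sigma> p x = p \<and> openin X (\<sigma> p ` U) \<and> \<sigma> p ` U \<subseteq> L p \<inter> M p"
    using branches_through[OF reg_topspace[OF x] A d openin_Int[OF V(1) reg_open]] V(2) x by (metis IntI)
  have inj: "inj_on \<sigma> A" using s(4) by (metis inj_onI)
  have "branch_tuple S T f (card A) U (\<sigma> ` A)"
    unfolding branch_tuple_def
  proof (intro conjI ballI)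
    show "card (\<sigma> ` A) = card A" using inj by (rule card_image)
    fix y assume y: "y \<in> U"
    show "inj_on (germ T y) (\<sigma> ` A)"
    proof (rule inj_onI)
      fix s' t' assume "s' \<in> \<sigma> ` A" "t' \<in> \<sigma> ` A" and eq: "germ T y s' = germ T y t'"
      then obtain p q where pq: "p \<in> A" "q \<in> A" "s' = \<sigma> p" "t' = \<sigma> q" by blast
      have "s' y = t' y" using germ_eqD[OF eq s(1) y] by metis
      then have "L p \<inter> L q \<noteq> {}" using s(4)[OF pq(1)] s(4)[OF pq(2)] pq y by blast
      then show "s' = t'" using L(2) pq by blast
    qed
  qed (use s fin in auto)
  then show thesis using that[of U \<sigma>] s inj by blast
qed

abbreviation "G \<equiv> \<lambda>k. surf_top (germ_surface S T f k)"

text \<open>Replaces sets of germs by \<open>k\<close>-subsets of a fibre, on which transpositions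
  act. The inclusion from right to left uses that a sheet passes through every such subset.\<close>

lemma topspace_germ_surface: "topspace (G k) = {(x, point_germ ` A) |x A. x \<in> reg \<and> A \<subseteq> fibre S f x \<and> card A = k}"
proof (intro equalityI subsetI)
  fix y assume "y \<in> topspace (G k)"
  then have "y \<in> germ_tuples S T f k" by (auto simp: germ_surface_def)
  then obtain x W where y: "y = (x, W)" "x \<in> reg" "W \<subseteq> inverse_germs S T f x" "card W = k"
    by (auto simp: germ_tuples_def)
  then obtain A where A: "A \<subseteq> fibre S f x" "W = point_germ ` A"
    using inverse_germs_eq[OF y(2)] by (auto simp: subset_image_iff)
  then have "card A = k" using y card_image inj_point_germ[OF y(2)] inj_on_subset by metis
  then show "y \<in> {(x, point_germ ` A) |x A. x \<in> reg \<and> A \<subseteq> fibre S f x \<and> card A = k}" using y A by blast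
next
  fix y assume "y \<in> {(x, point_germ ` A) |x A. x \<in> reg \<and> A \<subseteq> fibre S f x \<and> card A = k}"
  then obtain x A where y: "y = (x, point_germ ` A)" "x \<in> reg" "A \<subseteq> fibre S f x" "card A = k" by blast
  obtain \<sigma> U where s: "openin Y U" "x \<in> U" "branch_tuple S T f (card A) U (\<sigma> ` A)"
     "\<And>p. p \<in> A \<Longrightarrow> \<sigma> p \<in> inverse_branches S T f U \<and> \<sigma> p x = p"
  proof (rule branch_tuple_near[OF y(2,3) reg_open y(2), of "\<lambda>_. topspace X"])
    show "openin X (topspace X) \<and> p \<in> topspace X" if "p \<in> A" for p
      using that y(3) by (auto simp: fibre_iff)
  qed blast
  have "germ T x ` (\<sigma> ` A) = point_germ ` A"
    using germ_point[OF _ s(2) y(2)] s(4) by (force simp: image_image intro!: image_cong)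
  moreover have "(\<lambda>x. (x, germ T x ` (\<sigma> ` A))) x \<in> topspace (G k)"
    using continuous_map_image_subset_topspace[OF sheet_continuous[OF s(3)]] s(2) openin_subset[OF s(1)] y(4)
    by (auto simp: image_subset_iff)
  ultimately show "y \<in> topspace (G k)" using y by simp
qed

lemma tuple_open_near:
  assumes C: "openin (G k) C" and F: "branch_tuple S T f k U F"
  shows "openin Y {x \<in> U. (x, point_germ ` (\<lambda>s. s x) ` F) \<in> C}"
proof -
  have U: "openin Y U" "U \<subseteq> reg" "F \<subseteq> inverse_branches S T f U"
    using F by (auto simp: branch_tuple_def)
  have "openin (subtopology Y U) {x \<in> topspace (subtopology Y U). (x, germ T x ` F) \<in> C}"
    using sheet_continuous[OF F] C openin_continuous_map_preimage by blast
  moreover have "germ T x ` F = point_germ ` (\<lambda>s. s x) ` F" if "x \<in> U" for x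
    using germ_point that U(2,3) by (force simp: image_image intro!: image_cong)
  then have "{x \<in> topspace (subtopology Y U). (x, germ T x ` F) \<in> C} = {x \<in> U. (x, point_germ ` (\<lambda>s. s x) ` F) \<in> C}"
    using openin_subset[OF U(1)] by auto
  ultimately show ?thesis using U(1) by (simp add: openin_open_subtopology)
qed

end

section \<open>Related points of a fibre\<close>

lemma connectedin_clopen:
  assumes "connectedin X S" "openin X E1" "openin X E2" "S = E1 \<union> E2" "E1 \<inter> E2 = {}"
  shows "E1 = {} \<or> E2 = {}"
proof (rule ccontr)
  assume "\<not> ?thesis"
  then have "E1 \<inter> S \<noteq> {}" "E2 \<inter> S \<noteq> {}" "S \<subseteq> E1 \<union> E2" "E1 \<inter> E2 \<inter> S = {}" using assms(4,5) by auto
  then show False using assms(1-3) unfolding connectedin by blast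
qed

text \<open>The punctured disc \<open>N - {q}\<close> is connected, so it lies on one side of any
  separation of \<open>W - {q}\<close>. Adding \<open>q\<close> to that side would separate
  \<open>W\<close>.\<close>

lemma connectedin_delete_point:
  assumes RS: "riemann_surface S" and W: "connectedin (surf_top S) W" "openin (surf_top S) W"
  shows "connectedin (surf_top S) (W - {q})"
proof (cases "q \<in> W")
  case True
  let ?X = "surf_top S"
  obtain N where N: "openin ?X N" "q \<in> N" "N \<subseteq> W" "connectedin ?X (N - {q})" "N - {q} \<noteq> {}"
    using punctured_disc_neighbourhood[OF RS W(2) True] by metis
  have Hd: "Hausdorff_space ?X" using RS by (simp add: riemann_surface_def)
  have dq: "openin ?X (A - {q})" if "openin ?X A" for A
    using that Hausdorff_imp_t1_space[OF Hd] unfolding t1_space_openin_delete_alt by blast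
  have key: False
    if E: "openin ?X E1" "openin ?X E2" "W - {q} \<subseteq> E1 \<union> E2" "E1 \<inter> E2 \<inter> (W - {q}) = {}"
      "E2 \<inter> (W - {q}) \<noteq> {}" "E1 \<inter> (N - {q}) \<noteq> {}" for E1 E2
  proof -
    have *: "E2 \<inter> (N - {q}) = {}"
    proof (rule ccontr)
      assume ne: "E2 \<inter> (N - {q}) \<noteq> {}"
      have "N - {q} \<subseteq> E1 \<union> E2" "E1 \<inter> E2 \<inter> (N - {q}) = {}" using N(3) E(3,4) by blast+
      then show False using N(4) E(1,2,6) ne unfolding connectedin by blast
    qed
    let ?A = "(E1 \<inter> W - {q}) \<union> N" and ?B = "E2 \<inter> W - {q}"
    have "openin ?X ?A" "openin ?X ?B" using dq E(1,2) W(2) N(1) by blast+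
    moreover have "W = ?A \<union> ?B" using E(3) N(2,3) by blast
    moreover have "?A \<inter> ?B = {}" using E(4) * by blast
    ultimately have "?A = {} \<or> ?B = {}" by (rule connectedin_clopen[OF W(1)])
    then show False using E(5) N(2) by blast
  qed
  show ?thesis
    unfolding connectedin
  proof (intro conjI notI)
    show "W - {q} \<subseteq> topspace ?X" using openin_subset[OF W(2)] by blast
    assume "\<exists>E1 E2. openin ?X E1 \<and> openin ?X E2 \<and> W - {q} \<subseteq> E1 \<union> E2 \<and> E1 \<inter> E2 \<inter> (W - {q}) = {} \<and>
      E1 \<inter> (W - {q}) \<noteq> {} \<and> E2 \<inter> (W - {q}) \<noteq> {}"
    then obtain E1 E2 where E: "openin ?X E1" "openin ?X E2" "W - {q} \<subseteq> E1 \<union> E2" "E1 \<inter> E2 \<inter> (W - {q}) = {}"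
      "E1 \<inter> (W - {q}) \<noteq> {}" "E2 \<inter> (W - {q}) \<noteq> {}" by blast
    have "E1 \<inter> (N - {q}) \<noteq> {} \<or> E2 \<inter> (N - {q}) \<noteq> {}" using N(3,5) E(3) by blast
    then show False
    proof
      assume "E1 \<inter> (N - {q}) \<noteq> {}"
      then show False using key[of E1 E2] E by blast
    next
      assume "E2 \<inter> (N - {q}) \<noteq> {}"
      then show False using key[of E2 E1] E by blast
    qed
  qed
qed (use W in simp)

lemma connectedin_delete_finite:
  assumes RS: "riemann_surface S" and "finite Z" and W: "connectedin (surf_top S) W" "openin (surf_top S) W"
  shows "connectedin (surf_top S) (W - Z) \<and> openin (surf_top S) (W - Z)"
  using \<open>finite Z\<close>
proof (induction Z)
  case empty then show ?case using W by simp
next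
  case (insert q Z)
  have Hd: "Hausdorff_space (surf_top S)" using RS by (simp add: riemann_surface_def)
  have "W - insert q Z = W - Z - {q}" by blast
  moreover have "openin (surf_top S) (W - Z - {q})"
    using insert.IH Hausdorff_imp_t1_space[OF Hd] unfolding t1_space_openin_delete_alt by blast
  ultimately show ?case using connectedin_delete_point[OF RS, of "W - Z" q] insert.IH by simp
qed

text \<open>Exchanging an element of \<open>A - A'\<close> with one of \<open>A' - A\<close>
  shortens the difference by one; equal cardinalities ensure that both elements exist as long as the
  sets differ.\<close>

lemma card_subsets_swap_connected:
  assumes "finite P" "A \<subseteq> P" "A' \<subseteq> P" "card A = card A'"
    and swap: "\<And>A a b. A \<subseteq> P \<Longrightarrow> card A = card A' \<Longrightarrow> a \<in> P \<Longrightarrow> b \<in> P \<Longrightarrow> Q A \<longleftrightarrow> Q (Transposition.transpose a b ` A)"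
  shows "Q A \<longleftrightarrow> Q A'"
  using assms(2,4)
proof (induction "card (A - A')" arbitrary: A)
  case 0
  have "finite A" using 0 assms(1) finite_subset by blast
  then have "A \<subseteq> A'" using 0 by auto
  then have "A = A'" using 0(3) assms(1,3) by (meson card_subset_eq finite_subset)
  then show ?case by simp
next
  case (Suc j)
  have fin: "finite A" "finite A'" using Suc assms(1,3) finite_subset by blast+
  have "card (A - A') \<noteq> 0" using Suc(2) by linarith
  then have "A - A' \<noteq> {}" by force
  then obtain a where a: "a \<in> A" "a \<notin> A'" by blast
  have "\<not> A' \<subseteq> A" using a Suc(4) fin by (metis card_subset_eq)
  then obtain b where b: "b \<in> A'" "b \<notin> A" by blast
  let ?B = "Transposition.transpose a b ` A"
  have B: "?B = insert b (A - {a})"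
    using a b by (auto simp: Transposition.transpose_def image_iff)
  have "?B - A' = (A - A') - {a}" unfolding B using a b by auto
  then have "card (?B - A') = j" using Suc(2) a fin by simp
  moreover have "?B \<subseteq> P" unfolding B using b Suc(3) assms(3) by auto
  moreover have "card ?B = card A'" using Suc(4) by (simp add: card_image)
  ultimately have "Q ?B \<longleftrightarrow> Q A'" using Suc(1)[of ?B] by simp
  moreover have "Q A \<longleftrightarrow> Q ?B" using swap Suc(3,4) a b assms(3) by blast
  ultimately show ?case by simp
qed

section \<open>The exchange relation of a clopen part\<close>

locale split_cover = compact_cover S T f n
  for S :: "'a surface" and T :: "'b surface" and f n +
  fixes k :: nat and C :: "('a, 'b) germ_tuple set"
  assumes C: "openin (G k) C" and C': "openin (G k) (topspace (G k) - C)"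
begin

definition in_part :: "'b \<Rightarrow> 'a set \<Rightarrow> bool" where
  "in_part x A \<longleftrightarrow> (x, point_germ ` A) \<in> C"

text \<open>Over a critical value \<open>in_part\<close> is false throughout, as \<open>C\<close>
  lies above regular values; there any two points of a fibre are related and nothing is
  learned.\<close>

definition rel :: "'a \<Rightarrow> 'a \<Rightarrow> bool" where
  "rel a b \<longleftrightarrow> a \<in> topspace X \<and> b \<in> topspace X \<and> f a = f b \<and>
     (\<forall>A. A \<subseteq> fibre S f (f a) \<longrightarrow> card A = k \<longrightarrow> in_part (f a) A = in_part (f a) (Transposition.transpose a b ` A))"

definition vim :: "'b set \<Rightarrow> 'a set" where
  "vim V = {p \<in> topspace X. f p \<in> V}"

lemma vim_open: "openin Y V \<Longrightarrow> openin X (vim V)"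
  unfolding vim_def by (rule open_vimage)

lemma transpose_fibre:
  assumes "a \<in> fibre S f x" "b \<in> fibre S f x" "A \<subseteq> fibre S f x"
  shows "Transposition.transpose a b ` A \<subseteq> fibre S f x" "card (Transposition.transpose a b ` A) = card A"
proof -
  show "Transposition.transpose a b ` A \<subseteq> fibre S f x" using assms by (auto simp: Transposition.transpose_def)
  show "card (Transposition.transpose a b ` A) = card A" by (simp add: card_image)
qed

lemma rel_refl: "a \<in> topspace X \<Longrightarrow> rel a a"
  by (simp add: rel_def)

lemma rel_sym: "rel a b \<Longrightarrow> rel b a"
  unfolding rel_def by (metis transpose_commute)

lemma rel_trans:
  assumes "rel a b" "rel b d" shows "rel a d"
\<comment> \<open>The conjugation identity requires \<open>d\<close> to differ from both
  \<open>a\<close> and \<open>b\<close>; in the excluded cases the claim is immediate.\<close>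
proof (cases "a = d \<or> b = d")
  case True
  then show ?thesis using assms rel_refl by (auto simp: rel_def)
next
  case False
  have F: "a \<in> fibre S f (f a)" "b \<in> fibre S f (f a)" "d \<in> fibre S f (f a)"
    using assms by (auto simp: rel_def fibre_iff)
  have 1: "in_part (f a) A = in_part (f a) (Transposition.transpose a b ` A)" if "A \<subseteq> fibre S f (f a)" "card A = k" for A
    using assms(1) that by (auto simp: rel_def)
  have 2: "in_part (f a) A = in_part (f a) (Transposition.transpose b d ` A)" if "A \<subseteq> fibre S f (f a)" "card A = k" for A
    using assms that by (auto simp: rel_def)
  have "in_part (f a) A = in_part (f a) (Transposition.transpose a d ` A)" if A: "A \<subseteq> fibre S f (f a)" "card A = k" for A
  proof -
    note t1 = transpose_fibre[OF F(1,2) A(1)]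
    note t2 = transpose_fibre[OF F(2,3) t1(1)]
    have "in_part (f a) A = in_part (f a) (Transposition.transpose a b ` A)" using 1 A .
    also have "\<dots> = in_part (f a) (Transposition.transpose b d ` Transposition.transpose a b ` A)" using 2 t1 A by simp
    also have "\<dots> = in_part (f a) (Transposition.transpose a b ` Transposition.transpose b d ` Transposition.transpose a b ` A)" using 1 t1 t2 A by simp
    also have "Transposition.transpose a b ` Transposition.transpose b d ` Transposition.transpose a b ` A = (Transposition.transpose a b \<circ> Transposition.transpose b d \<circ> Transposition.transpose a b) ` A"
      by (simp add: image_comp)
    also have "Transposition.transpose a b \<circ> Transposition.transpose b d \<circ> Transposition.transpose a b = Transposition.transpose a d"
      using False by (intro transpose_comp_triple) auto
    finally show ?thesis .
  qed
  then show ?thesis using assms by (auto simp: rel_def)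
qed

lemma tuple_mem:
  assumes F: "branch_tuple S T f k U F" "x \<in> U"
  shows "(x, point_germ ` (\<lambda>s. s x) ` F) \<in> topspace (G k)"
proof -
  have U: "openin Y U" "U \<subseteq> reg" "F \<subseteq> inverse_branches S T f U"
    using F by (auto simp: branch_tuple_def)
  have "x \<in> topspace (subtopology Y U)" using F(2) openin_subset[OF U(1)] by auto
  then have "(x, germ T x ` F) \<in> topspace (G k)"
    using sheet_continuous[OF F(1)] by (auto simp: continuous_map_def Pi_iff)
  moreover have "germ T x ` F = point_germ ` (\<lambda>s. s x) ` F"
    using germ_point F(2) U(2,3) by (force simp: image_image intro!: image_cong)
  ultimately show ?thesis by simp
qed

text \<open>Membership persists along a sheet because \<open>C\<close> is open, non-membership
  because its complement is.\<close>

lemma c_locally_constant: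
  assumes F: "branch_tuple S T f k U F" and x: "x \<in> U"
  shows "\<exists>W. openin Y W \<and> x \<in> W \<and> W \<subseteq> U \<and> (\<forall>y\<in>W. in_part y ((\<lambda>s. s y) ` F) = in_part x ((\<lambda>s. s x) ` F))"
proof (cases "in_part x ((\<lambda>s. s x) ` F)")
  case True
  then show ?thesis using tuple_open_near[OF C F] x
    by (intro exI[of _ "{x \<in> U. (x, point_germ ` (\<lambda>s. s x) ` F) \<in> C}"]) (auto simp: in_part_def)
next
  case False
  then show ?thesis using tuple_open_near[OF C' F] x tuple_mem[OF F]
    by (intro exI[of _ "{x \<in> U. (x, point_germ ` (\<lambda>s. s x) ` F) \<in> topspace (G k) - C}"]) (auto simp: in_part_def)
qed

lemma branch_image_open:
  assumes s: "s \<in> inverse_branches S T f U" "openin X (s ` U)" and W: "openin Y W" "W \<subseteq> U"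
  shows "openin X (s ` W)"
proof -
  have "s ` W = s ` U \<inter> vim W"
    using W(2) branchD(2,3)[OF s(1)] by (auto simp: vim_def subset_iff)
  then show ?thesis using s(2) vim_open[OF W(1)] by auto
qed

text \<open>An evenly covered neighbourhood of \<open>x\<close> with its sheets labelled by the
  fibre over \<open>x\<close>, chosen so small that under these labels neither membership in the
  clopen part nor the relation varies.\<close>

definition rel_constant_on :: "'b \<Rightarrow> ('a \<Rightarrow> 'b \<Rightarrow> 'a) \<Rightarrow> 'b set \<Rightarrow> bool" where
  "rel_constant_on x \<sigma> W \<longleftrightarrow> openin Y W \<and> x \<in> W \<and> W \<subseteq> reg \<and>
    (\<forall>p\<in>fibre S f x. \<sigma> p \<in> inverse_branches S T f W \<and> \<sigma> p x = p \<and> openin X (\<sigma> p ` W)) \<and>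
    (\<forall>y\<in>W. bij_betw (\<lambda>p. \<sigma> p y) (fibre S f x) (fibre S f y)) \<and>
    (\<forall>y\<in>W. \<forall>I. I \<subseteq> fibre S f x \<longrightarrow> card I = k \<longrightarrow> in_part y ((\<lambda>p. \<sigma> p y) ` I) = in_part x I) \<and>
    (\<forall>y\<in>W. \<forall>a\<in>fibre S f x. \<forall>b\<in>fibre S f x. rel (\<sigma> a y) (\<sigma> b y) = rel a b)"

lemma rel_constant_onD:
  assumes "rel_constant_on x \<sigma> W"
  shows "openin Y W" "x \<in> W" "W \<subseteq> reg"
    "\<And>p. p \<in> fibre S f x \<Longrightarrow> \<sigma> p \<in> inverse_branches S T f W \<and> \<sigma> p x = p \<and> openin X (\<sigma> p ` W)"
    "\<And>y. y \<in> W \<Longrightarrow> bij_betw (\<lambda>p. \<sigma> p y) (fibre S f x) (fibre S f y)"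
    "\<And>y I. y \<in> W \<Longrightarrow> I \<subseteq> fibre S f x \<Longrightarrow> card I = k \<Longrightarrow> in_part y ((\<lambda>p. \<sigma> p y) ` I) = in_part x I"
    "\<And>y a b. y \<in> W \<Longrightarrow> a \<in> fibre S f x \<Longrightarrow> b \<in> fibre S f x \<Longrightarrow> rel (\<sigma> a y) (\<sigma> b y) = rel a b"
  using assms unfolding rel_constant_on_def by auto

text \<open>A fibre has finitely many \<open>k\<close>-subsets, and membership of each is constant
  along its own sheet near \<open>x\<close>; intersect these neighbourhoods. The relation is defined
  from membership, so it is constant there as well.\<close>

lemma rel_constant_nearby:
  assumes x: "x \<in> reg"
  obtains \<sigma> W where "rel_constant_on x \<sigma> W"
proof -
  let ?P = "fibre S f x"
  obtain \<sigma> U where s: "openin Y U" "x \<in> U" "U \<subseteq> reg" "branch_tuple S T f (card ?P) U (\<sigma> ` ?P)"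
    "inj_on \<sigma> ?P" "\<And>p. p \<in> ?P \<Longrightarrow> \<sigma> p \<in> inverse_branches S T f U \<and> \<sigma> p x = p \<and> openin X (\<sigma> p ` U)"
  proof (rule branch_tuple_near[OF x order_refl reg_open x, of "\<lambda>_. topspace X"])
    show "openin X (topspace X) \<and> p \<in> topspace X" if "p \<in> ?P" for p
      using that by (auto simp: fibre_iff)
  qed blast
  have bij: "bij_betw (\<lambda>p. \<sigma> p y) ?P (fibre S f y)" if y: "y \<in> U" for y
  proof -
    have inj: "inj_on (\<lambda>p. \<sigma> p y) ?P"
    proof (rule inj_onI)
      fix p q assume pq: "p \<in> ?P" "q \<in> ?P" "\<sigma> p y = \<sigma> q y"
      have "germ T y (\<sigma> p) = germ T y (\<sigma> q)"
        using germ_point[of "\<sigma> p" U y] germ_point[of "\<sigma> q" U y] s(3,6) pq y by auto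
      moreover have "inj_on (germ T y) (\<sigma> ` ?P)" using s(4) y by (auto simp: branch_tuple_def)
      ultimately have "\<sigma> p = \<sigma> q" using pq by (auto dest: inj_onD)
      then show "p = q" using s(5) pq by (auto dest: inj_onD)
    qed
    have sub: "(\<lambda>p. \<sigma> p y) ` ?P \<subseteq> fibre S f y"
    proof
      fix q assume "q \<in> (\<lambda>p. \<sigma> p y) ` ?P"
      then obtain p where "p \<in> ?P" "q = \<sigma> p y" by blast
      then show "q \<in> fibre S f y" using branchD(2,3)[of "\<sigma> p" U y] s(6)[of p] y by (simp add: fibre_iff)
    qed
    \<comment> \<open>All regular fibres have \<open>n\<close> points, so an injection between two
      of them is onto.\<close>
    have "card ((\<lambda>p. \<sigma> p y) ` ?P) = card (fibre S f y)"
      using card_image[OF inj] card_fibre x y s(3) by auto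
    then have "(\<lambda>p. \<sigma> p y) ` ?P = fibre S f y" using sub finite_fibre card_subset_eq by blast
    then show ?thesis using inj by (simp add: bij_betw_def)
  qed
  define II where "II = {I. I \<subseteq> ?P \<and> card I = k}"
  have "finite II" unfolding II_def using finite_fibre[of x] by (auto intro: finite_subset[of _ "Pow ?P"])
  have "\<forall>I\<in>II. \<exists>W. openin Y W \<and> x \<in> W \<and> W \<subseteq> U \<and> (\<forall>y\<in>W. in_part y ((\<lambda>p. \<sigma> p y) ` I) = in_part x I)"
  proof
    fix I assume "I \<in> II"
    then have I: "I \<subseteq> ?P" "card I = k" by (auto simp: II_def)
    have injI: "inj_on \<sigma> I" using s(5) I inj_on_subset by blast
    have bt: "branch_tuple S T f k U (\<sigma> ` I)"
      unfolding branch_tuple_def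
    proof (intro conjI ballI)
      have sub: "\<sigma> ` I \<subseteq> \<sigma> ` ?P" using I by blast
      show "finite (\<sigma> ` I)" using finite_subset[OF I(1) finite_fibre] by simp
      show "card (\<sigma> ` I) = k" using card_image[OF injI] I by simp
      show "\<sigma> ` I \<subseteq> inverse_branches S T f U" using s(6) I by blast
      fix y assume "y \<in> U"
      then have "inj_on (germ T y) (\<sigma> ` ?P)" using s(4) by (simp add: branch_tuple_def)
      then show "inj_on (germ T y) (\<sigma> ` I)" using sub by (rule inj_on_subset)
    qed (use s in auto)
    have "(\<lambda>s. s x) ` \<sigma> ` I = I" using s(6) I by (force simp: image_image)
    then show "\<exists>W. openin Y W \<and> x \<in> W \<and> W \<subseteq> U \<and> (\<forall>y\<in>W. in_part y ((\<lambda>p. \<sigma> p y) ` I) = in_part x I)"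
      using c_locally_constant[OF bt s(2)] by (simp add: image_image)
  qed
  from bchoice[OF this] obtain WI where
    WI: "\<forall>I\<in>II. openin Y (WI I) \<and> x \<in> WI I \<and> WI I \<subseteq> U \<and> (\<forall>y\<in>WI I. in_part y ((\<lambda>p. \<sigma> p y) ` I) = in_part x I)"
    by (elim exE)
  define W where "W = ((\<Inter>I\<in>II. WI I) \<inter> topspace Y) \<inter> U"
  have oW: "openin Y W" unfolding W_def
    using openin_INT[OF \<open>finite II\<close>, of Y WI] WI s(1) by blast
  have WU: "W \<subseteq> U" by (simp add: W_def)
  have xW: "x \<in> W" unfolding W_def using WI s(2) reg_topspace[OF x] by blast
  have cI: "in_part y ((\<lambda>p. \<sigma> p y) ` I) = in_part x I" if "y \<in> W" "I \<subseteq> ?P" "card I = k" for y I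
  proof -
    have "I \<in> II" using that by (simp add: II_def)
    then have "y \<in> WI I" using that(1) by (auto simp: W_def)
    then show ?thesis using WI \<open>I \<in> II\<close> by blast
  qed
  have relc: "rel (\<sigma> a y) (\<sigma> b y) = rel a b" if y: "y \<in> W" and ab: "a \<in> ?P" "b \<in> ?P" for y a b
  proof -
    let ?h = "\<lambda>p. \<sigma> p y"
    have bij: "bij_betw ?h ?P (fibre S f y)" using bij y WU by blast
    then have inj: "inj_on ?h ?P" and im: "?h ` ?P = fibre S f y" by (auto simp: bij_betw_def)
    \<comment> \<open>The labelling is injective on the fibre, so relabelling intertwines the two
      transpositions.\<close>
    have tr: "Transposition.transpose (?h a) (?h b) ` ?h ` I = ?h ` Transposition.transpose a b ` I" if "I \<subseteq> ?P" for I
    proof -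
      have "Transposition.transpose (?h a) (?h b) (?h p) = ?h (Transposition.transpose a b p)" if "p \<in> ?P" for p
        using inj that ab by (auto simp: Transposition.transpose_def dest: inj_onD)
      then show ?thesis using that by (force simp: image_image intro!: image_cong)
    qed
    have fab: "f (?h a) = y" "f (?h b) = y" "?h a \<in> topspace X" "?h b \<in> topspace X"
    proof -
      have "?h a \<in> fibre S f y" "?h b \<in> fibre S f y" using im ab by blast+
      then show "f (?h a) = y" "f (?h b) = y" "?h a \<in> topspace X" "?h b \<in> topspace X"
        by (simp_all add: fibre_iff)
    qed
    have fx: "f a = x" "f b = x" "a \<in> topspace X" "b \<in> topspace X" using ab by (auto simp: fibre_iff)
    have "rel (?h a) (?h b) \<longleftrightarrow> (\<forall>A. A \<subseteq> ?h ` ?P \<longrightarrow> card A = k \<longrightarrow> in_part y A = in_part y (Transposition.transpose (?h a) (?h b) ` A))"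
      unfolding rel_def im using fab by simp
    also have "\<dots> \<longleftrightarrow> (\<forall>I. I \<subseteq> ?P \<longrightarrow> card I = k \<longrightarrow> in_part y (?h ` I) = in_part y (Transposition.transpose (?h a) (?h b) ` ?h ` I))"
      unfolding all_subset_image using inj by (metis card_image inj_on_subset)
    also have "\<dots> \<longleftrightarrow> (\<forall>I. I \<subseteq> ?P \<longrightarrow> card I = k \<longrightarrow> in_part x I = in_part x (Transposition.transpose a b ` I))"
    proof -
      have "in_part y (?h ` I) = in_part x I" "in_part y (Transposition.transpose (?h a) (?h b) ` ?h ` I) = in_part x (Transposition.transpose a b ` I)"
        if "I \<subseteq> ?P" "card I = k" for I
        using cI[OF y that] tr[OF that(1)] cI[OF y transpose_fibre(1)[OF ab that(1)]]
          transpose_fibre(2)[OF ab that(1)] that(2) by auto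
      then show ?thesis by blast
    qed
    also have "\<dots> \<longleftrightarrow> rel a b" unfolding rel_def using fx by simp
    finally show ?thesis .
  qed
  have "rel_constant_on x \<sigma> W"
    unfolding rel_constant_on_def
  proof (intro conjI ballI allI impI)
    show "W \<subseteq> reg" using WU s(3) by blast
    fix p assume p: "p \<in> ?P"
    note sp = s(6)[OF p]
    show "\<sigma> p \<in> inverse_branches S T f W" using sp branch_subset[OF _ oW WU] by blast
    show "\<sigma> p x = p" using sp by blast
    show "openin X (\<sigma> p ` W)" using sp branch_image_open[OF _ _ oW WU] by blast
  next
    fix y assume "y \<in> W"
    then show "bij_betw (\<lambda>p. \<sigma> p y) ?P (fibre S f y)" using bij WU by blast
  qed (use cI relc oW xW in auto)
  then show thesis by (rule that)
qed

lemma open_image_reg: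
  assumes "openin X N" "N \<subseteq> vim reg" shows "openin Y (f ` N)"
proof (subst openin_subopen, intro ballI)
  fix x assume "x \<in> f ` N"
  then obtain p where p: "p \<in> N" "x = f p" by blast
  then have px: "x \<in> reg" "p \<in> topspace X" using assms by (auto simp: vim_def)
  then have d: "local_degree S T f p = 1" using regular_degree p by (auto simp: fibre_iff)
  obtain s U where s: "f p \<in> U" "s \<in> inverse_branches S T f U" "s ` U \<subseteq> N"
    by (rule branch_through[OF px(2) d assms(1) p(1)])
  then have "U \<subseteq> f ` N" using branchD(3)[OF s(2)] by force
  then show "\<exists>W. openin Y W \<and> x \<in> W \<and> W \<subseteq> f ` N" using branchD(1)[OF s(2)] s(1) p(2) by blast
qed

text \<open>A slice is the preimage in the surface of a section over \<open>V\<close> of its quotient by \<open>rel\<close>.\<close>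

definition slice :: "'b set \<Rightarrow> 'a set \<Rightarrow> bool" where
  "slice V P \<longleftrightarrow> P \<subseteq> vim V \<and> openin X P \<and> openin X (vim V - P) \<and>
     (\<forall>x\<in>V. \<exists>u\<in>P. f u = x) \<and>
     (\<forall>u\<in>P. \<forall>v\<in>topspace X. f v = f u \<longrightarrow> (v \<in> P \<longleftrightarrow> rel u v))"

text \<open>Triviality of the covering by classes, expressed as a section through every class.
  Intersecting with \<open>reg\<close> lets \<open>A\<close> be a full neighbourhood of a critical
  value, and extension across that value is phrased in this way.\<close>

definition trivial_over :: "'b set \<Rightarrow> bool" where
  "trivial_over A \<longleftrightarrow> (\<forall>p\<in>vim (A \<inter> reg). \<exists>P. p \<in> P \<and> slice (A \<inter> reg) P)"

text \<open>\<open>D\<close> is a transversal: above \<open>V\<close> it meets every fibre, always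
  within a single class. Transporting a point of \<open>D\<close> and a second point of its fibre
  simultaneously along their sheets preserves whether they are related, so both the saturation of
  \<open>D\<close> and its complement are open.\<close>

lemma saturation_slice:
  assumes V: "openin Y V" "V \<subseteq> reg" and D: "openin X D"
    and meets: "\<And>x. x \<in> V \<Longrightarrow> \<exists>u\<in>D. f u = x"
    and one: "\<And>u v. u \<in> D \<Longrightarrow> v \<in> D \<Longrightarrow> f u = f v \<Longrightarrow> f u \<in> V \<Longrightarrow> rel u v"
  shows "slice V {v \<in> vim V. \<exists>u\<in>D. rel u v}" (is "slice V ?P")
proof -
  have DX: "D \<subseteq> topspace X" using D by (rule openin_subset)
  have near: "\<exists>N. openin X N \<and> v \<in> N \<and> N \<subseteq> vim V \<and> (\<forall>q\<in>N. \<exists>u'\<in>D. f u' = f q \<and> rel u' q = rel u v)"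
    if uv: "v \<in> vim V" "u \<in> D" "f u = f v" for u v
  proof -
    have fv: "f v \<in> reg" "f v \<in> V" "u \<in> fibre S f (f v)" "v \<in> fibre S f (f v)"
      using uv V DX by (auto simp: vim_def fibre_iff)
    obtain \<sigma> W where "rel_constant_on (f v) \<sigma> W" using rel_constant_nearby[OF fv(1)] by blast
    note s = rel_constant_onD[OF this]
    \<comment> \<open>The base is shrunk so that the sheet through \<open>u\<close> stays in
      \<open>D\<close>; then \<open>\<sigma> u y\<close> is the companion in \<open>D\<close> of the
      moved point \<open>\<sigma> v y\<close>.\<close>
    let ?W = "{y \<in> W. \<sigma> u y \<in> D} \<inter> V"
    have oW: "openin Y ?W" using branch_open_vimage[of "\<sigma> u" W D] s(4)[OF fv(3)] D V(1) by blast
    have "openin X (\<sigma> v ` ?W)"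
      by (rule branch_image_open[OF _ _ oW]) (use s(4)[OF fv(4)] in auto)
    moreover have "v \<in> \<sigma> v ` ?W"
      by (rule image_eqI[of _ _ "f v"]) (use s(2,4) fv uv in auto)
    moreover have "\<sigma> v ` ?W \<subseteq> vim V"
      using branchD(2,3) s(4)[OF fv(4)] by (auto simp: vim_def)
    moreover have "\<forall>q\<in>\<sigma> v ` ?W. \<exists>u'\<in>D. f u' = f q \<and> rel u' q = rel u v"
    proof
      fix q assume "q \<in> \<sigma> v ` ?W"
      then obtain y where y: "y \<in> ?W" "q = \<sigma> v y" by blast
      then show "\<exists>u'\<in>D. f u' = f q \<and> rel u' q = rel u v"
        using s(4)[OF fv(4)] s(4)[OF fv(3)] branchD(3) s(7)[OF _ fv(3,4)] by (intro bexI[of _ "\<sigma> u y"]) auto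
    qed
    ultimately show ?thesis by blast
  qed
  have "openin X ?P"
  proof (subst openin_subopen, intro ballI)
    fix v assume "v \<in> ?P"
    then obtain u where u: "v \<in> vim V" "u \<in> D" "rel u v" by blast
    then have "f u = f v" by (simp add: rel_def)
    from near[OF u(1,2) this] obtain N where N: "openin X N" "v \<in> N" "N \<subseteq> vim V"
      "\<forall>q\<in>N. \<exists>u'\<in>D. f u' = f q \<and> rel u' q = rel u v" by blast
    have "N \<subseteq> ?P" using N(3,4) u(3) by (auto simp: subset_iff)
    then show "\<exists>N. openin X N \<and> v \<in> N \<and> N \<subseteq> ?P" using N(1,2) by (intro exI[of _ N]) simp
  qed
  moreover have "openin X (vim V - ?P)"
  proof (subst openin_subopen, intro ballI)
    fix v assume v: "v \<in> vim V - ?P"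
    then obtain u where u: "u \<in> D" "f u = f v" using meets by (auto simp: vim_def)
    have nr: "\<not> rel u v" using v u by blast
    obtain N where N: "openin X N" "v \<in> N" "N \<subseteq> vim V" "\<forall>q\<in>N. \<exists>u'\<in>D. f u' = f q \<and> rel u' q = rel u v"
      using near[OF _ u] v by blast
    have "q \<notin> ?P" if q: "q \<in> N" for q
    proof
      assume "q \<in> ?P"
      then obtain u2 where u2: "u2 \<in> D" "rel u2 q" by blast
      obtain u' where u': "u' \<in> D" "f u' = f q" "\<not> rel u' q" using N(4) q nr by blast
      have "f u' \<in> V" using u'(2) N(3) q by (auto simp: vim_def)
      then have "rel u' u2" using one[OF u'(1) u2(1)] u'(2) u2(2) by (simp add: rel_def)
      then show False using u2(2) u'(3) rel_trans by blast
    qed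
    then show "\<exists>N. openin X N \<and> v \<in> N \<and> N \<subseteq> vim V - ?P" using N by blast
  qed
  moreover have "\<exists>u\<in>?P. f u = x" if x: "x \<in> V" for x
  proof -
    obtain u where u: "u \<in> D" "f u = x" using meets x by blast
    then have "u \<in> vim V" "rel u u" using DX x rel_refl by (auto simp: vim_def)
    then show ?thesis using u by blast
  qed
  moreover have "v \<in> ?P \<longleftrightarrow> rel u v" if uv: "u \<in> ?P" "v \<in> topspace X" "f v = f u" for u v
  proof -
    obtain w where w: "w \<in> D" "rel w u" using uv by blast
    have v: "v \<in> vim V" using uv by (auto simp: vim_def)
    show ?thesis
    proof
      assume "v \<in> ?P"
      then obtain w' where w': "w' \<in> D" "rel w' v" by blast
      have "f w = f u" "f w' = f u" "f u \<in> V" using w w' uv by (auto simp: rel_def vim_def)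
      then have "rel w w'" using one w(1) w'(1) by simp
      then show "rel u v" using w w' rel_trans rel_sym by blast
    next
      assume "rel u v"
      then show "v \<in> ?P" using w v rel_trans by blast
    qed
  qed
  ultimately show ?thesis unfolding slice_def by blast
qed

lemma trivial_overI:
  assumes A: "openin Y A"
    and D: "\<And>p. p \<in> vim (A \<inter> reg) \<Longrightarrow> \<exists>D. openin X D \<and> p \<in> D \<and> (\<forall>x\<in>A \<inter> reg. \<exists>u\<in>D. f u = x) \<and>
       (\<forall>u\<in>D. \<forall>v\<in>D. f u = f v \<longrightarrow> f u \<in> A \<inter> reg \<longrightarrow> rel u v)"
  shows "trivial_over A"
  unfolding trivial_over_def
proof
  fix p assume p: "p \<in> vim (A \<inter> reg)"
  obtain D where D: "openin X D" "p \<in> D" "\<And>x. x \<in> A \<inter> reg \<Longrightarrow> \<exists>u\<in>D. f u = x"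
     "\<And>u v. u \<in> D \<Longrightarrow> v \<in> D \<Longrightarrow> f u = f v \<Longrightarrow> f u \<in> A \<inter> reg \<Longrightarrow> rel u v"
    using D[OF p] by blast
  have "slice (A \<inter> reg) {v \<in> vim (A \<inter> reg). \<exists>u\<in>D. rel u v}"
  proof (rule saturation_slice[OF _ _ D(1,3)])
    show "openin Y (A \<inter> reg)" using A reg_open by blast
    show "rel u v" if "u \<in> D" "v \<in> D" "f u = f v" "f u \<in> A \<inter> reg" for u v using D(4) that .
  qed auto
  moreover have "rel p p" using p rel_refl by (simp add: vim_def)
  then have "p \<in> {v \<in> vim (A \<inter> reg). \<exists>u\<in>D. rel u v}" using p D(2) by auto
  ultimately show "\<exists>P. p \<in> P \<and> slice (A \<inter> reg) P" by (intro exI conjI)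
qed

section \<open>Restricting and gluing slices\<close>

lemma trivial_over_subset:
  assumes "trivial_over A" "openin Y A'" "A' \<subseteq> A"
  shows "trivial_over A'"
  unfolding trivial_over_def
proof
  fix p assume p: "p \<in> vim (A' \<inter> reg)"
  then have "p \<in> vim (A \<inter> reg)" using assms(3) by (auto simp: vim_def)
  then obtain P where P: "p \<in> P" "slice (A \<inter> reg) P" using assms(1) by (auto simp: trivial_over_def)
  have o: "openin X (vim (A' \<inter> reg))" using assms(2) reg_open by (intro vim_open) auto
  have "slice (A' \<inter> reg) (P \<inter> vim (A' \<inter> reg))"
    unfolding slice_def
  proof (intro conjI ballI impI)
    show "openin X (P \<inter> vim (A' \<inter> reg))" using P o by (auto simp: slice_def)
    have "vim (A' \<inter> reg) - P \<inter> vim (A' \<inter> reg) = (vim (A \<inter> reg) - P) \<inter> vim (A' \<inter> reg)"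
      using assms(3) by (auto simp: vim_def)
    then show "openin X (vim (A' \<inter> reg) - P \<inter> vim (A' \<inter> reg))" using P o by (auto simp: slice_def)
    fix x assume x: "x \<in> A' \<inter> reg"
    then have "x \<in> A \<inter> reg" using assms(3) by blast
    then obtain u where u: "u \<in> P" "f u = x" using P(2) unfolding slice_def by blast
    then have "u \<in> vim (A' \<inter> reg)" using P(2) x by (auto simp: slice_def vim_def)
    then show "\<exists>u\<in>P \<inter> vim (A' \<inter> reg). f u = x" using u by blast
  next
    fix u v assume uv: "u \<in> P \<inter> vim (A' \<inter> reg)" "v \<in> topspace X" "f v = f u"
    have "v \<in> P \<longleftrightarrow> rel u v" using P(2) uv unfolding slice_def by blast
    moreover have "v \<in> vim (A' \<inter> reg)" using uv by (auto simp: vim_def)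
    ultimately show "v \<in> P \<inter> vim (A' \<inter> reg) \<longleftrightarrow> rel u v" by blast
  qed auto
  then show "\<exists>P. p \<in> P \<and> slice (A' \<inter> reg) P" using P(1) p by blast
qed

text \<open>Two sections over a connected base that agree at one point agree everywhere. The base
  splits into the images of \<open>P1 \<inter> P2\<close> and of the rest of \<open>P1\<close>: both
  are open since \<open>f\<close> is open above regular values, and they are disjoint since a slice
  holds just one class in each fibre.\<close>

lemma slice_unique:
  assumes P1: "slice V1 P1" and P2: "slice V2 P2" and V: "connectedin Y (V1 \<inter> V2)" "V1 \<union> V2 \<subseteq> reg"
    and p: "p \<in> P1" "p \<in> P2" and v: "v \<in> vim (V1 \<inter> V2)"
  shows "v \<in> P1 \<longleftrightarrow> v \<in> P2"
proof -
  let ?A = "P1 \<inter> P2" and ?B = "P1 \<inter> (vim V2 - P2)"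
  have sub: "P1 \<subseteq> vim V1" "P2 \<subseteq> vim V2" using P1 P2 by (auto simp: slice_def)
  have cl: "w \<in> P1 \<longleftrightarrow> rel u w" if "u \<in> P1" "w \<in> topspace X" "f w = f u" for u w
    using P1 that unfolding slice_def by blast
  have cl2: "w \<in> P2 \<longleftrightarrow> rel u w" if "u \<in> P2" "w \<in> topspace X" "f w = f u" for u w
    using P2 that unfolding slice_def by blast
  have "openin X ?A" "openin X ?B" using P1 P2 by (auto simp: slice_def)
  moreover have "?A \<subseteq> vim reg" "?B \<subseteq> vim reg" using sub V(2) by (auto simp: vim_def)
  ultimately have o: "openin Y (f ` ?A)" "openin Y (f ` ?B)" using open_image_reg by auto
  have disj: "f ` ?A \<inter> f ` ?B = {}"
  proof (rule ccontr)
    assume "f ` ?A \<inter> f ` ?B \<noteq> {}"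
    then obtain a b where ab: "a \<in> ?A" "b \<in> ?B" "f a = f b" by blast
    then have "b \<in> topspace X" by (auto simp: vim_def)
    then have "rel a b" using cl[of a b] ab by auto
    then have "b \<in> P2" using cl2[of a b] ab \<open>b \<in> topspace X\<close> by auto
    then show False using ab by blast
  qed
  have cov: "V1 \<inter> V2 = f ` ?A \<union> f ` ?B"
  proof (intro equalityI subsetI)
    fix x assume x: "x \<in> V1 \<inter> V2"
    then obtain u where u: "u \<in> P1" "f u = x" using P1 unfolding slice_def by blast
    then have "u \<in> vim V2" using x sub by (auto simp: vim_def)
    then show "x \<in> f ` ?A \<union> f ` ?B" using u by blast
  qed (use sub in \<open>auto simp: vim_def\<close>)
  have "f ` ?B = {}" using connectedin_clopen[OF V(1) o cov disj] p by blast
  then have all: "f v \<in> f ` ?A" using cov v by (auto simp: vim_def)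
  then obtain u where u: "u \<in> P1" "u \<in> P2" "f v = f u" by blast
  have "v \<in> topspace X" using v by (simp add: vim_def)
  then show ?thesis using cl[OF u(1) _ u(3)] cl2[OF u(2) _ u(3)] by simp
qed

text \<open>Continue the slice through \<open>p\<close> by a slice over \<open>A2\<close> chosen
  through one of its points above the overlap. Connectedness of the overlap makes the two agree on
  all of it, so their union is again a slice. This is the covering-space content of van Kampen's
  theorem used here.\<close>

lemma trivial_over_glue_half:
  assumes t: "trivial_over A1" "trivial_over A2" and o: "openin Y A1" "openin Y A2"
    and con: "connectedin Y (A1 \<inter> A2 \<inter> reg)" and ne: "A1 \<inter> A2 \<inter> reg \<noteq> {}"
    and p: "p \<in> vim (A1 \<inter> reg)"
  shows "\<exists>P. p \<in> P \<and> slice ((A1 \<union> A2) \<inter> reg) P"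
proof -
  let ?V1 = "A1 \<inter> reg" and ?V2 = "A2 \<inter> reg" and ?V = "(A1 \<union> A2) \<inter> reg"
  obtain P1 where P1: "p \<in> P1" "slice ?V1 P1" using t(1) p by (auto simp: trivial_over_def)
  obtain x where x: "x \<in> A1 \<inter> A2 \<inter> reg" using ne by blast
  then obtain q where q: "q \<in> P1" "f q = x" using P1(2) unfolding slice_def by blast
  have sub1: "P1 \<subseteq> vim ?V1" using P1 by (simp add: slice_def)
  then have "q \<in> vim ?V2" using q x by (auto simp: vim_def)
  then obtain P2 where P2: "q \<in> P2" "slice ?V2 P2" using t(2) by (auto simp: trivial_over_def)
  have sub2: "P2 \<subseteq> vim ?V2" using P2 by (simp add: slice_def)
  have eq: "v \<in> P1 \<longleftrightarrow> v \<in> P2" if "v \<in> vim (?V1 \<inter> ?V2)" for v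
  proof (rule slice_unique[OF P1(2) P2(2) _ _ q(1) P2(1) that])
    show "connectedin Y (?V1 \<inter> ?V2)" using con by (simp add: Int_ac)
  qed auto
  have o12: "openin X P1" "openin X (vim ?V1 - P1)" "openin X P2" "openin X (vim ?V2 - P2)"
    using P1 P2 by (auto simp: slice_def)
  have "slice ?V (P1 \<union> P2)"
    unfolding slice_def
  proof (intro conjI ballI impI)
    show "P1 \<union> P2 \<subseteq> vim ?V" using sub1 sub2 by (auto simp: vim_def)
    show "openin X (P1 \<union> P2)" using o12 by blast
    have "vim ?V - (P1 \<union> P2) = (vim ?V1 - P1) \<union> (vim ?V2 - P2)"
      using eq sub1 sub2 by (auto simp: vim_def)
    then show "openin X (vim ?V - (P1 \<union> P2))" using o12 by auto
    show "\<exists>u\<in>P1 \<union> P2. f u = x" if "x \<in> ?V" for x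
      using that P1(2) P2(2) unfolding slice_def by blast
    fix u v assume uv: "u \<in> P1 \<union> P2" "v \<in> topspace X" "f v = f u"
    have 1: "v \<in> P1 \<longleftrightarrow> rel u v" if "u \<in> P1" using P1(2) that uv unfolding slice_def by blast
    have 2: "v \<in> P2 \<longleftrightarrow> rel u v" if "u \<in> P2" using P2(2) that uv unfolding slice_def by blast
    have "v \<in> P1 \<longleftrightarrow> v \<in> P2" if "f u \<in> ?V1" "f u \<in> ?V2" using eq that uv by (auto simp: vim_def)
    moreover have "u \<in> P1 \<longleftrightarrow> u \<in> P2" if "f u \<in> ?V1" "f u \<in> ?V2"
      using eq that uv sub1 sub2 by (auto simp: vim_def)
    moreover have "f u \<in> ?V1" if "u \<in> P1 \<or> v \<in> P1" using that sub1 uv by (auto simp: vim_def)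
    moreover have "f u \<in> ?V2" if "u \<in> P2 \<or> v \<in> P2" using that sub2 uv by (auto simp: vim_def)
    ultimately show "v \<in> P1 \<union> P2 \<longleftrightarrow> rel u v" using 1 2 uv(1) by blast
  qed
  then show ?thesis using P1(1) by blast
qed

lemma trivial_over_glue:
  assumes "trivial_over A1" "trivial_over A2" "openin Y A1" "openin Y A2"
    and "connectedin Y (A1 \<inter> A2 \<inter> reg)" "A1 \<inter> A2 \<inter> reg \<noteq> {}"
  shows "trivial_over (A1 \<union> A2)"
  unfolding trivial_over_def
proof
  fix p assume "p \<in> vim ((A1 \<union> A2) \<inter> reg)"
  then consider "p \<in> vim (A1 \<inter> reg)" | "p \<in> vim (A2 \<inter> reg)" by (auto simp: vim_def)
  then show "\<exists>P. p \<in> P \<and> slice ((A1 \<union> A2) \<inter> reg) P"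
  proof cases
    case 1 then show ?thesis using trivial_over_glue_half assms by blast
  next
    case 2 then show ?thesis using trivial_over_glue_half[of A2 A1 p] assms by (simp add: Int_ac Un_ac)
  qed
qed

lemma trivial_near_regular:
  assumes "x \<in> reg" obtains U where "openin Y U" "x \<in> U" "trivial_over U"
proof -
  obtain \<sigma> W where "rel_constant_on x \<sigma> W" using rel_constant_nearby[OF assms] by blast
  note s = rel_constant_onD[OF this]
  have "trivial_over W"
  proof (rule trivial_overI[OF s(1)])
    fix p assume "p \<in> vim (W \<inter> reg)"
    then have p: "f p \<in> W" "p \<in> fibre S f (f p)" by (auto simp: vim_def fibre_iff)
    then obtain a where a: "a \<in> fibre S f x" "p = \<sigma> a (f p)"
      using s(5)[OF p(1)] unfolding bij_betw_def by blast
    note b = s(4)[OF a(1)]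
    show "\<exists>D. openin X D \<and> p \<in> D \<and> (\<forall>x\<in>W \<inter> reg. \<exists>u\<in>D. f u = x) \<and>
       (\<forall>u\<in>D. \<forall>v\<in>D. f u = f v \<longrightarrow> f u \<in> W \<inter> reg \<longrightarrow> rel u v)"
      using b branchD(2,3)[of "\<sigma> a" W] a(2) p(1) rel_refl by (intro exI[of _ "\<sigma> a ` W"]) auto
  qed
  then show thesis using that s by blast
qed

end

section \<open>Critical values\<close>

locale simple_split = split_cover S T f n k C
  for S :: "'a surface" and T :: "'b surface" and f n k and C :: "('a, 'b) germ_tuple set" +
  assumes connected: "connected_space X"
    and simple: "\<forall>p\<in>critical_points S T f. local_degree S T f p = 2"
    and unique_critical: "\<forall>z\<in>topspace Y. \<exists>\<^sub>\<le>\<^sub>1p. p \<in> critical_points S T f \<inter> fibre S f z"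
    and k_pos: "k \<ge> 1"
begin

text \<open>Near a critical value \<open>b\<close> all points of the fibre but two lie on branches that
  extend over \<open>b\<close>.  The remaining two are joined inside a punctured disc around the critical
  point \<open>q\<close>, and moving one of them to the other along the disc exchanges them.\<close>

lemma rel_near_critical_point:
  assumes q: "q \<in> N" "openin X N" "connectedin X (N - {q})"
    and U: "openin Y U" "\<And>v. v \<in> N - {q} \<Longrightarrow> f v \<in> U \<inter> reg"
    and P: "finite P" "\<And>p. p \<in> P \<Longrightarrow> \<sigma> p \<in> inverse_branches S T f U"
    and disj: "\<And>p. p \<in> P \<Longrightarrow> \<sigma> p ` U \<inter> N = {}"
      "\<And>p p'. p \<in> P \<Longrightarrow> p' \<in> P \<Longrightarrow> p \<noteq> p' \<Longrightarrow> \<sigma> p ` U \<inter> \<sigma> p' ` U = {}"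
    and a: "a \<in> N - {q}" "a' \<in> N - {q}" "f a = f a'" "a \<noteq> a'"
    and fib: "fibre S f (f a) = {a, a'} \<union> (\<lambda>p. \<sigma> p (f a)) ` P"
  shows "rel a a'"
proof -
  have NX: "N \<subseteq> topspace X" using q(2) by (rule openin_subset)
  have Hd: "Hausdorff_space X" using RS by (simp add: riemann_surface_def)
  have oN: "openin X (N - {q})" using q(2) Hausdorff_imp_t1_space[OF Hd] unfolding t1_space_openin_delete_alt by blast
  \<comment> \<open>The tuple made of the moving point \<open>v\<close> and the branches indexed by
    \<open>I\<close>. As \<open>v\<close> runs through the punctured disc this tuple moves
    continuously, so membership cannot change.\<close>
  define g where "g I v = in_part (f v) (insert v ((\<lambda>p. \<sigma> p (f v)) ` I))" for I v
  have gconst: "g I a = g I a'" if I: "I \<subseteq> P" "Suc (card I) = k" for I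
  proof -
    have near: "\<exists>L. openin X L \<and> v \<in> L \<and> L \<subseteq> N - {q} \<and> (\<forall>w\<in>L. g I w = g I v)" if v: "v \<in> N - {q}" for v
    proof -
      let ?y = "f v"
      have y: "?y \<in> U" "?y \<in> reg" using U(2)[OF v] by auto
      have vX: "v \<in> topspace X" using v NX by blast
      have d: "local_degree S T f v = 1" using regular_degree[OF y(2)] vX by (simp add: fibre_iff)
      obtain s U0 where s: "?y \<in> U0" "s \<in> inverse_branches S T f U0" "s ?y = v"
         "\<forall>V. V \<subseteq> U0 \<longrightarrow> openin Y V \<longrightarrow> openin X (s ` V)" "s ` U0 \<subseteq> N - {q}"
        by (rule branch_through[OF vX d oN v])
      define V where "V = U0 \<inter> U \<inter> reg"
      have oV: "openin Y V" unfolding V_def using branchD(1)[OF s(2)] U(1) reg_open by blast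
      have V: "V \<subseteq> U0" "V \<subseteq> U" "V \<subseteq> reg" "?y \<in> V" using s(1) y by (auto simp: V_def)
      \<comment> \<open>A local branch through \<open>v\<close> completes the fixed branches to a
        tuple. It takes values in \<open>N\<close>, which they avoid, so it never coincides with any
        of them.\<close>
      let ?F = "insert s (\<sigma> ` I)"
      have sN: "s x \<in> N" if "x \<in> V" for x using s(5) that V(1) by blast
      have sI: "\<sigma> p x \<notin> N" if "x \<in> V" "p \<in> I" for x p using disj(1)[of p] that V(2) I(1) by blast
      have II: "\<sigma> p x \<noteq> \<sigma> p' x" if "x \<in> V" "p \<in> I" "p' \<in> I" "p \<noteq> p'" for x p p'
        using disj(2)[of p p'] that V(2) I(1) by blast
      have finI: "finite I" using I(1) P(1) finite_subset by blast
      have "inj_on \<sigma> I" using II[OF V(4)] by (metis inj_onI)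
      moreover have "s \<notin> \<sigma> ` I" using sN[OF V(4)] sI[OF V(4)] by auto
      ultimately have card: "card ?F = k" using I(2) finI by (simp add: card_image)
      have br: "t \<in> inverse_branches S T f V" if "t \<in> ?F" for t
        using that branch_subset[OF s(2) oV V(1)] branch_subset[OF P(2) oV V(2)] I(1) by blast
      have bt: "branch_tuple S T f k V ?F"
        unfolding branch_tuple_def
      proof (intro conjI ballI)
        fix x assume x: "x \<in> V"
        have "t = t'" if "t \<in> ?F" "t' \<in> ?F" "t x = t' x" for t t'
        proof -
          have "\<sigma> p x \<noteq> s x" if "p \<in> I" for p using sN[OF x] sI[OF x that] by metis
          then have ne: "\<sigma> p x \<noteq> s x" "s x \<noteq> \<sigma> p x" if "p \<in> I" for p using that by metis+
          show ?thesis using that ne II[OF x] by auto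
        qed
        moreover have "t x = t' x" if tt: "germ T x t = germ T x t'" for t t'
          using germ_eqD[OF tt oV x] by blast
        ultimately show "inj_on (germ T x) ?F" by (intro inj_onI) blast
      qed (use oV V finI card br in auto)
      obtain W where W: "openin Y W" "?y \<in> W" "W \<subseteq> V"
          "\<forall>x\<in>W. in_part x ((\<lambda>t. t x) ` ?F) = in_part ?y ((\<lambda>t. t ?y) ` ?F)"
        using c_locally_constant[OF bt V(4)] by blast
      have "openin X (s ` W)" using s(4) W(1,3) V(1) by blast
      moreover have "v \<in> s ` W" using W(2) s(3) by (metis imageI)
      moreover have "s ` W \<subseteq> N - {q}" using s(5) W(3) V(1) by blast
      moreover have "g I w = g I v" if w: "w \<in> s ` W" for w
      proof -
        obtain x where x: "x \<in> W" "w = s x" using w by blast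
        have "f w = x" using branchD(3)[OF s(2)] x W(3) V(1) by blast
        then have "g I w = in_part x ((\<lambda>t. t x) ` ?F)" using x by (simp add: g_def image_image)
        also have "\<dots> = in_part ?y ((\<lambda>t. t ?y) ` ?F)" using W(4) x(1) by blast
        also have "\<dots> = g I v" using s(3) by (simp add: g_def image_image)
        finally show ?thesis .
      qed
      ultimately show ?thesis by blast
    qed
    let ?A = "{v \<in> N - {q}. g I v}" and ?B = "{v \<in> N - {q}. \<not> g I v}"
    have "openin X ?A"
    proof (subst openin_subopen, intro ballI)
      fix v assume v: "v \<in> ?A"
      then obtain L where "openin X L" "v \<in> L" "L \<subseteq> N - {q}" "\<forall>w\<in>L. g I w = g I v" using near by blast
      then show "\<exists>L. openin X L \<and> v \<in> L \<and> L \<subseteq> ?A" using v by (intro exI[of _ L]) blast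
    qed
    moreover have "openin X ?B"
    proof (subst openin_subopen, intro ballI)
      fix v assume v: "v \<in> ?B"
      then obtain L where "openin X L" "v \<in> L" "L \<subseteq> N - {q}" "\<forall>w\<in>L. g I w = g I v" using near by blast
      then show "\<exists>L. openin X L \<and> v \<in> L \<and> L \<subseteq> ?B" using v by (intro exI[of _ L]) blast
    qed
    moreover have "N - {q} = ?A \<union> ?B" "?A \<inter> ?B = {}" by blast+
    ultimately have "?A = {} \<or> ?B = {}" using q(3) by (rule connectedin_clopen[rotated])
    then show ?thesis using a by blast
  qed
  \<comment> \<open>A subset containing just one of \<open>a\<close> and \<open>a'\<close> consists
    of that point and points on branches, so its transform under the exchange is the tuple over
    \<open>I\<close> completed by the other point.\<close>
  have swap: "in_part (f a) A = in_part (f a) (Transposition.transpose b b' ` A)"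
    if A: "A \<subseteq> fibre S f (f a)" "card A = k" and b: "{b, b'} = {a, a'}" "b \<in> A" "b' \<notin> A" for A b b'
  proof -
    let ?x = "f a"
    define I where "I = {p \<in> P. \<sigma> p ?x \<in> A}"
    have xU: "?x \<in> U" using U(2) a(1) by blast
    have sb: "\<sigma> p ?x \<noteq> b" "\<sigma> p ?x \<noteq> b'" if "p \<in> P" for p
      using disj(1)[OF that] xU a b(1) by (auto simp: doubleton_eq_iff)
    have Aeq: "A = insert b ((\<lambda>p. \<sigma> p ?x) ` I)"
      using A(1) fib b by (auto simp: I_def)
    have inj: "inj_on (\<lambda>p. \<sigma> p ?x) I"
      using disj(2) xU by (intro inj_onI) (auto simp: I_def)
    have finI: "finite I" using P(1) by (simp add: I_def)
    have "b \<notin> (\<lambda>p. \<sigma> p ?x) ` I" using sb by (auto simp: I_def)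
    then have "Suc (card I) = k" using A(2) Aeq card_image[OF inj] finI by simp
    then have g: "g I a = g I a'" using gconst[of I] by (simp add: I_def)
    have "Transposition.transpose b b' ` A = insert b' ((\<lambda>p. \<sigma> p ?x) ` I)"
      unfolding Aeq using sb by (force simp: I_def Transposition.transpose_def image_iff)
    moreover have "f b = ?x" "f b' = ?x" using b(1) a(3) by (auto simp: doubleton_eq_iff)
    then have "in_part ?x A = g I b" "in_part ?x (insert b' ((\<lambda>p. \<sigma> p ?x) ` I)) = g I b'"
      unfolding g_def Aeq by simp_all
    ultimately show ?thesis using g b(1) by (auto simp: doubleton_eq_iff)
  qed
  show ?thesis
    unfolding rel_def
  proof (intro conjI allI impI)
    show "a \<in> topspace X" "a' \<in> topspace X" "f a = f a'" using a NX by auto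
    fix A assume A: "A \<subseteq> fibre S f (f a)" "card A = k"
    \<comment> \<open>A subset containing both points or neither is fixed by the transposition;
      otherwise \<open>swap\<close> applies in one of the two orders.\<close>
    consider "a \<in> A \<longleftrightarrow> a' \<in> A" | "a \<in> A" "a' \<notin> A" | "a \<notin> A" "a' \<in> A" by blast
    then show "in_part (f a) A = in_part (f a) (Transposition.transpose a a' ` A)"
    proof cases
      case 1 then show ?thesis by (simp add: transpose_image_eq)
    next
      case 2 then show ?thesis using swap[OF A] by blast
    next
      case 3 then show ?thesis using swap[OF A, of a' a] by (simp add: transpose_commute insert_commute)
    qed
  qed
qed

text \<open>A disc \<open>N\<close> around the critical point catches exactly two points of each
  nearby regular fibre, and these are related. So \<open>N\<close> serves as a transversal, while
  the remaining points lie on single-valued branches extending over \<open>b\<close>.\<close>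

lemma trivial_near_critical_value:
  assumes b: "b \<in> topspace Y" "b \<notin> reg" obtains U where "openin Y U" "b \<in> U" "trivial_over U"
proof -
  have "b \<in> critical_values S T f" using b by (simp add: regular_values_def)
  then obtain q where q: "q \<in> critical_points S T f" "f q = b" by (auto simp: critical_values_def)
  have qX: "q \<in> topspace X" "q \<in> fibre S f b" using q by (auto simp: critical_points_def fibre_iff)
  have uq: "p = q" if "p \<in> critical_points S T f" "p \<in> fibre S f b" for p
    using unique_critical b(1) that q(1) qX(2) unfolding Uniq_def by blast
  define P where "P = fibre S f b - {q}"
  have finP: "finite P" using finite_fibre by (simp add: P_def)
  have dP: "local_degree S T f p = 1" if "p \<in> P" for p
    using that uq noncritical_degree[of p] by (auto simp: P_def fibre_iff)
  have "(\<Sum>p\<in>fibre S f b. local_degree S T f p) = n"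
    using cover b(1) by (auto simp: branched_covering_def)
  also have "(\<Sum>p\<in>fibre S f b. local_degree S T f p) = local_degree S T f q + (\<Sum>p\<in>P. local_degree S T f p)"
    unfolding P_def using qX finite_fibre by (simp add: sum.remove)
  also have "\<dots> = 2 + card P" using simple q(1) dP by simp
  \<comment> \<open>The critical point counts twice and every other point once; comparison with the
    \<open>n\<close> points of a regular fibre will leave two for the disc.\<close>
  finally have n: "n = 2 + card P" by simp
  have "fibre S f b \<subseteq> topspace X" by (auto simp: fibre_iff)
  then obtain M where M: "\<And>p. p \<in> fibre S f b \<Longrightarrow> openin X (M p) \<and> p \<in> M p"
    "\<And>p p'. p \<in> fibre S f b \<Longrightarrow> p' \<in> fibre S f b \<Longrightarrow> p \<noteq> p' \<Longrightarrow> M p \<inter> M p' = {}"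
    using separate_points[OF finite_fibre] by metis
  \<comment> \<open>All other critical values are removed, so every point near \<open>b\<close>
    except \<open>b\<close> itself is regular.\<close>
  define U1 where "U1 = topspace Y - (critical_values S T f - {b})"
  have oU1: "openin Y U1"
  proof -
    have "finite (critical_values S T f - {b})"
      unfolding critical_values_def using finite_critical_points[OF compact] by simp
    moreover have "critical_values S T f - {b} \<subseteq> topspace Y"
      using f_in by (auto simp: critical_values_def critical_points_def)
    moreover have "Hausdorff_space Y" using RT by (simp add: riemann_surface_def)
    ultimately have "closedin Y (critical_values S T f - {b})"
      by (simp add: closedin_Hausdorff_finite)
    then show ?thesis unfolding U1_def by blast
  qed
  have U1: "b \<in> U1" "\<And>x. x \<in> U1 \<Longrightarrow> x \<noteq> b \<Longrightarrow> x \<in> reg"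
    using b(1) by (auto simp: U1_def regular_values_def)
  obtain \<sigma> U2 where U2: "openin Y U2" "b \<in> U2" "U2 \<subseteq> U1"
    "\<And>p. p \<in> P \<Longrightarrow> \<sigma> p \<in> inverse_branches S T f U2 \<and> \<sigma> p b = p \<and> openin X (\<sigma> p ` U2) \<and> \<sigma> p ` U2 \<subseteq> M p"
  proof (rule branches_through[OF b(1) _ _ oU1 U1(1), of P M])
    show "P \<subseteq> fibre S f b" by (auto simp: P_def)
    show "local_degree S T f p = 1 \<and> openin X (M p) \<and> p \<in> M p" if "p \<in> P" for p
      using that dP M(1) by (auto simp: P_def)
  qed blast
  have "openin X (M q \<inter> vim U2)" using M(1)[OF qX(2)] vim_open[OF U2(1)] by blast
  moreover have "q \<in> M q \<inter> vim U2" using M(1)[OF qX(2)] q(2) qX(1) U2(2) by (simp add: vim_def)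
  ultimately obtain N where N: "openin X N" "q \<in> N" "N \<subseteq> M q \<inter> vim U2" "connectedin X (N - {q})"
    by (rule punctured_disc_neighbourhood[OF RS])
  have fN: "f v \<in> U2 \<inter> reg" if v: "v \<in> N - {q}" for v
  proof -
    have v2: "f v \<in> U2" "v \<in> topspace X" "v \<in> M q" using v N(3) by (auto simp: vim_def)
    have "f v \<noteq> b"
    proof
      assume "f v = b"
      then have "v \<in> fibre S f b" using v2 by (simp add: fibre_iff)
      then show False using M(1)[of v] M(2)[of v q] v v2 qX(2) by blast
    qed
    then show ?thesis using v2 U1(2) U2(3) by blast
  qed
  have disjN: "\<sigma> p ` U2 \<inter> N = {}" if "p \<in> P" for p
  proof -
    have "M p \<inter> M q = {}" using M(2)[of p q] that qX(2) by (auto simp: P_def)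
    then show ?thesis using U2(4)[OF that] N(3) by blast
  qed
  have disjP: "\<sigma> p ` U2 \<inter> \<sigma> p' ` U2 = {}" if "p \<in> P" "p' \<in> P" "p \<noteq> p'" for p p'
  proof -
    have "M p \<inter> M p' = {}" using M(2)[of p p'] that by (auto simp: P_def)
    then show ?thesis using U2(4)[OF that(1)] U2(4)[OF that(2)] by blast
  qed
  \<comment> \<open>The disc together with the branch images is a neighbourhood of the whole fibre
    over \<open>b\<close>, so closedness of \<open>f\<close> confines nearby fibres to it.\<close>
  have "openin X (N \<union> (\<Union>p\<in>P. \<sigma> p ` U2))" using N(1) U2(4) by blast
  moreover have "fibre S f b \<subseteq> N \<union> (\<Union>p\<in>P. \<sigma> p ` U2)"
  proof
    fix p assume p: "p \<in> fibre S f b"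
    show "p \<in> N \<union> (\<Union>p\<in>P. \<sigma> p ` U2)"
    proof (cases "p = q")
      case False
      then have "p \<in> P" using p by (simp add: P_def)
      then have "p \<in> \<sigma> p ` U2" using U2(2,4) by (metis imageI)
      then show ?thesis using \<open>p \<in> P\<close> by blast
    qed (use N in simp)
  qed
  ultimately obtain V where V: "openin Y V" "b \<in> V"
     "\<And>p. p \<in> topspace X \<Longrightarrow> f p \<in> V \<Longrightarrow> p \<in> N \<union> (\<Union>p\<in>P. \<sigma> p ` U2)"
    using fibre_neighbourhood[OF b(1)] by (metis (no_types, lifting))
  define U where "U = V \<inter> U2"
  have oU: "openin Y U" "b \<in> U" using V U2 by (auto simp: U_def)
  have fib: "fibre S f x = (fibre S f x \<inter> N) \<union> (\<lambda>p. \<sigma> p x) ` P" and two: "card (fibre S f x \<inter> N) = 2"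
    if x: "x \<in> U" "x \<in> reg" for x
  proof -
    have xx: "x \<in> V" "x \<in> U2" using x by (auto simp: U_def)
    have sub: "(\<lambda>p. \<sigma> p x) ` P \<subseteq> fibre S f x"
      using U2(4) branchD(2,3) xx(2) by (force simp: fibre_iff)
    show eq: "fibre S f x = (fibre S f x \<inter> N) \<union> (\<lambda>p. \<sigma> p x) ` P"
    proof (intro equalityI subsetI)
      fix v assume v: "v \<in> fibre S f x"
      then have "v \<in> N \<union> (\<Union>p\<in>P. \<sigma> p ` U2)" using V(3)[of v] xx by (simp add: fibre_iff)
      moreover have "v \<in> (\<lambda>p. \<sigma> p x) ` P" if vp: "p \<in> P" "v \<in> \<sigma> p ` U2" for p
      proof -
        obtain y where y: "y \<in> U2" "v = \<sigma> p y" using vp by blast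
        have "f v = y" using branchD(3)[of "\<sigma> p" U2 y] U2(4)[OF vp(1)] y by simp
        then show ?thesis using v y vp(1) by (auto simp: fibre_iff)
      qed
      ultimately show "v \<in> (fibre S f x \<inter> N) \<union> (\<lambda>p. \<sigma> p x) ` P" using v by blast
    qed (use sub in blast)
    have inj: "inj_on (\<lambda>p. \<sigma> p x) P" using disjP xx(2) by (intro inj_onI) blast
    have "(fibre S f x \<inter> N) \<inter> (\<lambda>p. \<sigma> p x) ` P = {}" using disjN xx(2) by blast
    \<comment> \<open>The branches account for \<open>card P\<close> distinct points outside
      \<open>N\<close>, out of \<open>n = 2 + card P\<close>.\<close>
    then have "card (fibre S f x) = card (fibre S f x \<inter> N) + card P"
      using finite_fibre[of x] finP card_image[OF inj] by (subst eq) (simp add: card_Un_disjoint)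
    then show "card (fibre S f x \<inter> N) = 2" using card_fibre[OF x(2)] n by simp
  qed
  have relN: "rel u v" if uv: "u \<in> N" "v \<in> N" "f u = f v" "f u \<in> U \<inter> reg" for u v
  proof (cases "u = v")
    case True
    then show ?thesis using uv(1) openin_subset[OF N(1)] rel_refl by blast
  next
    case False
    have ux: "u \<in> fibre S f (f u) \<inter> N" "v \<in> fibre S f (f u) \<inter> N"
      using uv openin_subset[OF N(1)] by (auto simp: fibre_iff)
    have "card (fibre S f (f u) \<inter> N) = 2" using two uv(4) by blast
    then obtain a a' where "fibre S f (f u) \<inter> N = {a, a'}" unfolding card_2_iff by blast
    then have "fibre S f (f u) \<inter> N = {u, v}" using ux False by auto
    then have fu: "fibre S f (f u) = {u, v} \<union> (\<lambda>p. \<sigma> p (f u)) ` P" using fib uv(4) by blast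
    have "u \<noteq> q" "v \<noteq> q" using uv b(2) q(2) by auto
    show ?thesis
    proof (rule rel_near_critical_point[where N = N and q = q and U = U2 and P = P and \<sigma> = \<sigma>])
      show "f w \<in> U2 \<inter> reg" if "w \<in> N - {q}" for w using fN that .
      show "\<sigma> p \<in> inverse_branches S T f U2" if "p \<in> P" for p using U2(4)[OF that] by blast
      show "\<sigma> p ` U2 \<inter> N = {}" if "p \<in> P" for p using disjN that .
      show "\<sigma> p ` U2 \<inter> \<sigma> p' ` U2 = {}" if "p \<in> P" "p' \<in> P" "p \<noteq> p'" for p p' using disjP that .
    qed (use N U2(1) finP uv False fu \<open>u \<noteq> q\<close> \<open>v \<noteq> q\<close> in auto)
  qed
  have "trivial_over U"
  proof (rule trivial_overI[OF oU(1)])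
    fix p assume "p \<in> vim (U \<inter> reg)"
    then have p: "f p \<in> U" "f p \<in> reg" "p \<in> topspace X" by (auto simp: vim_def)
    then have "p \<in> (fibre S f (f p) \<inter> N) \<union> (\<lambda>j. \<sigma> j (f p)) ` P"
      using fib[OF p(1,2)] by (simp add: fibre_iff)
    then consider "p \<in> N" | j where "j \<in> P" "p = \<sigma> j (f p)" by blast
    then show "\<exists>D. openin X D \<and> p \<in> D \<and> (\<forall>x\<in>U \<inter> reg. \<exists>u\<in>D. f u = x) \<and>
       (\<forall>u\<in>D. \<forall>v\<in>D. f u = f v \<longrightarrow> f u \<in> U \<inter> reg \<longrightarrow> rel u v)"
    proof cases
      case 1
      have "\<exists>u\<in>N. f u = x" if x: "x \<in> U \<inter> reg" for x
      proof -
        have "fibre S f x \<inter> N \<noteq> {}" using two[of x] x by force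
        then show ?thesis by (auto simp: fibre_iff)
      qed
      then show ?thesis using N(1) 1 relN by (intro exI[of _ N]) blast
    next
      case 2
      note b = U2(4)[OF 2(1)]
      have "p \<in> \<sigma> j ` U2" using 2(2) p(1) by (auto simp: U_def)
      moreover have "\<exists>u\<in>\<sigma> j ` U2. f u = x" if "x \<in> U \<inter> reg" for x
        using that branchD(3)[of "\<sigma> j" U2] b by (auto simp: U_def)
      moreover have "rel u v" if "u \<in> \<sigma> j ` U2" "v \<in> \<sigma> j ` U2" "f u = f v" for u v
      proof -
        have "u = v" using that branchD(3)[of "\<sigma> j" U2] b by auto
        moreover have "u \<in> topspace X" using that branchD(2)[of "\<sigma> j" U2] b by auto
        ultimately show ?thesis using rel_refl by simp
      qed
      ultimately show ?thesis using b by (intro exI[of _ "\<sigma> j ` U2"]) blast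
    qed
  qed
  then show thesis using that oU by blast
qed

lemma trivial_nearby:
  assumes "z \<in> topspace Y" obtains U where "openin Y U" "z \<in> U" "trivial_over U"
  using trivial_near_regular trivial_near_critical_value assms by metis

section \<open>From global triviality to connectedness of the surface of tuples\<close>

lemma connectedin_regular_part: "connectedin X (vim reg)"
proof -
  have "vim reg = topspace X - (\<Union>z\<in>critical_values S T f. fibre S f z)"
    using f_in by (auto simp: vim_def regular_values_def fibre_iff)
  moreover have "finite (\<Union>z\<in>critical_values S T f. fibre S f z)"
    unfolding critical_values_def using finite_critical_points[OF compact] finite_fibre by simp
  moreover have "connectedin X (topspace X)" using connected by (simp add: connectedin_topspace)
  ultimately show ?thesis using connectedin_delete_finite[OF RS] by simp
qed

lemma rel_total:
  assumes t: "trivial_over (topspace Y)" and uv: "u \<in> vim reg" "v \<in> topspace X" "f u = f v"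
  shows "rel u v"
proof -
  have r: "topspace Y \<inter> reg = reg" using reg_topspace by blast
  obtain P where P: "u \<in> P" "slice reg P" using t uv(1) unfolding trivial_over_def r by blast
  have o: "openin X P" "openin X (vim reg - P)" "P \<subseteq> vim reg" using P(2) by (auto simp: slice_def)
  have "P = {} \<or> vim reg - P = {}"
    by (rule connectedin_clopen[OF connectedin_regular_part o(1,2)]) (use o(3) in auto)
  moreover have "v \<in> vim reg" using uv by (simp add: vim_def)
  ultimately have "v \<in> P" using P(1) by blast
  then show ?thesis using P uv unfolding slice_def by metis
qed

lemma no_separation:
  assumes t: "trivial_over (topspace Y)"
  shows "C = {} \<or> topspace (G k) - C = {}"
proof -
  \<comment> \<open>By \<open>all\<close>, every tuple over a given regular value has the same
    membership, so asking for some tuple is no loss. The function is read on the surface because the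
    connected set at hand is \<open>vim reg\<close>.\<close>
  define g where "g p = (\<exists>A. A \<subseteq> fibre S f (f p) \<and> card A = k \<and> in_part (f p) A)" for p
  have all: "in_part x A = in_part x A'"
    if x: "x \<in> reg" and A: "A \<subseteq> fibre S f x" "card A = k" "A' \<subseteq> fibre S f x" "card A' = k" for x A A'
  proof (rule card_subsets_swap_connected[OF finite_fibre A(1,3)])
    fix B a b assume B: "B \<subseteq> fibre S f x" "card B = card A'" and ab: "a \<in> fibre S f x" "b \<in> fibre S f x"
    have "rel a b" using rel_total[OF t] ab x by (simp add: vim_def fibre_iff)
    then show "in_part x B = in_part x (Transposition.transpose a b ` B)"
      using B ab A(4) unfolding rel_def fibre_iff by metis
  qed (use A in simp)
  have near: "\<exists>L. openin X L \<and> p \<in> L \<and> L \<subseteq> vim reg \<and> (\<forall>q\<in>L. g q = g p)" if p: "p \<in> vim reg" for p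
  proof -
    have x: "f p \<in> reg" "p \<in> topspace X" using p by (auto simp: vim_def)
    obtain \<sigma> W where "rel_constant_on (f p) \<sigma> W" using rel_constant_nearby[OF x(1)] by blast
    note s = rel_constant_onD[OF this]
    have "g q = g p" if q: "q \<in> vim W" for q
    proof -
      have y: "f q \<in> W" "f q \<in> reg" using q s(3) by (auto simp: vim_def)
      note bij = s(5)[OF y(1)]
      show ?thesis
      proof
        assume "g p"
        then obtain A where A: "A \<subseteq> fibre S f (f p)" "card A = k" "in_part (f p) A" by (auto simp: g_def)
        then have "in_part (f q) ((\<lambda>a. \<sigma> a (f q)) ` A)" using s(6)[OF y(1)] by simp
        moreover have "(\<lambda>a. \<sigma> a (f q)) ` A \<subseteq> fibre S f (f q)" using bij A(1) by (auto simp: bij_betw_def)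
        moreover have "card ((\<lambda>a. \<sigma> a (f q)) ` A) = k"
          using bij A(1,2) by (metis bij_betw_def card_image inj_on_subset)
        ultimately show "g q" unfolding g_def by blast
      next
        assume "g q"
        then obtain B where B: "B \<subseteq> fibre S f (f q)" "card B = k" "in_part (f q) B" by (auto simp: g_def)
        then obtain A where A: "A \<subseteq> fibre S f (f p)" "B = (\<lambda>a. \<sigma> a (f q)) ` A"
          using bij unfolding bij_betw_def by (metis subset_imageE)
        then have "card A = k" using bij B(2) by (metis bij_betw_def card_image inj_on_subset)
        then have "in_part (f p) A" using s(6)[OF y(1) A(1)] B(3) A(2) by simp
        then show "g p" unfolding g_def using A(1) \<open>card A = k\<close> by blast
      qed
    qed
    moreover have "p \<in> vim W" "vim W \<subseteq> vim reg" using s(2,3) x by (auto simp: vim_def)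
    ultimately show ?thesis using vim_open[OF s(1)] by blast
  qed
  let ?A = "{p \<in> vim reg. g p}" and ?B = "{p \<in> vim reg. \<not> g p}"
  have "openin X ?A"
  proof (subst openin_subopen, intro ballI)
    fix v assume v: "v \<in> ?A"
    then obtain L where "openin X L" "v \<in> L" "L \<subseteq> vim reg" "\<forall>w\<in>L. g w = g v" using near by blast
    then show "\<exists>L. openin X L \<and> v \<in> L \<and> L \<subseteq> ?A" using v by (intro exI[of _ L]) blast
  qed
  moreover have "openin X ?B"
  proof (subst openin_subopen, intro ballI)
    fix v assume v: "v \<in> ?B"
    then obtain L where "openin X L" "v \<in> L" "L \<subseteq> vim reg" "\<forall>w\<in>L. g w = g v" using near by blast
    then show "\<exists>L. openin X L \<and> v \<in> L \<and> L \<subseteq> ?B" using v by (intro exI[of _ L]) blast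
  qed
  moreover have "vim reg = ?A \<union> ?B" "?A \<inter> ?B = {}" by blast+
  ultimately have AB: "?A = {} \<or> ?B = {}" by (rule connectedin_clopen[OF connectedin_regular_part])
  have tup: "\<exists>p. p \<in> vim reg \<and> (g p \<longleftrightarrow> y \<in> C)" if y: "y \<in> topspace (G k)" for y
  proof -
    obtain x A where x: "y = (x, point_germ ` A)" "x \<in> reg" "A \<subseteq> fibre S f x" "card A = k"
      using y unfolding topspace_germ_surface by blast
    \<comment> \<open>Positive \<open>k\<close> supplies a point of the surface above
      \<open>x\<close> at which \<open>g\<close> can be evaluated.\<close>
    then have "A \<noteq> {}" using k_pos by auto
    then obtain p where p: "p \<in> A" by blast
    then have fp: "f p = x" "p \<in> vim reg" using x by (auto simp: fibre_iff vim_def)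
    have "g p \<longleftrightarrow> in_part x A" unfolding g_def fp using all[OF x(2)] x(3,4) by blast
    then show ?thesis using fp x(1) by (auto simp: in_part_def)
  qed
  have "C \<subseteq> topspace (G k)" using C by (rule openin_subset)
  then show ?thesis using AB tup by blast
qed

end

section \<open>Simple connectivity of the sphere\<close>

text \<open>Rectangles are convenient for gluing: the overlap of two rectangles is again one, hence
  connected.\<close>

definition rect :: "real \<Rightarrow> real \<Rightarrow> real \<Rightarrow> real \<Rightarrow> complex set" where
  "rect a b c d = {w. a < Re w \<and> Re w < b \<and> c < Im w \<and> Im w < d}"

lemma rect: "open (rect a b c d)" "connected (rect a b c d)"
proof -
  have "rect a b c d = box (Complex a c) (Complex b d)"
    by (auto simp: rect_def in_box_complex_iff)
  then show "open (rect a b c d)" "connected (rect a b c d)" by (auto simp: convex_connected)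
qed

lemma rect_nonempty: "a < b \<Longrightarrow> c < d \<Longrightarrow> rect a b c d \<noteq> {}"
proof -
  assume "a < b" "c < d"
  then have "Complex ((a + b) / 2) ((c + d) / 2) \<in> rect a b c d" by (simp add: rect_def)
  then show ?thesis by blast
qed

lemma rect_openin: "openin sphere_top (Some ` rect a b c d)"
  using rect(1) by simp

locale sphere_split = simple_split S riemann_sphere f n k C
  for S :: "'a surface" and f n k and C :: "('a, complex option) germ_tuple set"
begin

text \<open>The critical values are finite in number, and a nonempty connected open set in the plane
  stays connected and nonempty without them.\<close>

lemma glue_plane:
  assumes "trivial_over A1" "trivial_over A2" "openin sphere_top A1" "openin sphere_top A2"
    and W: "A1 \<inter> A2 = Some ` W" "open W" "connected W" "W \<noteq> {}"
  shows "trivial_over (A1 \<union> A2)"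
proof -
  define Z where "Z = {w. Some w \<in> critical_values S riemann_sphere f}"
  have "finite (critical_values S riemann_sphere f)"
    unfolding critical_values_def using finite_critical_points[OF compact] by simp
  then have Z: "finite Z" unfolding Z_def by (rule finite_vimageI[unfolded vimage_def]) simp
  have eq: "A1 \<inter> A2 \<inter> reg = Some ` (W - Z)"
    unfolding W(1) by (auto simp: regular_values_def surf_top_sphere topspace_sphere Z_def)
  have "connected (W - Z)" using W Z by (intro connected_open_delete_finite) auto
  then have "connectedin sphere_top (Some ` (W - Z))"
    using connectedin_continuous_map_image[OF continuous_map_Some] by (metis connectedin_iff_connected)
  moreover have "W - Z \<noteq> {}"
    using W(2,4) Z by (metis Diff_eq_empty_iff finite_imp_not_open finite_subset)
  ultimately show ?thesis
    using trivial_over_glue[of A1 A2] assms(1-4) eq by (simp add: surf_top_sphere)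
qed

lemma trivial_rect_subset:
  assumes "trivial_over (Some ` rect a b c d)" "a \<le> a'" "b' \<le> b" "c \<le> c'" "d' \<le> d"
  shows "trivial_over (Some ` rect a' b' c' d')"
proof (rule trivial_over_subset[OF assms(1)])
  show "openin (surf_top riemann_sphere) (Some ` rect a' b' c' d')"
    unfolding surf_top_sphere by (rule rect_openin)
  show "Some ` rect a' b' c' d' \<subseteq> Some ` rect a b c d" using assms by (auto simp: rect_def)
qed

text \<open>Bisection of the segment: sufficiently short pieces lie in one trivial neighbourhood,
  and adjacent thickened pieces, cut to a common margin, overlap in a rectangle.\<close>

lemma trivial_near_segment:
  assumes "a \<le> b"
  shows "\<exists>e>0. trivial_over (Some ` rect (a - e) (b + e) (y - e) (y + e))"
  using assms
proof (induction rule: Bolzano)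
  case (trans a b c)
  then obtain e1 e2 where e: "e1 > 0" "e2 > 0" "trivial_over (Some ` rect (a - e1) (b + e1) (y - e1) (y + e1))"
    "trivial_over (Some ` rect (b - e2) (c + e2) (y - e2) (y + e2))" by blast
  define e where "e = min e1 e2"
  have e0: "e > 0" "e \<le> e1" "e \<le> e2" using e by (auto simp: e_def)
  let ?A = "rect (a - e) (b + e) (y - e) (y + e)" and ?B = "rect (b - e) (c + e) (y - e) (y + e)"
  have "trivial_over (Some ` ?A \<union> Some ` ?B)"
  proof (rule glue_plane[of _ _ "rect (b - e) (b + e) (y - e) (y + e)"])
    show "trivial_over (Some ` ?A)" by (rule trivial_rect_subset[OF e(3)]) (use e0 in auto)
    show "trivial_over (Some ` ?B)" by (rule trivial_rect_subset[OF e(4)]) (use e0 in auto)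
    show "Some ` ?A \<inter> Some ` ?B = Some ` rect (b - e) (b + e) (y - e) (y + e)"
      using trans(3,4) by (auto simp: rect_def image_iff)
    show "rect (b - e) (b + e) (y - e) (y + e) \<noteq> {}" using e0 by (intro rect_nonempty) auto
  qed (rule rect_openin rect)+
  moreover have "Some ` ?A \<union> Some ` ?B = Some ` rect (a - e) (c + e) (y - e) (y + e)"
    using trans(3,4) e0 by (auto simp: rect_def image_iff)
  ultimately show ?case using e0 by auto
next
  case (local x)
  obtain U where U: "openin sphere_top U" "Some (Complex x y) \<in> U" "trivial_over U"
    using trivial_nearby[of "Some (Complex x y)"] by (auto simp: surf_top_sphere topspace_sphere)
  then have "open (Some -` U)" by (simp add: openin_sphere_iff)
  then obtain r where r: "r > 0" "ball (Complex x y) r \<subseteq> Some -` U" using U(2) openE by blast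
  \<comment> \<open>Points of the thickened piece are within \<open>2 * e\<close> of the centre
    horizontally and within \<open>e\<close> vertically, and \<open>3 * e < r\<close>.\<close>
  define e where "e = r / 4"
  have e: "e > 0" using r by (simp add: e_def)
  have *: "trivial_over (Some ` rect (a - e) (b + e) (y - e) (y + e))"
    if ab: "a \<le> x" "x \<le> b" "b - a < e" for a b
  proof (rule trivial_over_subset[OF U(3)])
    show "openin (surf_top riemann_sphere) (Some ` rect (a - e) (b + e) (y - e) (y + e))"
      unfolding surf_top_sphere by (rule rect_openin)
    show "Some ` rect (a - e) (b + e) (y - e) (y + e) \<subseteq> U"
    proof clarify
      fix w assume w: "w \<in> rect (a - e) (b + e) (y - e) (y + e)"
      have "norm (Complex x y - w) \<le> \<bar>x - Re w\<bar> + \<bar>y - Im w\<bar>"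
        using cmod_le[of "Complex x y - w"] by simp
      also have "\<dots> < 2 * e + e" using w ab unfolding rect_def by auto
      also have "\<dots> < r" using r by (simp add: e_def)
      finally show "Some w \<in> U" using r(2) by (auto simp: dist_norm)
    qed
  qed
  show ?case using e * by (intro exI[of _ e]) auto
qed

text \<open>The same bisection in the vertical direction, with the thickened horizontal segments in
  the role of small neighbourhoods.\<close>

lemma trivial_near_square:
  assumes "r > 0" shows "\<exists>e>0. trivial_over (Some ` rect (- r - e) (r + e) (- r - e) (r + e))"
proof -
  have "\<exists>e>0. trivial_over (Some ` rect (- r - e) (r + e) (c - e) (d + e))" if "c \<le> d" for c d
    using that
  proof (induction rule: Bolzano)
    case (trans a b c)
    then obtain e1 e2 where e: "e1 > 0" "e2 > 0" "trivial_over (Some ` rect (- r - e1) (r + e1) (a - e1) (b + e1))"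
      "trivial_over (Some ` rect (- r - e2) (r + e2) (b - e2) (c + e2))" by blast
    define e where "e = min e1 e2"
    have e0: "e > 0" "e \<le> e1" "e \<le> e2" using e by (auto simp: e_def)
    let ?A = "rect (- r - e) (r + e) (a - e) (b + e)" and ?B = "rect (- r - e) (r + e) (b - e) (c + e)"
    have "trivial_over (Some ` ?A \<union> Some ` ?B)"
    proof (rule glue_plane[of _ _ "rect (- r - e) (r + e) (b - e) (b + e)"])
      show "trivial_over (Some ` ?A)" by (rule trivial_rect_subset[OF e(3)]) (use e0 in auto)
      show "trivial_over (Some ` ?B)" by (rule trivial_rect_subset[OF e(4)]) (use e0 in auto)
      show "Some ` ?A \<inter> Some ` ?B = Some ` rect (- r - e) (r + e) (b - e) (b + e)"
        using trans(3,4) by (auto simp: rect_def image_iff)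
      show "rect (- r - e) (r + e) (b - e) (b + e) \<noteq> {}" using e0 assms by (intro rect_nonempty) auto
    qed (rule rect_openin rect)+
    moreover have "Some ` ?A \<union> Some ` ?B = Some ` rect (- r - e) (r + e) (a - e) (c + e)"
      using trans(3,4) e0 by (auto simp: rect_def image_iff)
    ultimately show ?case using e0 by auto
  next
    case (local y)
    have "- r \<le> r" using assms by simp
    from trivial_near_segment[OF this, of y] obtain e where
      e: "e > 0" "trivial_over (Some ` rect (- r - e) (r + e) (y - e) (y + e))" by blast
    \<comment> \<open>Half of the margin absorbs the height of the piece, the other half remains as
      its thickening.\<close>
    have "trivial_over (Some ` rect (- r - e/2) (r + e/2) (c - e/2) (d + e/2))"
      if "c \<le> y" "y \<le> d" "d - c < e/2" for c d
      by (rule trivial_rect_subset[OF e(2)]) (use that e(1) in \<open>auto simp: field_simps\<close>)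
    then show ?case using e(1) by (intro exI[of _ "e/2"]) (auto intro!: exI[of _ "e/2"])
  qed
  then show ?thesis using assms by simp
qed

text \<open>A disc and a neighbourhood of infinity overlap in an annulus. Both pieces are already
  trivial, so for gluing the annulus need only be connected.\<close>

lemma trivial_over_sphere: "trivial_over UNIV"
proof -
  obtain U where U: "openin sphere_top U" "None \<in> U" "trivial_over U"
    using trivial_nearby[of None] by (auto simp: surf_top_sphere topspace_sphere)
  then obtain B where B: "\<And>w. B < norm w \<Longrightarrow> Some w \<in> U" by (auto simp: openin_sphere_iff)
  \<comment> \<open>\<open>B\<close> may be negative; the maximum makes the radii of the disc and of
    the annulus positive.\<close>
  define r where "r = max B 1"
  have r: "r \<ge> 1" "B \<le> r" by (auto simp: r_def)
  let ?O = "- (Some ` cball (0 :: complex) r)" and ?D = "Some ` ball (0 :: complex) (r + 1)"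
  have oO: "openin sphere_top ?O"
  proof -
    have "Some -` ?O = - cball (0 :: complex) r" by auto
    then show ?thesis unfolding openin_sphere_iff
      by (auto intro!: exI[of _ r] simp: open_Compl)
  qed
  have "?O \<subseteq> U"
  proof
    fix z assume "z \<in> ?O"
    then show "z \<in> U" using B U(2) r(2) by (cases z) (auto simp: image_iff)
  qed
  then have tO: "trivial_over ?O" using trivial_over_subset[OF U(3)] oO by (simp add: surf_top_sphere)
  obtain e where e: "e > 0" "trivial_over (Some ` rect (- (r + 1) - e) ((r + 1) + e) (- (r + 1) - e) ((r + 1) + e))"
    using trivial_near_square[of "r + 1"] r by auto
  have "ball 0 (r + 1) \<subseteq> rect (- (r + 1) - e) ((r + 1) + e) (- (r + 1) - e) ((r + 1) + e)"
  proof
    fix w :: complex assume "w \<in> ball 0 (r + 1)"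
    then have "norm w < r + 1" by simp
    then show "w \<in> rect (- (r + 1) - e) ((r + 1) + e) (- (r + 1) - e) ((r + 1) + e)"
      using abs_Re_le_cmod[of w] abs_Im_le_cmod[of w] e(1) by (auto simp: rect_def abs_le_iff)
  qed
  then have tD: "trivial_over ?D"
    by (intro trivial_over_subset[OF e(2)]) (auto simp: surf_top_sphere)
  let ?W = "{w :: complex. r < norm w \<and> norm w < r + 1}"
  have "trivial_over (?O \<union> ?D)"
  proof (rule glue_plane[OF tO tD oO])
    show "openin sphere_top ?D" by simp
    show "?O \<inter> ?D = Some ` ?W" by (auto simp: image_iff)
    show "open ?W" by (intro open_Collect_conj open_Collect_less continuous_intros)
    show "connected ?W" using connected_annulus(1)[where 'N=complex, of r 0 "r + 1"] by simp
    have "of_real (r + 1/2) \<in> ?W" using r by (simp add: norm_of_real del: of_real_add)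
    then show "?W \<noteq> {}" by blast
  qed
  moreover have "z \<in> ?O \<union> ?D" for z by (cases z) (auto simp: image_iff)
  then have "?O \<union> ?D = UNIV" by blast
  ultimately show ?thesis by simp
qed

lemma sphere_no_separation: "C = {} \<or> topspace (G k) - C = {}"
proof -
  have "topspace (surf_top riemann_sphere) = UNIV" by (simp only: surf_top_sphere topspace_sphere)
  then show ?thesis using no_separation trivial_over_sphere by simp
qed

end

section \<open>Filling the punctures\<close>

context compact_cover
begin

lemma germ_sheet_open:
  assumes "branch_tuple S T f k U F" shows "openin (G k) (germ_sheet T U F)"
proof -
  have "openin (topology_generated_by {germ_sheet T U F |U F. branch_tuple S T f k U F}) (germ_sheet T U F)"
    using assms by (intro topology_generated_by_Basis) blast
  moreover have "germ_sheet T U F \<subseteq> germ_tuples S T f k"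
  proof -
    have "U \<subseteq> topspace Y" using assms openin_subset by (auto simp: branch_tuple_def)
    then have "germ_sheet T U F \<subseteq> topspace (G k)"
      using continuous_map_image_subset_topspace[OF sheet_continuous[OF assms]]
      by (simp add: germ_sheet_def inf.absorb2)
    then show ?thesis by (auto simp: germ_surface_def)
  qed
  ultimately show ?thesis
    unfolding germ_surface_def surface.simps openin_subtopology by blast
qed

text \<open>Local connectedness of the surface of tuples, obtained by restricting a sheet to a
  connected coordinate neighbourhood in the base.\<close>

lemma connected_sheet_through:
  assumes y: "y \<in> topspace (G k)" "fst y \<in> V" and V: "openin Y V"
  obtains Z where "openin (G k) Z" "y \<in> Z" "connectedin (G k) Z" "fst ` Z \<subseteq> V \<inter> reg"
proof -
  obtain x A where x: "y = (x, point_germ ` A)" "x \<in> reg" "A \<subseteq> fibre S f x" "card A = k"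
    using y(1) unfolding topspace_germ_surface by blast
  obtain \<sigma> U where s: "openin Y U" "x \<in> U" "U \<subseteq> V \<inter> reg" "branch_tuple S T f (card A) U (\<sigma> ` A)"
     "\<And>p. p \<in> A \<Longrightarrow> \<sigma> p \<in> inverse_branches S T f U \<and> \<sigma> p x = p"
  proof (rule branch_tuple_near[OF x(2,3), of "V \<inter> reg" "\<lambda>_. topspace X"])
    show "openin X (topspace X) \<and> p \<in> topspace X" if "p \<in> A" for p
      using that x(3) by (auto simp: fibre_iff)
    show "openin Y (V \<inter> reg)" using V reg_open by blast
    show "x \<in> V \<inter> reg" using x y(2) by simp
  qed blast
  obtain N where N: "openin Y N" "x \<in> N" "N \<subseteq> U" "connectedin Y N"
    using punctured_disc_neighbourhood[OF RT s(1,2)] by metis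
  have bt: "branch_tuple S T f k N (\<sigma> ` A)"
    using s(3,4) N(1,3) x(4) branch_subset[OF _ N(1,3)] unfolding branch_tuple_def by blast
  let ?Z = "germ_sheet T N (\<sigma> ` A)"
  show thesis
  proof
    show "openin (G k) ?Z" by (rule germ_sheet_open[OF bt])
    have "germ T x ` (\<sigma> ` A) = point_germ ` A"
      using germ_point[OF _ s(2) x(2)] s(5) by (force simp: image_image intro!: image_cong)
    then show "y \<in> ?Z" unfolding germ_sheet_def x(1) using N(2) by (intro image_eqI[of _ _ x]) auto
    have "connectedin (subtopology Y N) N" using N(4) by (simp add: connectedin_subtopology)
    then show "connectedin (G k) ?Z"
      unfolding germ_sheet_def by (rule connectedin_continuous_map_image[OF sheet_continuous[OF bt]])
    show "fst ` ?Z \<subseteq> V \<inter> reg" using N(3) s(3) by (auto simp: germ_sheet_def)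
  qed
qed

text \<open>Components of an open part of a locally connected space are open. The neighbourhoods of
  ends are built from these components, so continuity of \<open>Inl\<close> depends on it.\<close>

lemma component_over_open:
  assumes V: "openin Y V" and K: "K \<in> components_over (germ_surface S T f k) fst (critical_values S T f) V"
  shows "openin (G k) K"
proof (subst openin_subopen, intro ballI)
  let ?D = "{y \<in> topspace (G k). fst y \<in> V - critical_values S T f}"
  have K': "K \<in> connected_components_of (subtopology (G k) ?D)" using K by (simp add: components_over_def)
  fix y assume y: "y \<in> K"
  have "K \<subseteq> topspace (subtopology (G k) ?D)" using K' by (rule connected_components_of_subset)
  then have yD: "y \<in> topspace (G k)" "fst y \<in> V" using y by auto
  obtain Z where Z: "openin (G k) Z" "y \<in> Z" "connectedin (G k) Z" "fst ` Z \<subseteq> V \<inter> reg"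
    using connected_sheet_through[OF yD V] .
  have "Z \<subseteq> ?D" using openin_subset[OF Z(1)] Z(4) by (auto simp: regular_values_def)
  then have "connectedin (subtopology (G k) ?D) Z" using Z(3) by (simp add: connectedin_subtopology)
  moreover have "\<not> disjnt K Z" using y Z(2) unfolding disjnt_def by blast
  ultimately have "Z \<subseteq> K" using connected_components_of_maximal[OF K'] by blast
  then show "\<exists>Z. openin (G k) Z \<and> y \<in> Z \<and> Z \<subseteq> K" using Z by blast
qed

text \<open>The added points do not affect connectedness: every neighbourhood of an end \<open>e\<close> contains
  a whole component \<open>e V\<close>, so the unbranched part is dense.\<close>

lemma filled_connected:
  assumes con: "connected_space (G k)"
  shows "connected_space (filled_topology (germ_surface S T f k) T fst (critical_values S T f))"
proof -
  let ?S = "germ_surface S T f k" and ?B = "critical_values S T f"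
  let ?F = "filled_topology ?S T fst ?B"
  define basis where "basis = {Inl ` U | U. openin (G k) U} \<union>
        {Inl ` K \<union> {Inr (b, e) | e. e \<in> ends_over ?S T fst ?B b \<and> e V = K} | K b V.
           b \<in> ?B \<and> openin Y V \<and> b \<in> V \<and> K \<in> components_over ?S fst ?B V}"
  have F: "?F = topology_generated_by basis" by (simp add: filled_topology_def basis_def)
  have comp: "openin (G k) K" if "openin Y V" "K \<in> components_over ?S fst ?B V" for K V
    using component_over_open that .
  \<comment> \<open>A basic neighbourhood of ends meets the unbranched part in a single component,
    which is open.\<close>
  have "continuous_map (G k) ?F Inl"
    unfolding F
  proof (rule continuous_on_generated_topo)
    fix E assume "E \<in> basis"
    then consider U where "openin (G k) U" "E = Inl ` U"
      | K b V where "openin Y V" "K \<in> components_over ?S fst ?B V"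
        "E = Inl ` K \<union> {Inr (b, e) | e. e \<in> ends_over ?S T fst ?B b \<and> e V = K}"
      unfolding basis_def by blast
    then show "openin (G k) (Inl -` E \<inter> topspace (G k))"
    proof cases
      case 1
      then have "Inl -` E \<inter> topspace (G k) = U" using openin_subset[OF 1(1)] by auto
      then show ?thesis using 1 by simp
    next
      case 2
      have "Inl -` E \<inter> topspace (G k) = K" using 2 openin_subset[OF comp[OF 2(1,2)]] by auto
      then show ?thesis using comp[OF 2(1,2)] by simp
    qed
  next
    have "Inl ` topspace (G k) \<in> basis" unfolding basis_def by blast
    then show "Inl ` topspace (G k) \<subseteq> \<Union> basis" by blast
  qed
  then have c1: "connectedin ?F (Inl ` topspace (G k))"
    using connectedin_continuous_map_image con by (metis connectedin_topspace)
  \<comment> \<open>The generating sets are only a subbasis, so the claim that an open set around an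
    end contains a whole \<open>e V\<close> is carried through finite intersections and
    unions.\<close>
  have inv: "(\<forall>y. Inl y \<in> E \<longrightarrow> y \<in> topspace (G k)) \<and>
      (\<forall>b e. Inr (b, e) \<in> E \<longrightarrow> e \<in> ends_over ?S T fst ?B b \<and> (\<exists>V. openin Y V \<and> b \<in> V \<and> Inl ` e V \<subseteq> E))"
    if "openin ?F E" for E
  proof -
    have "generate_topology_on basis E" using that unfolding F by (rule openin_topology_generated_by)
    then show ?thesis
    proof (induction rule: generate_topology_on.induct)
      case (Int E1 E2)
      have ex: "\<exists>V. openin Y V \<and> b \<in> V \<and> Inl ` e V \<subseteq> E1 \<inter> E2" if be: "Inr (b, e) \<in> E1 \<inter> E2" for b e
      proof -
        obtain V1 V2 where V: "openin Y V1" "b \<in> V1" "Inl ` e V1 \<subseteq> E1" "openin Y V2" "b \<in> V2" "Inl ` e V2 \<subseteq> E2"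
          using Int be by blast
        have e: "e \<in> ends_over ?S T fst ?B b" using Int be by blast
        have o: "openin Y (V1 \<inter> V2)" using V by blast
        \<comment> \<open>Coherence of the end: its component over a smaller neighbourhood lies
          inside those over the larger ones.\<close>
        have "e (V1 \<inter> V2) \<subseteq> e V1" "e (V1 \<inter> V2) \<subseteq> e V2"
          using e V o unfolding ends_over_def by (auto simp del: openin_Int)
        then show ?thesis using V o by (intro exI[of _ "V1 \<inter> V2"]) blast
      qed
      show ?case
      proof (intro conjI allI impI)
        show "y \<in> topspace (G k)" if "Inl y \<in> E1 \<inter> E2" for y using conjunct1[OF Int(3)] that by blast
        show "e \<in> ends_over ?S T fst ?B b" if "Inr (b, e) \<in> E1 \<inter> E2" for b e using conjunct2[OF Int(3)] that by blast
      qed (rule ex)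
    next
      case (UN \<K>)
      then show ?case by (meson Sup_upper UnionE UnionI subset_trans)
    next
      case (Basis E)
      then consider U where "openin (G k) U" "E = Inl ` U"
        | K b V where "openin Y V" "b \<in> V" "K \<in> components_over ?S fst ?B V"
          "E = Inl ` K \<union> {Inr (b, e) | e. e \<in> ends_over ?S T fst ?B b \<and> e V = K}"
        unfolding basis_def by blast
      then show ?case
      proof cases
        case 1 then show ?thesis using openin_subset[OF 1(1)] by auto
      next
        case 2 then show ?thesis using openin_subset[OF comp[OF 2(1,3)]] by auto
      qed
    qed simp
  qed
  have "?F closure_of (Inl ` topspace (G k)) = topspace ?F"
    unfolding dense_intersects_open
  proof (intro allI impI)
    fix E assume E: "openin ?F E \<and> E \<noteq> {}"
    then obtain z where z: "z \<in> E" by blast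
    show "Inl ` topspace (G k) \<inter> E \<noteq> {}"
    proof (cases z)
      case (Inl y)
      then show ?thesis using z inv E by blast
    next
      case (Inr be)
      obtain b e where be: "be = (b, e)" by (cases be)
      have "Inr (b, e) \<in> E" using z Inr be by simp
      with conjunct2[OF inv[OF conjunct1[OF E]], rule_format, OF this]
      obtain V where V: "e \<in> ends_over ?S T fst ?B b" "openin Y V" "b \<in> V" "Inl ` e V \<subseteq> E"
        by blast
      have "e V \<in> components_over ?S fst ?B V" using V(1-3) by (auto simp: ends_over_def)
      then have "e V \<noteq> {}" "e V \<subseteq> topspace (G k)"
        using openin_subset[OF comp[OF V(2)]] unfolding components_over_def
        by (auto dest: nonempty_connected_components_of)
      then show ?thesis using V(4) by blast
    qed
  qed
  then show ?thesis using connectedin_closure_of[OF c1] by (simp add: connectedin_topspace)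
qed

end

theorem mainTheorem4:
  fixes R :: "'a surface" and \<pi> :: "'a \<Rightarrow> complex option" and m :: nat
  assumes "riemann_surface R"
    and "compact_space (surf_top R)"
    and "connected_space (surf_top R)"
    and "1 \<le> m"
    and "branched_covering R riemann_sphere \<pi> (m + 1)"
    and "\<forall>p\<in>critical_points R riemann_sphere \<pi>. local_degree R riemann_sphere \<pi> p = 2"
    and "\<forall>z\<in>topspace (surf_top riemann_sphere).
           \<exists>\<^sub>\<le>\<^sub>1p. p \<in> critical_points R riemann_sphere \<pi> \<inter> fibre R \<pi> z"
  shows "\<forall>k\<in>{1..m}. connected_space (surf_top (tuple_surface R riemann_sphere \<pi> k))"
proof
  fix k assume k: "k \<in> {1..m}"
  interpret compact_cover R riemann_sphere \<pi> "m + 1"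
    by unfold_locales (use assms riemann_surface_sphere in auto)
  have "connected_space (G k)"
    unfolding connected_space_def
  proof
    assume "\<exists>E1 E2. openin (G k) E1 \<and> openin (G k) E2 \<and> topspace (G k) \<subseteq> E1 \<union> E2 \<and>
      E1 \<inter> E2 = {} \<and> E1 \<noteq> {} \<and> E2 \<noteq> {}"
    then obtain E1 E2 where E: "openin (G k) E1" "openin (G k) E2" "topspace (G k) \<subseteq> E1 \<union> E2"
      "E1 \<inter> E2 = {}" "E1 \<noteq> {}" "E2 \<noteq> {}" by blast
    have E2: "topspace (G k) - E1 = E2" using E openin_subset[OF E(2)] by blast
    \<comment> \<open>One side of the supposed separation serves as the clopen part from which the
      relation is formed.\<close>
    interpret sphere_split R \<pi> "m + 1" k E1
      by unfold_locales (use assms k E E2 in auto)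
    show False using sphere_no_separation E E2 by blast
  qed
  then show "connected_space (surf_top (tuple_surface R riemann_sphere \<pi> k))"
    unfolding tuple_surface_def fill_punctures_def surface.simps by (rule filled_connected)
qed

end
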